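(* For every $d\ge 3$, the two morphisms $\Psi$ and $\Phi$ from $\mathbf{R}_d$ to $\mathbb{P}(S^{d-2}S_2)$ are equal.
   Context: Work over $\mathbb{C}$. $S_n$ is the irreducible representation of $SL_2$ of dimension $n+1$, identified with its dual by the $SL_2$-invariant bilinear form. $V=H^0(\mathbb{P}^3,\mathcal{O}(1))$. $q$ is the quadratic form on $\Lambda^2V$ given by the wedge product (used to identify $\Lambda^2V$ with $\Lambda^2 V^\vee$), and $\mathbb{G}\subset\mathbb{P}(\Lambda^2V)$ is the quadric it defines, i.e. the Grassmannian of lines of $\mathbb{P}^3$, with tautological sequence $0\to K\to V\otimes\mathcal{O}_{\mathbb{G}}\to Q\to 0$. $\mathbf{R}_d$ is the open subset of $\mathrm{Mor}_d(\mathbb{P}^1,\mathbb{G})$ (morphisms of degree $d$) of those $f$ such that $f(\mathbb{P}^1)$ is not contained in a plane totally isotropic for $q$. Definition of $\Psi$: let $I\subset S^2\mathbb{P}^1\times\mathbb{P}^1$ be the incidence variety divisor/point, with projections $s:I\to S^2\mathbb{P}^1=\mathbb{P}(S_2)$ and $r:I\to\mathbb{P}^1$. For $f\in\mathbf{R}_d$ let $R$ be the cokernel of $V\otimes\mathcal{O}_{\mathbb{P}(S_2)}\to V\otimes s_*r^*\mathcal{O}_{\mathbb{P}^1}\to s_*r^*(f^*Q)$. Then $\Psi(f)$ is the curve of degree $d-2$ of $\mathbb{P}(S_2)$ defined by the $0$-th Fitting ideal of $R$, a point of $\mathbb{P}(S^{d-2}S_2)$. Definition of $\Phi$: a morphism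 $f\in\mathrm{Mor}_d(\mathbb{P}^1,\mathbb{P}(\Lambda^2V))$ is given by a surjection $\Lambda^2V\otimes\mathcal{O}_{\mathbb{P}^1}\to\mathcal{O}_{\mathbb{P}^1}(d)$, hence, on sections, by $\psi\in\mathbb{P}(\mathrm{Hom}(\Lambda^2V,S_d))$; thus $\mathbf{R}_d\subset\mathbb{P}(\mathrm{Hom}(\Lambda^2V,S_d))$. Put $\Phi(\psi)=\psi\, q\,{}^t\psi\in\mathbb{P}(S^2S_d)$ (the pull-back of $q$ by the projection $\mathbb{P}(S_d)\dashrightarrow\mathbb{P}(\Lambda^2V)$). For $f\in\mathbf{R}_d$ the quadric $\Phi(f)$ contains the rational normal curve $C_d\subset\mathbb{P}(S_d)$; the space of quadrics containing $C_d$ is $\mathbb{P}(H^0\mathcal{I}_{C_d}(2))\simeq\mathbb{P}(S^2S_{d-2})$, identified with $\mathbb{P}(S^{d-2}S_2)$ by Hermite reciprocity. Geometrically this identification sends a quadric $A\supset C_d$ to the curve of degree $d-2$ $\{(x,y)\in S^2C_d=S^2\mathbb{P}^1 : \text{the line } (xy)\text{ is isotropic for } A\}$. *)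

theory Defs
  imports
    Complex_Main
    "HOL-Library.Function_Algebras"
    "HOL-Library.FuncSet"
    "Jordan_Normal_Form.Determinant"
    "Jordan_Normal_Form.DL_Rank"
begin

text \<open>
  Points of \<open>\<bbbP>\<^sup>1\<close> and of \<open>\<bbbP>(S\<^sub>2) = S\<^sup>2\<bbbP>\<^sup>1\<close> are handled through
  their nonzero coordinate vectors. A vector \<open>(a, b, c)\<close> stands for the binary quadratic form
  \<open>a X\<^sup>2 + b X Y + c Y\<^sup>2\<close>, i.e. for its divisor of zeros. Over the complex numbers forms
  may be identified with the functions they define.
\<close>

type_synonym pt1 = "complex \<times> complex"
type_synonym pt2 = "complex \<times> complex \<times> complex"

section \<open>Forms and projective spaces\<close>

text \<open>\<open>S\<^sup>m S\<^sub>2\<close>, as the space of forms of degree \<open>m\<close> on \<open>S\<^sub>2\<close> (which is self-dual).\<close>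

definition ternary_forms :: "nat \<Rightarrow> (pt2 \<Rightarrow> complex) set" where
  "ternary_forms m =
     {(\<lambda>(a, b, c). \<Sum>i\<le>m. \<Sum>j\<le>m - i. k i j * a ^ i * b ^ j * c ^ (m - i - j)) |
        k :: nat \<Rightarrow> nat \<Rightarrow> complex. True}"

definition biforms :: "nat \<times> nat \<Rightarrow> (pt2 \<times> pt1 \<Rightarrow> complex) set" where
  "biforms = (\<lambda>(m, n).
     {(\<lambda>(g, (x, y)). \<Sum>i\<le>n. F i g * x ^ (n - i) * y ^ i) | F. \<forall>i. F i \<in> ternary_forms m})"

definition line :: "(complex \<Rightarrow> 'v \<Rightarrow> 'v) \<Rightarrow> 'v \<Rightarrow> 'v set" where
  "line sc v = {sc c v | c. c \<noteq> 0}"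

text \<open>\<open>\<bbbP>(S\<^sup>m S\<^sub>2)\<close>: plane curves of degree \<open>m\<close>.\<close>

definition curves :: "nat \<Rightarrow> (pt2 \<Rightarrow> complex) set set" where
  "curves m = line (\<lambda>c F u. c * F u) ` (ternary_forms m - {\<lambda>_. 0})"

section \<open>The Grassmannian and the space \<open>\<^bold>R\<^sub>d\<close>\<close>

text \<open>
  \<open>V = \<complex>\<^sup>4\<close> with basis \<open>e\<^sub>0, \<dots>, e\<^sub>3\<close>; the basis of \<open>\<Lambda>\<^sup>2V\<close> is
  \<open>e\<^sub>0\<^sub>1, e\<^sub>0\<^sub>2, e\<^sub>0\<^sub>3, e\<^sub>1\<^sub>2, e\<^sub>1\<^sub>3, e\<^sub>2\<^sub>3\<close>, where
  \<open>e\<^sub>i\<^sub>j\<close> is the wedge of \<open>e\<^sub>i\<close> and \<open>e\<^sub>j\<close>. The matrix of the wedge product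
  is its own inverse, so the same matrix gives the form transported to the dual of \<open>\<Lambda>\<^sup>2V\<close>.
\<close>

definition qmat :: "complex mat" where
  "qmat = mat_of_rows_list 6
     [[0,  0, 0, 0,  0, 1],
      [0,  0, 0, 0, -1, 0],
      [0,  0, 0, 1,  0, 0],
      [0,  0, 1, 0,  0, 0],
      [0, -1, 0, 0,  0, 0],
      [1,  0, 0, 0,  0, 0]]"

text \<open>
  A point of \<open>\<bbbP>(\<Lambda>\<^sup>2V)\<close> is a rank one quotient of \<open>\<Lambda>\<^sup>2V\<close>, hence a functional
  \<open>p\<close> up to scalars. \<open>alt_mat p\<close> is the matrix of the alternating form that \<open>p\<close>
  defines on \<open>V\<close>. If \<open>p\<close> lies on the quadric, then \<open>p\<close> is the map from \<open>\<Lambda>\<^sup>2V\<close> to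
  \<open>\<Lambda>\<^sup>2Q\<close>, and the fibre \<open>K\<close> of the tautological subbundle is the radical of this form.
\<close>

definition alt_mat :: "complex vec \<Rightarrow> complex mat" where
  "alt_mat p = mat_of_rows_list 4
     [[0,          p $ 0,      p $ 1,     p $ 2],
      [- (p $ 0),  0,          p $ 3,     p $ 4],
      [- (p $ 1),  - (p $ 3),  0,         p $ 5],
      [- (p $ 2),  - (p $ 4),  - (p $ 5), 0]]"

definition taut_fibre :: "complex vec \<Rightarrow> complex vec set" where
  "taut_fibre p = {v \<in> carrier_vec 4. alt_mat p *\<^sub>v v = 0\<^sub>v 4}"

text \<open>The affine parametrization of the rational normal curve \<open>C\<^sub>d\<close>.\<close>

definition veronese :: "nat \<Rightarrow> pt1 \<Rightarrow> complex vec" where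
  "veronese d = (\<lambda>(x, y). vec (d + 1) (\<lambda>i. x ^ (d - i) * y ^ i))"

text \<open>
  An element \<open>\<psi>\<close> of \<open>Hom(\<Lambda>\<^sup>2V, S\<^sub>d)\<close> is a matrix of size \<open>(d+1) \<times> 6\<close> whose columns are
  the coefficients, in the monomials \<open>X\<^sup>d\<^sup>-\<^sup>i Y\<^sup>i\<close>, of the images of the basis vectors.
  Its value at \<open>t\<close> is a functional on \<open>\<Lambda>\<^sup>2V\<close>.
\<close>

definition mor_eval :: "nat \<Rightarrow> complex mat \<Rightarrow> pt1 \<Rightarrow> complex vec" where
  "mor_eval d \<psi> t = transpose_mat \<psi> *\<^sub>v veronese d t"

definition is_mor :: "nat \<Rightarrow> complex mat \<Rightarrow> bool" where
  "is_mor d \<psi> \<longleftrightarrow> \<psi> \<in> carrier_mat (d + 1) 6 \<and>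
     (\<forall>t. t \<noteq> (0, 0) \<longrightarrow> mor_eval d \<psi> t \<noteq> 0\<^sub>v 6 \<and>
        mor_eval d \<psi> t \<bullet> (qmat *\<^sub>v mor_eval d \<psi> t) = 0)"

text \<open>A totally isotropic plane is given by a basis, the columns of \<open>M\<close>.\<close>

definition isotropic_plane :: "complex mat \<Rightarrow> bool" where
  "isotropic_plane M \<longleftrightarrow> M \<in> carrier_mat 6 3 \<and> vec_space.rank 6 M = 3 \<and>
     transpose_mat M * qmat * M = 0\<^sub>m 3 3"

definition R_maps :: "nat \<Rightarrow> complex mat set set" where
  "R_maps d = {line (\<cdot>\<^sub>m) \<psi> | \<psi>. is_mor d \<psi> \<and>
     \<not> (\<exists>M. isotropic_plane M \<and>
          (\<forall>t. t \<noteq> (0, 0) \<longrightarrow> mor_eval d \<psi> t \<in> {M *\<^sub>v c | c. c \<in> carrier_vec 3}))}"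

section \<open>Fitting ideals\<close>

text \<open>
  Here \<open>A\<close> is a commutative ring, carried by a multiplicatively and additively closed subset of a
  ring type, and the module is \<open>E / N\<close> for \<open>A\<close>-modules \<open>N \<subseteq> E\<close>, with scalar action \<open>sc\<close>.
\<close>

definition ideal_gen :: "'r::comm_ring_1 set \<Rightarrow> 'r set \<Rightarrow> 'r set" where
  "ideal_gen A S = {(\<Sum>i<k. a i * s i) | (k::nat) a s. \<forall>i<k. a i \<in> A \<and> s i \<in> S}"

definition generates_mod ::
  "'r set \<Rightarrow> ('r \<Rightarrow> 'm \<Rightarrow> 'm) \<Rightarrow> 'm::ab_group_add set \<Rightarrow> 'm set \<Rightarrow> nat \<Rightarrow> (nat \<Rightarrow> 'm) \<Rightarrow> bool" where
  "generates_mod A sc E N n m \<longleftrightarrow> (\<forall>i<n. m i \<in> E) \<and>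
     (\<forall>e\<in>E. \<exists>a. (\<forall>i<n. a i \<in> A) \<and> e - (\<Sum>i<n. sc (a i) (m i)) \<in> N)"

text \<open>
  For one finite generating family, the \<open>0\<close>-th Fitting ideal is generated by the maximal
  minors of the matrix of relations. It does not depend on the family (Fitting's lemma), so all
  finite generating families are allowed at once instead of choosing one.
\<close>

definition fitting0 ::
  "'r::comm_ring_1 set \<Rightarrow> ('r \<Rightarrow> 'm \<Rightarrow> 'm) \<Rightarrow> 'm::ab_group_add set \<Rightarrow> 'm set \<Rightarrow> 'r set" where
  "fitting0 A sc E N = ideal_gen A
     {det (mat n n (\<lambda>(i, j). a i j)) | n a. \<exists>m. generates_mod A sc E N n m \<and>
        (\<forall>i<n. (\<forall>j<n. a i j \<in> A) \<and> (\<Sum>j<n. sc (a i j) (m j)) \<in> N)}"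

section \<open>The map \<open>\<Psi>\<close>\<close>

text \<open>
  Regular functions on (the affine cone over) a locally closed subset \<open>X\<close>: locally quotients of
  forms of the same degree. They are extended by \<open>0\<close> outside \<open>X\<close>, so that ring elements
  are determined by their values on \<open>X\<close>; the unit of the ring is the indicator function of \<open>X\<close>.
\<close>

definition regular_on :: "('k \<Rightarrow> ('x \<Rightarrow> complex) set) \<Rightarrow> 'x set \<Rightarrow> ('x \<Rightarrow> complex) set" where
  "regular_on forms X = {\<phi>. (\<forall>x. x \<notin> X \<longrightarrow> \<phi> x = 0) \<and>
     (\<forall>x\<in>X. \<exists>k. \<exists>a\<in>forms k. \<exists>b\<in>forms k. b x \<noteq> 0 \<and>
        (\<forall>y\<in>X. b y \<noteq> 0 \<longrightarrow> \<phi> y = a y / b y))}"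

text \<open>The preimage under \<open>s\<close> of \<open>U\<close> in the incidence variety; \<open>s = fst\<close> and \<open>r = snd\<close>.\<close>

definition incidence :: "pt2 set \<Rightarrow> (pt2 \<times> pt1) set" where
  "incidence U = {((a, b, c), (x, y)). (a, b, c) \<in> U \<and> (a, b, c) \<noteq> (0, 0, 0) \<and> (x, y) \<noteq> (0, 0) \<and>
     a * x ^ 2 + b * x * y + c * y ^ 2 = 0}"

definition O_plane :: "pt2 set \<Rightarrow> (pt2 \<Rightarrow> complex) set" where
  "O_plane U = regular_on ternary_forms U"

definition O_inc :: "pt2 set \<Rightarrow> (pt2 \<times> pt1 \<Rightarrow> complex) set" where
  "O_inc U = regular_on biforms (incidence U)"

text \<open>\<open>V \<otimes> A = A\<^sup>4\<close>, as sequences supported on the first four indices.\<close>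

definition V_tensor :: "('x \<Rightarrow> complex) set \<Rightarrow> (nat \<Rightarrow> 'x \<Rightarrow> complex) set" where
  "V_tensor A = {\<sigma>. (\<forall>i<4. \<sigma> i \<in> A) \<and> (\<forall>i\<ge>4. \<sigma> i = (\<lambda>_. 0))}"

text \<open>
  Sections over an affine open \<open>U\<close>. Since the preimage of \<open>U\<close> under the finite map \<open>s\<close> is affine,
  the sections of \<open>s\<^sub>*r\<^sup>*(f\<^sup>*Q)\<close> are the quotient of the sections \<open>V_tensor (O_inc U)\<close> of
  \<open>V \<otimes> s\<^sub>*r\<^sup>*\<O>\<close> by \<open>K_sections\<close>, the sections of \<open>s\<^sub>*r\<^sup>*(f\<^sup>*K)\<close>. The cokernel sheaf
  is therefore \<open>V_tensor (O_inc U)\<close> modulo the sum of \<open>K_sections\<close> and of the image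
  of \<open>V \<otimes> \<O>(U)\<close>.
\<close>

definition K_sections :: "nat \<Rightarrow> complex mat \<Rightarrow> pt2 set \<Rightarrow> (nat \<Rightarrow> pt2 \<times> pt1 \<Rightarrow> complex) set" where
  "K_sections d \<psi> U = {\<sigma> \<in> V_tensor (O_inc U).
     \<forall>w\<in>incidence U. vec 4 (\<lambda>i. \<sigma> i w) \<in> taut_fibre (mor_eval d \<psi> (snd w))}"

definition pulled_back :: "pt2 set \<Rightarrow> (nat \<Rightarrow> pt2 \<times> pt1 \<Rightarrow> complex) set" where
  "pulled_back U =
     (\<lambda>\<sigma> i w. if w \<in> incidence U then \<sigma> i (fst w) else 0) ` V_tensor (O_plane U)"

definition coker_relations ::
  "nat \<Rightarrow> complex mat \<Rightarrow> pt2 set \<Rightarrow> (nat \<Rightarrow> pt2 \<times> pt1 \<Rightarrow> complex) set" where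
  "coker_relations d \<psi> U = {\<sigma> + \<tau> | \<sigma> \<tau>. \<sigma> \<in> pulled_back U \<and> \<tau> \<in> K_sections d \<psi> U}"

definition scale_sections ::
  "(pt2 \<Rightarrow> complex) \<Rightarrow> (nat \<Rightarrow> pt2 \<times> pt1 \<Rightarrow> complex) \<Rightarrow> (nat \<Rightarrow> pt2 \<times> pt1 \<Rightarrow> complex)" where
  "scale_sections a \<sigma> = (\<lambda>i w. a (fst w) * \<sigma> i w)"

definition fitting_coker :: "nat \<Rightarrow> complex mat \<Rightarrow> pt2 set \<Rightarrow> (pt2 \<Rightarrow> complex) set" where
  "fitting_coker d \<psi> U =
     fitting0 (O_plane U) scale_sections (V_tensor (O_inc U)) (coker_relations d \<psi> U)"

definition principal_open :: "(pt2 \<Rightarrow> complex) \<Rightarrow> pt2 set" where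
  "principal_open h = {u. h u \<noteq> 0}"

text \<open>
  The curve \<open>F = 0\<close> of degree \<open>m\<close> is the subscheme defined by an ideal sheaf if, on all
  sufficiently small affine (principal) neighbourhoods \<open>U\<close> of every point, the ideal is generated
  by a local equation \<open>F / b\<close>, with \<open>b\<close> of degree \<open>m\<close> nowhere zero on \<open>U\<close>. The degree of
  \<open>h\<close> is positive because the open set defined by a nonzero constant, the whole plane, is not affine.
\<close>

definition defines_curve ::
  "nat \<Rightarrow> (pt2 set \<Rightarrow> (pt2 \<Rightarrow> complex) set) \<Rightarrow> (pt2 \<Rightarrow> complex) \<Rightarrow> bool" where
  "defines_curve m J F \<longleftrightarrow>
     (\<forall>p. p \<noteq> (0, 0, 0) \<longrightarrow>
       (\<exists>n0>0. \<exists>h0\<in>ternary_forms n0. h0 p \<noteq> 0 \<and>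
         (\<forall>n>0. \<forall>h\<in>ternary_forms n.
            h p \<noteq> 0 \<and> principal_open h \<subseteq> principal_open h0 \<longrightarrow>
            (\<exists>b\<in>ternary_forms m. (\<forall>u\<in>principal_open h. b u \<noteq> 0) \<and>
               J (principal_open h) =
                 ideal_gen (O_plane (principal_open h))
                   {\<lambda>u. if u \<in> principal_open h then F u / b u else 0}))))"

definition Psi :: "nat \<Rightarrow> complex mat set \<Rightarrow> (pt2 \<Rightarrow> complex) set" where
  "Psi d f = (THE C. C \<in> curves (d - 2) \<and>
     (\<exists>\<psi>\<in>f. \<exists>F\<in>C. defines_curve (d - 2) (fitting_coker d \<psi>) F))"

section \<open>The map \<open>\<Phi>\<close>\<close>

definition sym_mats :: "nat \<Rightarrow> complex mat set" where
  "sym_mats n = {A \<in> carrier_mat n n. transpose_mat A = A}"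

text \<open>\<open>H\<^sup>0(I(2))\<close> for the ideal sheaf \<open>I\<close> of \<open>C\<^sub>d\<close>, as a subspace of \<open>S\<^sup>2S\<^sub>d\<close>.\<close>

definition quadrics_through_rnc :: "nat \<Rightarrow> complex mat set" where
  "quadrics_through_rnc d =
     {A \<in> sym_mats (d + 1). \<forall>t. veronese d t \<bullet> (A *\<^sub>v veronese d t) = 0}"

text \<open>
  The isomorphism with \<open>S\<^sup>2S\<^sub>d\<^sub>-\<^sub>2\<close>: the polarization of \<open>A\<close>, a symmetric form of bidegree
  \<open>(d, d)\<close> on \<open>\<bbbP>\<^sup>1 \<times> \<bbbP>\<^sup>1\<close> which is zero on the diagonal, is divisible by the square of
  the equation of the diagonal.
\<close>

definition rnc_iso :: "nat \<Rightarrow> complex mat \<Rightarrow> complex mat \<Rightarrow> bool" where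
  "rnc_iso d A B \<longleftrightarrow> A \<in> quadrics_through_rnc d \<and> B \<in> sym_mats (d - 1) \<and>
     (\<forall>x y. veronese d x \<bullet> (A *\<^sub>v veronese d y) =
        (fst x * snd y - snd x * fst y) ^ 2 *
        (veronese (d - 2) x \<bullet> (B *\<^sub>v veronese (d - 2) y)))"

text \<open>The binary quadratic form vanishing at \<open>x\<close> and \<open>y\<close>.\<close>

definition divisor :: "pt1 \<Rightarrow> pt1 \<Rightarrow> pt2" where
  "divisor x y = (snd x * snd y, - (fst x * snd y + snd x * fst y), fst x * fst y)"

text \<open>
  Hermite reciprocity between \<open>S\<^sup>2S\<^sub>m\<close> and \<open>S\<^sup>mS\<^sub>2\<close>: symmetric forms of bidegree
  \<open>(m, m)\<close> on \<open>\<bbbP>\<^sup>1 \<times> \<bbbP>\<^sup>1\<close> are the pull-backs of forms of degree \<open>m\<close> on \<open>S\<^sup>2\<bbbP>\<^sup>1\<close>.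
\<close>

definition hermite_iso :: "nat \<Rightarrow> complex mat \<Rightarrow> (pt2 \<Rightarrow> complex) \<Rightarrow> bool" where
  "hermite_iso m B F \<longleftrightarrow> B \<in> sym_mats (m + 1) \<and> F \<in> ternary_forms m \<and>
     (\<forall>x y. veronese m x \<bullet> (B *\<^sub>v veronese m y) = F (divisor x y))"

definition Phi :: "nat \<Rightarrow> complex mat set \<Rightarrow> (pt2 \<Rightarrow> complex) set" where
  "Phi d f = (THE C. C \<in> curves (d - 2) \<and>
     (\<exists>\<psi>\<in>f. \<exists>B. \<exists>F\<in>C. rnc_iso d (\<psi> * qmat * transpose_mat \<psi>) B \<and> hermite_iso (d - 2) B F))"

end

theory Submission
  imports Defs "HOL-Computational_Algebra.Fundamental_Theorem_Algebra"
begin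

text \<open>
  A divisor \<open>{x, y}\<close> of degree two on the projective line is a point of the plane of binary quadratic forms,
  and the fibre of \<open>s\<close> over it consists of \<open>x\<close> and \<open>y\<close>. If these are distinct, the fibre of the cokernel at \<open>{x, y}\<close>
  is the quotient of \<open>Q\<^sub>x \<oplus> Q\<^sub>y\<close> by \<open>V\<close>; it is nonzero exactly if the lines \<open>K\<^sub>x\<close> and \<open>K\<^sub>y\<close>
  meet, that is, if \<open>f(x)\<close> and \<open>f(y)\<close> are orthogonal for \<open>q\<close>. So off the conic of double points both curves
  have the same points, and the proof makes this an identity of equations.

  On the side of \<open>\<Phi>\<close> the polar form \<open>q(f(x), f(y))\<close> is symmetric of bidegree \<open>(d, d)\<close> and zero on the diagonal.
  Symmetric forms descend to the plane (\<open>bihom_symmetric_descends\<close>), where the square of the bracket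
  \<open>[x, y]\<close> becomes the discriminant, which divides every form that vanishes on the conic of double points
  (\<open>disc_divides\<close>). This gives a form \<open>F\<close> of degree \<open>d - 2\<close> with
  \<open>q(f(x), f(y)) = [x, y]\<^sup>2 F({x, y})\<close>. It is not zero, because a family of lines that pairwise
  meet has a common point or a common plane, and then \<open>f\<close> maps into an isotropic plane (\<open>isotropic_family\<close>).

  On the side of \<open>\<Psi>\<close> choose a coordinate \<open>\<xi>\<close> of the projective line that is finite on the fibres over a small
  affine open set \<open>U\<close>. The functions on the double cover are \<open>\<O>(U) \<oplus> \<O>(U) \<xi>\<close> (\<open>O_inc_split\<close>), and two
  sections \<open>k, k'\<close> trivialize the bundle \<open>K\<close>. Modulo \<open>V \<otimes> \<O>(U)\<close> the module is therefore generated by the four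
  multiples \<open>\<xi> e\<^sub>i\<close>, and its relations are the coefficients of \<open>\<xi>\<close> in \<open>k, k', \<xi> k, \<xi> k'\<close>: a square matrix
  \<open>M\<close>. Such a presentation has Fitting ideal \<open>(det M)\<close>, whatever generators are used
  (\<open>fitting0_square_presentation\<close>). Row operations give
  \<open>det M = det(k\<^sub>x, k'\<^sub>x, k\<^sub>y, k'\<^sub>y) / (\<xi>(x) - \<xi>(y))\<^sup>2\<close> (\<open>relation_det\<close>), and the determinant of the
  two lines is \<open>q(f(x), f(y))\<close> up to the contractions \<open>\<delta>(x) \<delta>(y)\<close>, which do not vanish on \<open>U\<close>.
  As \<open>\<xi>(x) - \<xi>(y)\<close> is \<open>[x, y]\<close> up to a unit, \<open>det M\<close> is \<open>F\<close> up to a unit.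

  Finally, the ideals determine \<open>F\<close> up to a constant (\<open>defines_curve_unique\<close>), so the two
  descriptions select the same line of forms.
\<close>

section \<open>Ternary forms\<close>

definition monomial3 :: "complex \<Rightarrow> nat \<Rightarrow> nat \<Rightarrow> nat \<Rightarrow> pt2 \<Rightarrow> complex" where
  "monomial3 k i j l = (\<lambda>(a, b, c). k * a ^ i * b ^ j * c ^ l)"

lemma ternary_forms_iff:
  "F \<in> ternary_forms m \<longleftrightarrow> (\<exists>k. \<forall>u. F u = (\<Sum>i\<le>m. \<Sum>j\<le>m - i. monomial3 (k i j) i j (m - i - j) u))"
  unfolding ternary_forms_def monomial3_def by (auto simp: fun_eq_iff)

lemma ternary_monomial: "monomial3 k i j l \<in> ternary_forms (i + j + l)"
proof -
  have "monomial3 k i j l u = (\<Sum>i'\<le>i + j + l. \<Sum>j'\<le>i + j + l - i'.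
      monomial3 (if i' = i \<and> j' = j then k else 0) i' j' (i + j + l - i' - j') u)" for u
  proof -
    have "(\<Sum>i'\<le>i + j + l. \<Sum>j'\<le>i + j + l - i'.
        monomial3 (if i' = i \<and> j' = j then k else 0) i' j' (i + j + l - i' - j') u)
      = (\<Sum>i'\<le>i + j + l. if i' = i then
          (\<Sum>j'\<le>i + j + l - i'. if j' = j then monomial3 k i j l u else 0) else 0)"
      by (intro sum.cong refl)
        (simp add: monomial3_def case_prod_unfold if_distrib[of "\<lambda>x. x * _"] cong: if_cong)
    then show ?thesis by (simp add: sum.delta)
  qed
  then show ?thesis unfolding ternary_forms_iff by (intro exI[of _ "\<lambda>i' j'. if i' = i \<and> j' = j then k else 0"]) blast
qed

lemma ternary_zero: "(\<lambda>_. 0) \<in> ternary_forms m"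
  unfolding ternary_forms_iff monomial3_def by (intro exI[of _ "\<lambda>_ _. 0"]) auto

lemma ternary_add:
  assumes "F \<in> ternary_forms m" "G \<in> ternary_forms m"
  shows "(\<lambda>u. F u + G u) \<in> ternary_forms m"
proof -
  obtain k l where "\<forall>u. F u = (\<Sum>i\<le>m. \<Sum>j\<le>m - i. monomial3 (k i j) i j (m - i - j) u)"
    "\<forall>u. G u = (\<Sum>i\<le>m. \<Sum>j\<le>m - i. monomial3 (l i j) i j (m - i - j) u)"
    using assms unfolding ternary_forms_iff by blast
  then show ?thesis unfolding ternary_forms_iff
    by (intro exI[of _ "\<lambda>i j. k i j + l i j"])
      (auto simp: monomial3_def sum.distrib algebra_simps)
qed

text \<open>A form is a sum of monomials, so a property that is additive need only be checked on these.\<close>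

lemma ternary_monomial_induct [consumes 1, case_names mono zero add]:
  assumes F: "F \<in> ternary_forms m"
    and mono: "\<And>k i j l. i + j + l = m \<Longrightarrow> P (monomial3 k i j l)"
    and zero: "P (\<lambda>_. 0)"
    and add: "\<And>F G. P F \<Longrightarrow> P G \<Longrightarrow> P (\<lambda>u. F u + G u)"
  shows "P F"
proof -
  have sum: "P (\<lambda>u. \<Sum>i\<in>I. f i u)" if "finite I" "\<And>i. i \<in> I \<Longrightarrow> P (f i)" for I :: "nat set" and f
    using that by (induction I rule: finite_induct) (auto intro: zero add)
  obtain k where k: "\<forall>u. F u = (\<Sum>i\<le>m. \<Sum>j\<le>m - i. monomial3 (k i j) i j (m - i - j) u)"
    using F unfolding ternary_forms_iff by blast
  have "P (\<lambda>u. \<Sum>i\<le>m. \<Sum>j\<le>m - i. monomial3 (k i j) i j (m - i - j) u)"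
    by (intro sum mono) auto
  with k show ?thesis by (metis (no_types, lifting) ext)
qed

lemma ternary_mult:
  assumes F: "F \<in> ternary_forms m" and G: "G \<in> ternary_forms n"
  shows "(\<lambda>u. F u * G u) \<in> ternary_forms (m + n)"
  using F
proof (induction F rule: ternary_monomial_induct)
  case (mono k i j l)
  note ijl = this
  show ?case
    using G
  proof (induction G rule: ternary_monomial_induct)
    case (mono k' i' j' l')
    have "(\<lambda>u. monomial3 k i j l u * monomial3 k' i' j' l' u)
      = monomial3 (k * k') (i + i') (j + j') (l + l')"
      by (auto simp: monomial3_def power_add)
    with ternary_monomial[of "k * k'" "i + i'" "j + j'" "l + l'"] ijl mono show ?case
      by (metis (no_types, lifting) add.assoc add.commute)
  qed (auto simp: ternary_zero distrib_left intro: ternary_add)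
qed (auto simp: ternary_zero distrib_right intro: ternary_add)

lemma ternary_const: "(\<lambda>_. k) \<in> ternary_forms 0"
  using ternary_monomial[of k 0 0 0] by (simp add: monomial3_def case_prod_unfold)

lemma ternary_cmult: "F \<in> ternary_forms m \<Longrightarrow> (\<lambda>u. k * F u) \<in> ternary_forms m"
  using ternary_mult[OF ternary_const[of k]] by fastforce

lemma ternary_diff:
  assumes "F \<in> ternary_forms m" "G \<in> ternary_forms m"
  shows "(\<lambda>u. F u - G u) \<in> ternary_forms m"
  using ternary_add[OF assms(1) ternary_cmult[OF assms(2), of "-1"]] by simp

lemma ternary_power: "F \<in> ternary_forms m \<Longrightarrow> (\<lambda>u. F u ^ n) \<in> ternary_forms (m * n)"
  by (induction n) (auto simp: ternary_const intro: ternary_mult)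

lemma ternary_linear: "(\<lambda>(a, b, c). p * a + q * b + r * c) \<in> ternary_forms 1"
proof -
  have "(\<lambda>u. monomial3 p 1 0 0 u + (monomial3 q 0 1 0 u + monomial3 r 0 0 1 u)) \<in> ternary_forms 1"
    using ternary_monomial[of p 1 0 0] ternary_monomial[of q 0 1 0] ternary_monomial[of r 0 0 1]
    by (intro ternary_add) auto
  then show ?thesis by (simp add: monomial3_def case_prod_unfold add.assoc)
qed

definition disc :: "pt2 \<Rightarrow> complex" where
  "disc = (\<lambda>(a, b, c). b\<^sup>2 - 4 * a * c)"

lemma ternary_disc: "disc \<in> ternary_forms 2"
proof -
  have "(\<lambda>u. monomial3 1 0 2 0 u + monomial3 (-4) 1 0 1 u) \<in> ternary_forms 2"
    using ternary_monomial[of 1 0 2 0] ternary_monomial[of "-4" 1 0 1]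
    by (intro ternary_add) (auto simp: numeral_2_eq_2)
  then show ?thesis by (simp add: monomial3_def disc_def case_prod_unfold)
qed

lemma ternary_homogeneous:
  assumes "F \<in> ternary_forms m"
  shows "F (s * a, s * b, s * c) = s ^ m * F (a, b, c)"
  using assms
  by (induction F rule: ternary_monomial_induct)
    (auto simp: monomial3_def algebra_simps power_mult_distrib power_add)

text \<open>Divisibility questions about forms are reduced to polynomials in one variable on lines. The coefficient in the top
  degree is the value at the point at infinity of the line.\<close>

lemma ternary_restrict_line:
  assumes "F \<in> ternary_forms m"
  shows "\<exists>p. degree p \<le> m \<and> coeff p m = F (a', b', c') \<and>
    (\<forall>s. poly p s = F (a + s * a', b + s * b', c + s * c'))"
  using assms
proof (induction F rule: ternary_monomial_induct)
  case (mono k i j l)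
  define p where "p = [:k:] * ([:a, a':] ^ i * ([:b, b':] ^ j * [:c, c':] ^ l))"
  have lin: "degree ([:x, y:] ^ e) \<le> e \<and> coeff ([:x, y:] ^ e) e = y ^ e" for x y :: complex and e
  proof (induction e)
    case (Suc e)
    have "coeff ([:x, y:] ^ e) (Suc e) = 0" using Suc by (intro coeff_eq_0) auto
    moreover have "degree ([:x, y:] * [:x, y:] ^ e) \<le> 1 + e"
      using Suc degree_mult_le[of "[:x, y:]" "[:x, y:] ^ e"] degree_pCons_le[of x "[:y:]"]
      by (simp split: if_splits) 
    ultimately show ?case using Suc by simp
  qed auto
  have mul: "degree (p * q) \<le> m + n \<and> coeff (p * q) (m + n) = x * y"
    if "degree p \<le> m \<and> coeff p m = x" "degree q \<le> n \<and> coeff q n = y" for p q :: "complex poly" and m n x y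
  proof -
    have "coeff (p * q) (m + n) = (\<Sum>i\<le>m + n. if i = m then x * y else 0)"
      unfolding coeff_mult
    proof (intro sum.cong refl)
      fix i assume i: "i \<in> {..m + n}"
      consider "i = m" | "i > m" | "i < m" by linarith
      then show "coeff p i * coeff q (m + n - i) = (if i = m then x * y else 0)"
      proof cases
        case 2
        then show ?thesis using that by (simp add: coeff_eq_0)
      next
        case 3
        then have "degree q < m + n - i" using that by linarith
        then show ?thesis using 3 by (simp add: coeff_eq_0)
      qed (use that in simp)
    qed
    then show ?thesis using that degree_mult_le[of p q] by simp
  qed
  have "degree p \<le> 0 + (i + (j + l)) \<and> coeff p (0 + (i + (j + l))) = k * (a' ^ i * (b' ^ j * c' ^ l))"
    unfolding p_def by (intro mul lin) auto
  moreover have "\<forall>s. poly p s = monomial3 k i j l (a + s * a', b + s * b', c + s * c')"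
    by (simp add: p_def monomial3_def poly_power algebra_simps)
  ultimately show ?case using mono by (intro exI[of _ p]) (auto simp: monomial3_def add.assoc)
next
  case zero
  show ?case by (intro exI[of _ 0]) auto
next
  case (add F G)
  from add.IH obtain p q where "degree p \<le> m" "coeff p m = F (a', b', c')"
    "\<forall>s. poly p s = F (a + s * a', b + s * b', c + s * c')"
    "degree q \<le> m" "coeff q m = G (a', b', c')"
    "\<forall>s. poly q s = G (a + s * a', b + s * b', c + s * c')" by blast
  then show ?case by (intro exI[of _ "p + q"]) (auto intro: degree_add_le)
qed

lemma ternary_domain:
  assumes F: "F \<in> ternary_forms m" and G: "G \<in> ternary_forms n"
    and FG: "\<And>u. F u * G u = 0"
  shows "(\<forall>u. F u = 0) \<or> (\<forall>u. G u = 0)"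
proof (rule ccontr)
  assume "\<not> ?thesis"
  then obtain a b c a' b' c' where nz: "F (a, b, c) \<noteq> 0" "G (a', b', c') \<noteq> 0" by auto
  obtain p where p: "\<And>s. poly p s = F (a + s * (a' - a), b + s * (b' - b), c + s * (c' - c))"
    using ternary_restrict_line[OF F] by blast
  obtain q where q: "\<And>s. poly q s = G (a + s * (a' - a), b + s * (b' - b), c + s * (c' - c))"
    using ternary_restrict_line[OF G] by blast
  have "poly (p * q) s = 0" for s using FG by (simp add: p q)
  then have "p * q = 0" using poly_all_0_iff_0 by blast
  moreover have "poly p 0 \<noteq> 0" "poly q 1 \<noteq> 0" using nz by (simp_all add: p q)
  ultimately show False by auto
qed

lemma disc_nonzero: "\<exists>u. disc u \<noteq> 0"
  by (intro exI[of _ "(0, 1, 0)"]) (simp add: disc_def)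

text \<open>Forms are a domain. On the double cover the coefficients of a function can only be compared where the two
  points of a fibre are distinct; this extends the resulting identities over the discriminant.\<close>

lemma ternary_zero_dense:
  assumes F: "F \<in> ternary_forms m" and h: "h \<in> ternary_forms n" and hp: "h p \<noteq> 0"
    and van: "\<And>u. h u \<noteq> 0 \<Longrightarrow> disc u \<noteq> 0 \<Longrightarrow> F u = 0"
  shows "F u = 0"
proof -
  have "(\<forall>u. h u * disc u = 0) \<or> (\<forall>u. F u = 0)"
    using van by (intro ternary_domain[OF ternary_mult[OF h ternary_disc] F]) auto
  moreover have "(\<forall>u. h u = 0) \<or> (\<forall>u. disc u = 0)" if "\<forall>u. h u * disc u = 0"
    using that by (intro ternary_domain[OF h ternary_disc]) auto
  ultimately show ?thesis using hp disc_nonzero by blast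
qed

section \<open>Bihomogeneous forms on pairs of points and forms on the symmetric square\<close>

definition monomial22 :: "complex \<Rightarrow> nat \<Rightarrow> nat \<Rightarrow> nat \<Rightarrow> nat \<Rightarrow> pt1 \<Rightarrow> pt1 \<Rightarrow> complex" where
  "monomial22 k i i' j j' x y = k * fst x ^ i * snd x ^ i' * fst y ^ j * snd y ^ j'"

definition bihom :: "nat \<Rightarrow> nat \<Rightarrow> (pt1 \<Rightarrow> pt1 \<Rightarrow> complex) \<Rightarrow> bool" where
  "bihom m n f \<longleftrightarrow> (\<exists>k. \<forall>x y. f x y = (\<Sum>i\<le>m. \<Sum>j\<le>n. monomial22 (k i j) (m - i) i (n - j) j x y))"

lemma bihom_monomial: "bihom (i + i') (j + j') (monomial22 k i i' j j')"
proof -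
  have "monomial22 k i i' j j' x y = (\<Sum>a\<le>i + i'. \<Sum>b\<le>j + j'.
      monomial22 (if a = i' \<and> b = j' then k else 0) (i + i' - a) a (j + j' - b) b x y)" for x y
  proof -
    have "(\<Sum>a\<le>i + i'. \<Sum>b\<le>j + j'.
        monomial22 (if a = i' \<and> b = j' then k else 0) (i + i' - a) a (j + j' - b) b x y)
      = (\<Sum>a\<le>i + i'. if a = i' then
          (\<Sum>b\<le>j + j'. if b = j' then monomial22 k i i' j j' x y else 0) else 0)"
      by (intro sum.cong refl)
        (simp add: monomial22_def if_distrib[of "\<lambda>x. x * _"] cong: if_cong)
    then show ?thesis by simp
  qed
  then show ?thesis unfolding bihom_def
    by (intro exI[of _ "\<lambda>a b. if a = i' \<and> b = j' then k else 0"]) blast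
qed

lemma bihom_zero: "bihom m n (\<lambda>_ _. 0)"
  unfolding bihom_def monomial22_def by (intro exI[of _ "\<lambda>_ _. 0"]) auto

lemma bihom_add:
  assumes "bihom m n f" "bihom m n g"
  shows "bihom m n (\<lambda>x y. f x y + g x y)"
proof -
  obtain k l where
    "\<forall>x y. f x y = (\<Sum>i\<le>m. \<Sum>j\<le>n. monomial22 (k i j) (m - i) i (n - j) j x y)"
    "\<forall>x y. g x y = (\<Sum>i\<le>m. \<Sum>j\<le>n. monomial22 (l i j) (m - i) i (n - j) j x y)"
    using assms unfolding bihom_def by blast
  then show ?thesis unfolding bihom_def
    by (intro exI[of _ "\<lambda>i j. k i j + l i j"])
      (auto simp: monomial22_def sum.distrib algebra_simps)
qed

lemma bihom_sum:
  assumes "\<And>i. i \<in> I \<Longrightarrow> bihom m n (f i)"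
  shows "bihom m n (\<lambda>x y. \<Sum>i\<in>I. f i x y)"
  using assms by (induction I rule: infinite_finite_induct) (auto intro: bihom_zero bihom_add)

lemma bihom_monomial_induct [consumes 1, case_names mono zero add]:
  assumes f: "bihom m n f"
    and mono: "\<And>k i i' j j'. i + i' = m \<Longrightarrow> j + j' = n \<Longrightarrow> P (monomial22 k i i' j j')"
    and zero: "P (\<lambda>_ _. 0)"
    and add: "\<And>f g. P f \<Longrightarrow> P g \<Longrightarrow> P (\<lambda>x y. f x y + g x y)"
  shows "P f"
proof -
  have sum: "P (\<lambda>x y. \<Sum>i\<in>I. g i x y)" if "finite I" "\<And>i. i \<in> I \<Longrightarrow> P (g i)"
    for I :: "nat set" and g
    using that by (induction I rule: finite_induct) (auto intro: zero add)
  obtain k where k: "\<forall>x y. f x y = (\<Sum>i\<le>m. \<Sum>j\<le>n. monomial22 (k i j) (m - i) i (n - j) j x y)"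
    using f unfolding bihom_def by blast
  have "P (\<lambda>x y. \<Sum>i\<le>m. \<Sum>j\<le>n. monomial22 (k i j) (m - i) i (n - j) j x y)"
    by (intro sum mono) auto
  moreover have "f = (\<lambda>x y. \<Sum>i\<le>m. \<Sum>j\<le>n. monomial22 (k i j) (m - i) i (n - j) j x y)"
    using k by (intro ext) blast
  ultimately show ?thesis by simp
qed

lemma bihom_mult:
  assumes f: "bihom m n f" and g: "bihom m' n' g"
  shows "bihom (m + m') (n + n') (\<lambda>x y. f x y * g x y)"
  using f
proof (induction f rule: bihom_monomial_induct)
  case (mono k i i' j j')
  note ij = this
  show ?case
    using g
  proof (induction g rule: bihom_monomial_induct)
    case (mono l a a' b b')
    have "(\<lambda>x y. monomial22 k i i' j j' x y * monomial22 l a a' b b' x y)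
      = monomial22 (k * l) (i + a) (i' + a') (j + b) (j' + b')"
      by (intro ext) (simp add: monomial22_def power_add)
    moreover have "m + m' = (i + a) + (i' + a')" "n + n' = (j + b) + (j' + b')"
      using ij mono by auto
    ultimately show ?case using bihom_monomial by metis
  qed (auto simp: bihom_zero distrib_left intro: bihom_add)
qed (auto simp: bihom_zero distrib_right intro: bihom_add)

lemma bihom_const: "bihom 0 0 (\<lambda>_ _. k)"
proof -
  have "monomial22 k 0 0 0 0 = (\<lambda>_ _. k)" by (intro ext) (simp add: monomial22_def)
  with bihom_monomial[of 0 0 0 0 k] show ?thesis by simp
qed

lemma bihom_cmult: "bihom m n f \<Longrightarrow> bihom m n (\<lambda>x y. k * f x y)"
  using bihom_mult[OF bihom_const] by fastforce

lemma bihom_diff: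
  assumes "bihom m n f" "bihom m n g"
  shows "bihom m n (\<lambda>x y. f x y - g x y)"
  using bihom_add[OF assms(1) bihom_cmult[OF assms(2), of "-1"]] by simp

lemma bihom_power: "bihom m n f \<Longrightarrow> bihom (e * m) (e * n) (\<lambda>x y. f x y ^ e)"
  by (induction e) (auto simp: bihom_const intro: bihom_mult)

lemma bihom_swap: "bihom m n f \<Longrightarrow> bihom n m (\<lambda>x y. f y x)"
proof (induction f rule: bihom_monomial_induct)
  case (mono k i i' j j')
  have "(\<lambda>x y. monomial22 k i i' j j' y x) = monomial22 k j j' i i'"
    by (intro ext) (simp add: monomial22_def)
  with bihom_monomial[of j j' i i' k] mono show ?case by simp
qed (auto intro: bihom_zero bihom_add)

lemma bihom_coord:
  "bihom 1 0 (\<lambda>x y. fst x)" "bihom 1 0 (\<lambda>x y. snd x)"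
  "bihom 0 1 (\<lambda>x y. fst y)" "bihom 0 1 (\<lambda>x y. snd y)"
proof -
  have "monomial22 1 1 0 0 0 = (\<lambda>x y. fst x)" "monomial22 1 0 1 0 0 = (\<lambda>x y. snd x)"
    "monomial22 1 0 0 1 0 = (\<lambda>x y. fst y)" "monomial22 1 0 0 0 1 = (\<lambda>x y. snd y)"
    by (intro ext; simp add: monomial22_def)+
  then show "bihom 1 0 (\<lambda>x y. fst x)" "bihom 1 0 (\<lambda>x y. snd x)"
    "bihom 0 1 (\<lambda>x y. fst y)" "bihom 0 1 (\<lambda>x y. snd y)"
    using bihom_monomial[of 1 0 0 0 1] bihom_monomial[of 0 1 0 0 1]
      bihom_monomial[of 0 0 1 0 1] bihom_monomial[of 0 0 0 1 1] by simp_all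
qed

lemma divisor_commute: "divisor x y = divisor y x"
  by (simp add: divisor_def algebra_simps)

lemma divisor_coords:
  "fst (divisor x y) = snd x * snd y" "snd (snd (divisor x y)) = fst x * fst y"
  "fst (snd (divisor x y)) = - (fst x * snd y + snd x * fst y)"
  by (simp_all add: divisor_def)

definition bracket :: "pt1 \<Rightarrow> pt1 \<Rightarrow> complex" where
  "bracket x y = fst x * snd y - snd x * fst y"

lemma disc_divisor: "disc (divisor x y) = (bracket x y)\<^sup>2"
  by (simp add: disc_def divisor_def bracket_def power2_eq_square algebra_simps)

lemma divisor_eq_zero: "divisor x y = (0, 0, 0) \<longleftrightarrow> x = (0, 0) \<or> y = (0, 0)"
  by (cases x; cases y) (auto simp: divisor_def)

lemma divisor_self: "divisor (s, t) (s, t) = (t\<^sup>2, - 2 * s * t, s\<^sup>2)"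
  by (simp add: divisor_def power2_eq_square)

text \<open>Dividing the quadratic form by the linear form that vanishes at \<open>t\<close> leaves the one that vanishes at \<open>y\<close>.\<close>

lemma divisor_residual:
  assumes t: "t \<noteq> (0, 0)" and root: "a * fst t ^ 2 + b * fst t * snd t + c * snd t ^ 2 = 0"
  shows "\<exists>y. (a, b, c) = divisor t y"
proof (cases "snd t = 0")
  case True
  then have t1: "fst t \<noteq> 0" using t by (cases t) auto
  with True root have "a = 0" by simp
  then show ?thesis using True t1
    by (intro exI[of _ "(c / fst t, - b / fst t)"]) (simp add: divisor_def)
next
  case False
  define y where "y = (- (b + fst t * (a / snd t)) / snd t, a / snd t)"
  have "b * fst t * snd t + a * fst t ^ 2 = - c * snd t ^ 2"
    using root by (simp add: algebra_simps eq_neg_iff_add_eq_0)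
  then have "fst t * (b + fst t * (a / snd t)) = - c * snd t"
    using False by (simp add: field_simps power2_eq_square)
  then have "fst t * (- (b + fst t * (a / snd t))) = c * snd t"
    by (simp only: mult_minus_right mult_minus_left minus_minus)
  then have "fst t * fst y = c" using False by (simp add: y_def)
  then show ?thesis using False
    by (intro exI[of _ y]) (auto simp: divisor_def y_def field_simps)
qed

lemma binary_quadratic_root:
  "\<exists>t. t \<noteq> (0, 0) \<and> a * fst t ^ 2 + b * fst t * snd t + (c :: complex) * snd t ^ 2 = 0"
proof (cases "a = 0")
  case True
  then show ?thesis by (intro exI[of _ "(1, 0)"]) simp
next
  case False
  define r where "r = csqrt (b\<^sup>2 - 4 * a * c)"
  have r: "r * r = b * b - 4 * a * c" by (simp add: r_def flip: power2_eq_square)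
  have "(r - b) * (r - b) + 2 * b * (r - b) + 4 * a * c = 0"
    using r by (simp add: algebra_simps)
  then have "a * ((r - b) / (2 * a))\<^sup>2 + b * ((r - b) / (2 * a)) + c = 0"
  proof -
    define z where "z = (r - b) / (2 * a)"
    have rz: "r - b = 2 * a * z" using False by (simp add: z_def)
    have "4 * a * (a * z\<^sup>2 + b * z + c) = 0"
      using \<open>(r - b) * (r - b) + 2 * b * (r - b) + 4 * a * c = 0\<close> unfolding rz
      by (simp add: algebra_simps power2_eq_square)
    then show ?thesis using False by (simp add: z_def)
  qed
  then show ?thesis by (intro exI[of _ "((r - b) / (2 * a), 1)"]) simp
qed

lemma divisor_surj: "\<exists>x y. u = divisor x y"
proof -
  obtain a b c where u: "u = (a, b, c)" by (cases u) auto
  obtain t where "t \<noteq> (0, 0)" "a * fst t ^ 2 + b * fst t * snd t + c * snd t ^ 2 = 0"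
    using binary_quadratic_root by blast
  with divisor_residual u show ?thesis by blast
qed

lemma divisor_root:
  assumes "divisor x y = (a, b, c)"
  shows "a * fst x ^ 2 + b * fst x * snd x + c * snd x ^ 2 = 0"
proof -
  have "a = snd x * snd y" "b = - (fst x * snd y + snd x * fst y)" "c = fst x * fst y"
    using assms by (simp_all add: divisor_def)
  then show ?thesis by (simp only: power2_eq_square) (simp only: algebra_simps minus_add_distrib, simp)
qed

lemma incidence_iff:
  "(u, t) \<in> incidence U \<longleftrightarrow> u \<in> U \<and> (\<exists>y. t \<noteq> (0, 0) \<and> y \<noteq> (0, 0) \<and> u = divisor t y)"
proof -
  obtain a b c where u: "u = (a, b, c)" by (cases u) auto
  obtain t1 t2 where t: "t = (t1, t2)" by (cases t)
  have "(u, t) \<in> incidence U \<longleftrightarrow> u \<in> U \<and> u \<noteq> (0, 0, 0) \<and> t \<noteq> (0, 0) \<and>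
      a * fst t ^ 2 + b * fst t * snd t + c * snd t ^ 2 = 0"
    by (auto simp: incidence_def u t)
  also have "\<dots> \<longleftrightarrow> u \<in> U \<and> (\<exists>y. t \<noteq> (0, 0) \<and> y \<noteq> (0, 0) \<and> u = divisor t y)"
  proof (intro conj_cong refl iffI)
    assume "u \<noteq> (0, 0, 0) \<and> t \<noteq> (0, 0) \<and> a * fst t ^ 2 + b * fst t * snd t + c * snd t ^ 2 = 0"
    then have "u \<noteq> (0, 0, 0)" "t \<noteq> (0, 0)" "a * fst t ^ 2 + b * fst t * snd t + c * snd t ^ 2 = 0"
      by blast+
    then obtain y where y: "u = divisor t y" using divisor_residual u by metis
    with \<open>u \<noteq> _\<close> have "y \<noteq> (0, 0)" using divisor_eq_zero by metis
    with y \<open>t \<noteq> _\<close> show "\<exists>y. t \<noteq> (0, 0) \<and> y \<noteq> (0, 0) \<and> u = divisor t y" by blast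
  next
    assume "\<exists>y. t \<noteq> (0, 0) \<and> y \<noteq> (0, 0) \<and> u = divisor t y"
    then obtain y where "t \<noteq> (0, 0)" "y \<noteq> (0, 0)" "u = divisor t y" by blast
    then show "u \<noteq> (0, 0, 0) \<and> t \<noteq> (0, 0) \<and> a * fst t ^ 2 + b * fst t * snd t + c * snd t ^ 2 = 0"
      using divisor_root[of t y a b c] divisor_eq_zero[of t y] u by auto
  qed
  finally show ?thesis .
qed

lemma incidence_divisor:
  assumes "divisor x y \<in> U" "x \<noteq> (0, 0)" "y \<noteq> (0, 0)"
  shows "(divisor x y, x) \<in> incidence U" "(divisor x y, y) \<in> incidence U"
  using assms divisor_commute by (metis incidence_iff)+

lemma ternary_pullback: "G \<in> ternary_forms m \<Longrightarrow> bihom m m (\<lambda>x y. G (divisor x y))"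
proof (induction G rule: ternary_monomial_induct)
  case (mono k i j l)
  have sq: "bihom 1 1 (\<lambda>x y. snd x * snd y)" "bihom 1 1 (\<lambda>x y. fst x * fst y)"
    "bihom 1 1 (\<lambda>x y. fst x * snd y)" "bihom 1 1 (\<lambda>x y. snd x * fst y)"
    using bihom_mult[OF bihom_coord(2) bihom_coord(4)] bihom_mult[OF bihom_coord(1) bihom_coord(3)]
      bihom_mult[OF bihom_coord(1) bihom_coord(4)] bihom_mult[OF bihom_coord(2) bihom_coord(3)]
    by simp_all
  have mid: "bihom 1 1 (\<lambda>x y. - (fst x * snd y + snd x * fst y))"
    using bihom_cmult[OF bihom_add[OF sq(3,4)], of "-1"] by simp
  have "bihom (0 + (i * 1 + (j * 1 + l * 1))) (0 + (i * 1 + (j * 1 + l * 1)))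
      (\<lambda>x y. k * ((snd x * snd y) ^ i * ((- (fst x * snd y + snd x * fst y)) ^ j * (fst x * fst y) ^ l)))"
    by (intro bihom_mult bihom_const bihom_power sq mid)
  then show ?case using mono
    by (simp add: monomial3_def divisor_def mult.assoc add.assoc)
qed (auto intro: bihom_zero bihom_add)

text \<open>The case distinction replaces a truncated subtraction: in degree \<open>-1\<close> only zero is left.\<close>

definition ternary_pred :: "nat \<Rightarrow> (pt2 \<Rightarrow> complex) set" where
  "ternary_pred m = (case m of 0 \<Rightarrow> {\<lambda>_. 0} | Suc k \<Rightarrow> ternary_forms k)"

lemma ternary_pred_simps:
  "ternary_pred 0 = {\<lambda>_. 0}" "ternary_pred (Suc k) = ternary_forms k"
  by (simp_all add: ternary_pred_def)

lemma ternary_pred_mult: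
  assumes "K \<in> ternary_forms 1" "G \<in> ternary_pred m"
  shows "(\<lambda>u. K u * G u) \<in> ternary_forms m"
  using assms ternary_mult[OF assms(1)] by (cases m) (auto simp: ternary_pred_simps ternary_zero)

lemma ternary_coord: "fst \<in> ternary_forms 1" "(\<lambda>u. - fst (snd u)) \<in> ternary_forms 1"
  "(\<lambda>u. snd (snd u)) \<in> ternary_forms 1"
  using ternary_linear[of 1 0 0] ternary_linear[of 0 "-1" 0] ternary_linear[of 0 0 1]
  by (simp_all add: case_prod_unfold)

text \<open>The forms of equal bidegrees are a free graded module over the ternary forms with basis \<open>1\<close> and \<open>x1 y2\<close>.\<close>

definition splits :: "nat \<Rightarrow> (pt1 \<Rightarrow> pt1 \<Rightarrow> complex) \<Rightarrow> bool" where
  "splits m f \<longleftrightarrow> (\<exists>G\<in>ternary_forms m. \<exists>H\<in>ternary_pred m. \<forall>x y.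
     f x y = G (divisor x y) + fst x * snd y * H (divisor x y))"

lemma splits_add: "splits m f \<Longrightarrow> splits m g \<Longrightarrow> splits m (\<lambda>x y. f x y + g x y)"
proof -
  assume "splits m f" "splits m g"
  then obtain G H G' H' where *: "G \<in> ternary_forms m" "H \<in> ternary_pred m"
    "\<forall>x y. f x y = G (divisor x y) + fst x * snd y * H (divisor x y)"
    "G' \<in> ternary_forms m" "H' \<in> ternary_pred m"
    "\<forall>x y. g x y = G' (divisor x y) + fst x * snd y * H' (divisor x y)"
    unfolding splits_def by blast
  then have "(\<lambda>u. H u + H' u) \<in> ternary_pred m"
    by (cases m) (auto simp: ternary_pred_simps intro: ternary_add)
  with * show ?thesis unfolding splits_def
    by (intro bexI[of _ "\<lambda>u. G u + G' u"] bexI[of _ "\<lambda>u. H u + H' u"])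
      (auto simp: algebra_simps intro: ternary_add)
qed

text \<open>The products of a coordinate of \<open>x\<close> and one of \<open>y\<close> generate all forms of equal bidegrees. Two of them
  are coordinates of the divisor, and the other two are conjugate and have trace and norm in the coordinates.\<close>

lemma splits_coord_mult:
  assumes "splits m f"
  shows "splits (Suc m) (\<lambda>x y. (snd x * snd y) * f x y)"
    and "splits (Suc m) (\<lambda>x y. (fst x * fst y) * f x y)"
    and "splits (Suc m) (\<lambda>x y. (fst x * snd y) * f x y)"
    and "splits (Suc m) (\<lambda>x y. (snd x * fst y) * f x y)"
proof -
  obtain G H where G: "G \<in> ternary_forms m" and H: "H \<in> ternary_pred m"
    and f: "\<And>x y. f x y = G (divisor x y) + fst x * snd y * H (divisor x y)"
    using assms unfolding splits_def by blast
  note L = ternary_coord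
  have mG: "(\<lambda>u. K u * G u) \<in> ternary_forms (Suc m)" if "K \<in> ternary_forms 1" for K
    using ternary_mult[OF that G] by simp
  have mH: "(\<lambda>u. K u * H u) \<in> ternary_pred (Suc m)" if "K \<in> ternary_forms 1" for K
    using ternary_pred_mult[OF that H] by (simp add: ternary_pred_simps)
  have mmH: "(\<lambda>u. K u * (K' u * H u)) \<in> ternary_forms (Suc m)"
    if "K \<in> ternary_forms 1" "K' \<in> ternary_forms 1" for K K'
    using ternary_mult[OF that(1) ternary_pred_mult[OF that(2) H]] by simp
  show "splits (Suc m) (\<lambda>x y. (snd x * snd y) * f x y)"
    unfolding splits_def f
    by (rule bexI[OF _ mG[OF L(1)]], rule bexI[OF _ mH[OF L(1)]])
      (simp add: divisor_coords algebra_simps)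
  show "splits (Suc m) (\<lambda>x y. (fst x * fst y) * f x y)"
    unfolding splits_def f
    by (rule bexI[OF _ mG[OF L(3)]], rule bexI[OF _ mH[OF L(3)]])
      (simp add: divisor_coords algebra_simps)
  \<comment> \<open>\<open>x1 y2\<close> and \<open>x2 y1\<close> are the roots of \<open>T\<^sup>2 + b T + a c\<close>.\<close>
  show *: "splits (Suc m) (\<lambda>x y. (fst x * snd y) * f x y)"
  proof -
    have "(\<lambda>u. - 1 * (fst u * (snd (snd u) * H u))) \<in> ternary_forms (Suc m)"
      by (intro ternary_cmult mmH L)
    moreover have "(\<lambda>u. G u + (- fst (snd u)) * H u) \<in> ternary_pred (Suc m)"
      using ternary_add[OF _ mH[OF L(2), unfolded ternary_pred_simps], of G] G
      by (simp add: ternary_pred_simps)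
    moreover have "fst x * snd y * f x y = - 1 * (fst (divisor x y) * (snd (snd (divisor x y)) * H (divisor x y)))
        + fst x * snd y * (G (divisor x y) + - fst (snd (divisor x y)) * H (divisor x y))" for x y
      unfolding f divisor_coords by (simp add: algebra_simps)
    ultimately show ?thesis unfolding splits_def by fast
  qed
  show "splits (Suc m) (\<lambda>x y. (snd x * fst y) * f x y)"
  proof -
    have "(\<lambda>u. (- fst (snd u)) * G u + fst u * (snd (snd u) * H u)) \<in> ternary_forms (Suc m)"
      by (intro ternary_add mG mmH L)
    moreover have "(\<lambda>u. - 1 * G u) \<in> ternary_pred (Suc m)"
      using ternary_cmult[OF G, of "-1"] by (simp add: ternary_pred_simps)
    moreover have "snd x * fst y * f x y = (- fst (snd (divisor x y)) * G (divisor x y)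
          + fst (divisor x y) * (snd (snd (divisor x y)) * H (divisor x y)))
        + fst x * snd y * (- 1 * G (divisor x y))" for x y
      unfolding f divisor_coords by (simp add: algebra_simps)
    ultimately show ?thesis unfolding splits_def by fast
  qed
qed

lemma bihom_splits: "bihom m m f \<Longrightarrow> splits m f"
proof (induction f rule: bihom_monomial_induct)
  case (mono k i i' j j')
  have base: "splits 0 (\<lambda>x y. k)"
    unfolding splits_def using ternary_const[of k]
    by (intro bexI[of _ "\<lambda>_. k"] bexI[of _ "\<lambda>_. 0"]) (auto simp: ternary_pred_simps)
  have iter: "splits (e + n) (\<lambda>x y. g x y ^ e * f x y)"
    if "\<And>m f. splits m f \<Longrightarrow> splits (Suc m) (\<lambda>x y. g x y * f x y)" "splits n f" for g e n f
    using that(2) by (induction e) (auto simp: mult.assoc intro: that(1))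
  show ?case
  proof (cases "i' \<le> j'")
    case True
    define e where "e = j' - i'"
    have e: "j' = i' + e" "i = j + e" using True mono by (auto simp: e_def)
    have "splits (i' + (j + (e + 0))) (\<lambda>x y. (snd x * snd y) ^ i' *
        ((fst x * fst y) ^ j * ((fst x * snd y) ^ e * k)))"
      by (intro iter splits_coord_mult base)
    moreover have "m = i' + (j + (e + 0))" using e mono by auto
    moreover have "(\<lambda>x y. (snd x * snd y) ^ i' * ((fst x * fst y) ^ j * ((fst x * snd y) ^ e * k)))
        = monomial22 k i i' j j'"
      by (intro ext) (simp add: monomial22_def e power_add power_mult_distrib algebra_simps)
    ultimately show ?thesis by simp
  next
    case False
    define e where "e = i' - j'"
    have e: "i' = j' + e" "j = i + e" using False mono by (auto simp: e_def)
    have "splits (j' + (i + (e + 0))) (\<lambda>x y. (snd x * snd y) ^ j' *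
        ((fst x * fst y) ^ i * ((snd x * fst y) ^ e * k)))"
      by (intro iter splits_coord_mult base)
    moreover have "m = j' + (i + (e + 0))" using e mono by auto
    moreover have "(\<lambda>x y. (snd x * snd y) ^ j' * ((fst x * fst y) ^ i * ((snd x * fst y) ^ e * k)))
        = monomial22 k i i' j j'"
      by (intro ext) (simp add: monomial22_def e power_add power_mult_distrib algebra_simps)
    ultimately show ?thesis by simp
  qed
next
  case zero
  show ?case unfolding splits_def using ternary_zero
    by (intro bexI[of _ "\<lambda>_. 0"]) (auto simp: ternary_pred_def split: nat.splits)
qed (rule splits_add)

text \<open>Averaging over the exchange of \<open>x\<close> and \<open>y\<close> replaces \<open>x1 y2\<close> by half of its trace.\<close>

lemma bihom_symmetric_descends:
  assumes f: "bihom m m f" and sym: "\<And>x y. f x y = f y x"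
  shows "\<exists>G\<in>ternary_forms m. \<forall>x y. f x y = G (divisor x y)"
proof -
  obtain G H where G: "G \<in> ternary_forms m" and H: "H \<in> ternary_pred m"
    and f': "\<And>x y. f x y = G (divisor x y) + fst x * snd y * H (divisor x y)"
    using bihom_splits[OF f] unfolding splits_def by blast
  have "f x y = G (divisor x y) + (1 / 2) * (- fst (snd (divisor x y)) * H (divisor x y))" for x y
  proof -
    have "2 * f x y = f x y + f y x" using sym[of x y] by simp
    also have "\<dots> = 2 * G (divisor x y) + - fst (snd (divisor x y)) * H (divisor x y)"
      unfolding f' divisor_commute[of y x] by (simp add: divisor_coords algebra_simps)
    finally have "f x y = (2 * G (divisor x y) + - fst (snd (divisor x y)) * H (divisor x y)) / 2"
      by (metis nonzero_mult_div_cancel_left zero_neq_numeral)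
    then show ?thesis by (simp add: add_divide_distrib diff_divide_distrib)
  qed
  moreover have "(\<lambda>u. G u + (1 / 2) * (- fst (snd u) * H u)) \<in> ternary_forms m"
    by (intro ternary_add ternary_cmult ternary_pred_mult ternary_coord G H)
  ultimately show ?thesis by (intro bexI[of _ "\<lambda>u. G u + (1 / 2) * (- fst (snd u) * H u)"]) auto
qed

text \<open>Division with remainder by \<open>b\<^sup>2 - 4 a c\<close>, which is monic in \<open>b\<close>.\<close>

lemma ternary_split_off_disc:
  assumes "i + j + l = Suc (Suc n)"
  shows "\<exists>F\<in>ternary_forms n. \<exists>G\<in>ternary_forms (Suc (Suc n)). \<exists>H\<in>ternary_forms (Suc n).
    (\<forall>a b c. monomial3 k i j l (a, b, c) = disc (a, b, c) * F (a, b, c) + G (a, b, c) + b * H (a, b, c)) \<and>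
    (\<forall>a b b' c. G (a, b, c) = G (a, b', c) \<and> H (a, b, c) = H (a, b', c))"
  using assms
proof (induction j arbitrary: i l k rule: nat_induct2)
  case 0
  then have "monomial3 k i 0 l \<in> ternary_forms (Suc (Suc n))"
    using ternary_monomial[of k i 0 l] by simp
  then show ?case using ternary_zero
    by (intro bexI[of _ "\<lambda>_. 0"] bexI[of _ "monomial3 k i 0 l"]) (auto simp: monomial3_def)
next
  case 1
  then have "monomial3 k i 0 l \<in> ternary_forms (Suc n)"
    using ternary_monomial[of k i 0 l] by simp
  then show ?case using ternary_zero
    by (intro bexI[of _ "\<lambda>_. 0"] bexI[of _ "monomial3 k i 0 l"]) (auto simp: monomial3_def)
next
  case (step j)
  then have "Suc i + j + Suc l = Suc (Suc n)" by simp
  from step.IH[OF this, of "4 * k"] obtain F G H where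
    F: "F \<in> ternary_forms n" and G: "G \<in> ternary_forms (Suc (Suc n))" and H: "H \<in> ternary_forms (Suc n)"
    and eq: "\<And>a b c. monomial3 (4 * k) (Suc i) j (Suc l) (a, b, c)
      = disc (a, b, c) * F (a, b, c) + G (a, b, c) + b * H (a, b, c)"
    and ind: "\<forall>a b b' c. G (a, b, c) = G (a, b', c) \<and> H (a, b, c) = H (a, b', c)"
    by blast
  have "i + j + l = n" using step.prems by simp
  then have "(\<lambda>u. monomial3 k i j l u + F u) \<in> ternary_forms n"
    using ternary_add[OF ternary_monomial[of k i j l]] F by simp
  moreover have "monomial3 k i (j + 2) l (a, b, c)
      = disc (a, b, c) * (monomial3 k i j l (a, b, c) + F (a, b, c)) + G (a, b, c) + b * H (a, b, c)" for a b c
  proof -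
    have "monomial3 k i (j + 2) l (a, b, c)
        = disc (a, b, c) * monomial3 k i j l (a, b, c) + monomial3 (4 * k) (Suc i) j (Suc l) (a, b, c)"
      by (simp add: monomial3_def disc_def algebra_simps power2_eq_square)
    then show ?thesis unfolding eq by (simp add: algebra_simps)
  qed
  ultimately show ?case using G H ind
    by (intro bexI[of _ "\<lambda>u. monomial3 k i j l u + F u"] bexI[of _ G] bexI[of _ H]) auto
qed

lemma ternary_disc_remainder:
  assumes "G \<in> ternary_forms (Suc (Suc n))"
  shows "\<exists>F\<in>ternary_forms n. \<exists>G0\<in>ternary_forms (Suc (Suc n)). \<exists>H\<in>ternary_forms (Suc n).
    (\<forall>a b c. G (a, b, c) = disc (a, b, c) * F (a, b, c) + G0 (a, b, c) + b * H (a, b, c)) \<and>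
    (\<forall>a b b' c. G0 (a, b, c) = G0 (a, b', c) \<and> H (a, b, c) = H (a, b', c))"
  using assms
proof (induction G rule: ternary_monomial_induct)
  case (mono k i j l)
  then show ?case by (rule ternary_split_off_disc)
next
  case zero
  show ?case using ternary_zero by (intro bexI[of _ "\<lambda>_. 0"]) auto
next
  case (add G G')
  from add obtain F G0 H where 1:
    "F \<in> ternary_forms n" "G0 \<in> ternary_forms (Suc (Suc n))" "H \<in> ternary_forms (Suc n)"
    "\<forall>a b c. G (a, b, c) = disc (a, b, c) * F (a, b, c) + G0 (a, b, c) + b * H (a, b, c)"
    "\<forall>a b b' c. G0 (a, b, c) = G0 (a, b', c) \<and> H (a, b, c) = H (a, b', c)" by blast
  from add obtain F' G0' H' where 2:
    "F' \<in> ternary_forms n" "G0' \<in> ternary_forms (Suc (Suc n))" "H' \<in> ternary_forms (Suc n)"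
    "\<forall>a b c. G' (a, b, c) = disc (a, b, c) * F' (a, b, c) + G0' (a, b, c) + b * H' (a, b, c)"
    "\<forall>a b b' c. G0' (a, b, c) = G0' (a, b', c) \<and> H' (a, b, c) = H' (a, b', c)" by blast
  have "(\<forall>a b c. G (a, b, c) + G' (a, b, c) = disc (a, b, c) * (F (a, b, c) + F' (a, b, c))
      + (G0 (a, b, c) + G0' (a, b, c)) + b * (H (a, b, c) + H' (a, b, c)))"
    using 1(4) 2(4) by (simp add: algebra_simps)
  moreover have "(\<forall>a b b' c. G0 (a, b, c) + G0' (a, b, c) = G0 (a, b', c) + G0' (a, b', c) \<and>
       H (a, b, c) + H' (a, b, c) = H (a, b', c) + H' (a, b', c))"
    using 1(5) 2(5) by metis
  ultimately show ?case
    using 1(1-3) 2(1-3)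
    by (intro bexI[of _ "\<lambda>u. F u + F' u"] bexI[of _ "\<lambda>u. G0 u + G0' u"] bexI[of _ "\<lambda>u. H u + H' u"] conjI ternary_add)
qed

text \<open>The conic of squares is parametrized by \<open>(t\<^sup>2, -2st, s\<^sup>2)\<close>; separating the even and
  the odd part in \<open>s\<close> shows that the remainder modulo its equation is determined by the
  values on the conic.\<close>

lemma disc_divides:
  assumes G: "G \<in> ternary_forms (Suc (Suc n))" and van: "\<And>x. G (divisor x x) = 0"
  shows "\<exists>F\<in>ternary_forms n. \<forall>u. G u = disc u * F u"
proof -
  obtain F G0 H where F: "F \<in> ternary_forms n" and G0: "G0 \<in> ternary_forms (Suc (Suc n))"
    and H: "H \<in> ternary_forms (Suc n)"
    and eq: "\<And>a b c. G (a, b, c) = disc (a, b, c) * F (a, b, c) + G0 (a, b, c) + b * H (a, b, c)"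
    and ind: "\<And>a b b' c. G0 (a, b, c) = G0 (a, b', c) \<and> H (a, b, c) = H (a, b', c)"
    using ternary_disc_remainder[OF G] by blast
  have conic: "G0 (t\<^sup>2, 0, s\<^sup>2) - 2 * s * t * H (t\<^sup>2, 0, s\<^sup>2) = 0" for s t
  proof -
    have "disc (t\<^sup>2, - 2 * s * t, s\<^sup>2) = 0" by (simp add: disc_def power2_eq_square)
    then show ?thesis
      using van[of "(s, t)"] ind[THEN conjunct1, of "t\<^sup>2" "- 2 * s * t" "s\<^sup>2" 0]
        ind[THEN conjunct2, of "t\<^sup>2" "- 2 * s * t" "s\<^sup>2" 0]
      unfolding divisor_self eq by simp
  qed
  have even: "G0 (t\<^sup>2, 0, s\<^sup>2) = 0" and odd: "s * t * H (t\<^sup>2, 0, s\<^sup>2) = 0" for s t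
    using conic[where s = s and t = t] conic[where s = "- s" and t = t] by simp_all
  have G0_0: "G0 (a, b, c) = 0" for a b c
    using even[of "csqrt a" "csqrt c"] ind[THEN conjunct1, of a b c 0] by simp
  have "H (a, b, c) = 0" if "a * c \<noteq> 0" for a b c
    using odd[of "csqrt c" "csqrt a"] ind[of a b c 0] that by simp
  then have "fst u * snd (snd u) * H u = 0" for u by (cases u) auto
  then have "(\<forall>u :: pt2. fst u * snd (snd u) = 0) \<or> (\<forall>u. H u = 0)"
    by (rule ternary_domain[OF ternary_mult[OF ternary_coord(1,3)] H])
  moreover have "\<exists>u :: pt2. fst u * snd (snd u) \<noteq> 0" by (intro exI[of _ "(1, 0, 1)"]) simp
  ultimately have "H u = 0" for u by blast
  then show ?thesis using F eq G0_0 by (intro bexI[of _ F]) auto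
qed

section \<open>Regular functions\<close>

lemma biforms_iff: "A \<in> biforms (m, n) \<longleftrightarrow> (\<exists>F. (\<forall>i. F i \<in> ternary_forms m) \<and>
    (\<forall>w. A w = (\<Sum>i\<le>n. F i (fst w) * fst (snd w) ^ (n - i) * snd (snd w) ^ i)))"
  unfolding biforms_def by (auto simp: fun_eq_iff)

definition biterm :: "(pt2 \<Rightarrow> complex) \<Rightarrow> nat \<Rightarrow> nat \<Rightarrow> pt2 \<times> pt1 \<Rightarrow> complex" where
  "biterm G i j w = G (fst w) * fst (snd w) ^ i * snd (snd w) ^ j"

lemma biforms_zero: "(\<lambda>_. 0) \<in> biforms (m, n)"
  unfolding biforms_iff by (intro exI[of _ "\<lambda>_ _. 0"]) (simp add: ternary_zero)

lemma biforms_add: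
  assumes "A \<in> biforms (m, n)" "B \<in> biforms (m, n)"
  shows "(\<lambda>w. A w + B w) \<in> biforms (m, n)"
proof -
  obtain F G where "\<forall>i. F i \<in> ternary_forms m" "\<forall>i. G i \<in> ternary_forms m"
    "\<forall>w. A w = (\<Sum>i\<le>n. F i (fst w) * fst (snd w) ^ (n - i) * snd (snd w) ^ i)"
    "\<forall>w. B w = (\<Sum>i\<le>n. G i (fst w) * fst (snd w) ^ (n - i) * snd (snd w) ^ i)"
    using assms unfolding biforms_iff by blast
  then show ?thesis unfolding biforms_iff
    by (intro exI[of _ "\<lambda>i u. F i u + G i u"]) (auto simp: sum.distrib algebra_simps intro: ternary_add)
qed

lemma biforms_biterm: "G \<in> ternary_forms m \<Longrightarrow> biterm G i j \<in> biforms (m, i + j)"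
  unfolding biforms_iff
  by (intro exI[of _ "\<lambda>a. if a = j then G else (\<lambda>_. 0)"])
    (auto simp: biterm_def ternary_zero if_distrib[of "\<lambda>g. g _"] if_distrib[of "\<lambda>x. x * _"] cong: if_cong)

lemma biforms_induct [consumes 1, case_names biterm zero add]:
  assumes A: "A \<in> biforms (m, n)"
    and biterm: "\<And>G i j. G \<in> ternary_forms m \<Longrightarrow> i + j = n \<Longrightarrow> P (biterm G i j)"
    and zero: "P (\<lambda>_. 0)"
    and add: "\<And>A B. P A \<Longrightarrow> P B \<Longrightarrow> P (\<lambda>w. A w + B w)"
  shows "P A"
proof -
  have sum: "P (\<lambda>x. \<Sum>i\<in>I. g i x)" if "finite I" "\<And>i. i \<in> I \<Longrightarrow> P (g i)"
    for I :: "nat set" and g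
    using that by (induction I rule: finite_induct) (auto intro: zero add)
  obtain F where F: "\<forall>i. F i \<in> ternary_forms m"
    "\<forall>w. A w = (\<Sum>i\<le>n. biterm (F i) (n - i) i w)"
    using A unfolding biforms_iff biterm_def by blast
  have "P (\<lambda>w. \<Sum>i\<le>n. biterm (F i) (n - i) i w)"
    using F by (intro sum biterm) auto
  moreover have "A = (\<lambda>w. \<Sum>i\<le>n. biterm (F i) (n - i) i w)"
    using F by (intro ext) blast
  ultimately show ?thesis by simp
qed

lemma biforms_mult:
  assumes A: "A \<in> biforms (m, n)" and B: "B \<in> biforms (m', n')"
  shows "(\<lambda>w. A w * B w) \<in> biforms (m + m', n + n')"
  using A
proof (induction A rule: biforms_induct)
  case (biterm G i j)
  note ij = this
  show ?case
    using B
  proof (induction B rule: biforms_induct)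
    case (biterm H a b)
    have "(\<lambda>w. biterm G i j w * biterm H a b w) = biterm (\<lambda>u. G u * H u) (i + a) (j + b)"
      by (intro ext) (simp add: biterm_def power_add)
    moreover have "n + n' = (i + a) + (j + b)" using ij biterm by auto
    ultimately show ?case using biforms_biterm ternary_mult ij biterm by metis
  qed (auto simp: biforms_zero distrib_left intro: biforms_add)
qed (auto simp: biforms_zero distrib_right intro: biforms_add)

lemma biforms_of_ternary: "G \<in> ternary_forms m \<Longrightarrow> (\<lambda>w. G (fst w)) \<in> biforms (m, 0)"
  using biforms_biterm[of G m 0 0] by (simp add: biterm_def[abs_def])

text \<open>Binary forms are the bihomogeneous forms of degree zero in the second point.\<close>

lemma biforms_of_binary: "bihom n 0 (\<lambda>x y. f x) \<Longrightarrow> (\<lambda>w. f (snd w)) \<in> biforms (0, n)"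
proof -
  assume "bihom n 0 (\<lambda>x y. f x)"
  then obtain k where k: "\<And>x. f x = (\<Sum>i\<le>n. monomial22 (k i 0) (n - i) i 0 0 x x)"
    unfolding bihom_def by fastforce
  show ?thesis unfolding biforms_iff k
    by (intro exI[of _ "\<lambda>i _. k i 0"]) (auto simp: ternary_const monomial22_def)
qed

lemma biforms_pullback:
  "A \<in> biforms (m, n) \<Longrightarrow> bihom (m + n) m (\<lambda>x y. A (divisor x y, x))"
proof (induction A rule: biforms_induct)
  case (biterm G i j)
  have "bihom (m + (i * 1 + j * 1)) (m + (i * 0 + j * 0)) (\<lambda>x y. G (divisor x y) * (fst x ^ i * snd x ^ j))"
    by (intro bihom_mult ternary_pullback bihom_power bihom_coord biterm)
  then show ?case using biterm by (simp add: biterm_def mult.assoc)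
qed (auto intro: bihom_zero bihom_add)

text \<open>The common part of the arguments for the plane and for the incidence variety, with their
  gradings by numbers and by pairs of numbers.\<close>

locale graded_functions =
  fixes forms :: "'k \<Rightarrow> ('x \<Rightarrow> complex) set" and comb :: "'k \<Rightarrow> 'k \<Rightarrow> 'k" and unit_deg :: 'k
  assumes forms_add: "a \<in> forms k \<Longrightarrow> b \<in> forms k \<Longrightarrow> (\<lambda>x. a x + b x) \<in> forms k"
    and forms_mult: "a \<in> forms k \<Longrightarrow> b \<in> forms l \<Longrightarrow> (\<lambda>x. a x * b x) \<in> forms (comb k l)"
    and forms_const: "(\<lambda>_. c) \<in> forms unit_deg"
begin

lemma regular_fraction:
  assumes "a \<in> forms k" "b \<in> forms k" "\<And>x. x \<in> X \<Longrightarrow> b x \<noteq> 0"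
  shows "(\<lambda>x. if x \<in> X then a x / b x else 0) \<in> regular_on forms X"
  using assms unfolding regular_on_def by auto

lemma regular_const: "(\<lambda>x. if x \<in> X then c else 0) \<in> regular_on forms X"
  using regular_fraction[OF forms_const forms_const, of X 1 c] by (simp cong: if_cong)

lemma regular_add:
  assumes "f \<in> regular_on forms X" "g \<in> regular_on forms X"
  shows "(\<lambda>x. f x + g x) \<in> regular_on forms X"
  unfolding regular_on_def
proof (intro CollectI conjI allI impI ballI)
  fix x assume x: "x \<in> X"
  obtain k a b where f: "a \<in> forms k" "b \<in> forms k" "b x \<noteq> 0" "\<forall>y\<in>X. b y \<noteq> 0 \<longrightarrow> f y = a y / b y"
    using assms(1) x unfolding regular_on_def by blast
  obtain l a' b' where g: "a' \<in> forms l" "b' \<in> forms l" "b' x \<noteq> 0" "\<forall>y\<in>X. b' y \<noteq> 0 \<longrightarrow> g y = a' y / b' y"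
    using assms(2) x unfolding regular_on_def by blast
  have "\<forall>y\<in>X. b y * b' y \<noteq> 0 \<longrightarrow> f y + g y = (a y * b' y + b y * a' y) / (b y * b' y)"
    using f(4) g(4) by (auto simp: field_simps)
  then show "\<exists>k. \<exists>a\<in>forms k. \<exists>b\<in>forms k. b x \<noteq> 0 \<and> (\<forall>y\<in>X. b y \<noteq> 0 \<longrightarrow> f y + g y = a y / b y)"
    using f(3) g(3)
    by (intro exI[of _ "comb k l"] rev_bexI[OF forms_add[OF forms_mult[OF f(1) g(2)] forms_mult[OF f(2) g(1)]]]
        rev_bexI[OF forms_mult[OF f(2) g(2)]]) auto
qed (use assms in \<open>auto simp: regular_on_def\<close>)

lemma regular_mult:
  assumes "f \<in> regular_on forms X" "g \<in> regular_on forms X"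
  shows "(\<lambda>x. f x * g x) \<in> regular_on forms X"
  unfolding regular_on_def
proof (intro CollectI conjI allI impI ballI)
  fix x assume x: "x \<in> X"
  obtain k a b where f: "a \<in> forms k" "b \<in> forms k" "b x \<noteq> 0" "\<forall>y\<in>X. b y \<noteq> 0 \<longrightarrow> f y = a y / b y"
    using assms(1) x unfolding regular_on_def by blast
  obtain l a' b' where g: "a' \<in> forms l" "b' \<in> forms l" "b' x \<noteq> 0" "\<forall>y\<in>X. b' y \<noteq> 0 \<longrightarrow> g y = a' y / b' y"
    using assms(2) x unfolding regular_on_def by blast
  have "\<forall>y\<in>X. b y * b' y \<noteq> 0 \<longrightarrow> f y * g y = (a y * a' y) / (b y * b' y)"
    using f(4) g(4) by simp
  then show "\<exists>k. \<exists>a\<in>forms k. \<exists>b\<in>forms k. b x \<noteq> 0 \<and> (\<forall>y\<in>X. b y \<noteq> 0 \<longrightarrow> f y * g y = a y / b y)"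
    using f(3) g(3)
    by (intro exI[of _ "comb k l"] rev_bexI[OF forms_mult[OF f(1) g(1)]]
        rev_bexI[OF forms_mult[OF f(2) g(2)]]) auto
qed (use assms in \<open>auto simp: regular_on_def\<close>)

lemma regular_zero: "(\<lambda>_. 0) \<in> regular_on forms X"
  using regular_const[of X 0] by simp

lemma regular_cmult:
  assumes "f \<in> regular_on forms X"
  shows "(\<lambda>x. c * f x) \<in> regular_on forms X"
proof -
  have "(\<lambda>x. c * f x) = (\<lambda>x. (if x \<in> X then c else 0) * f x)"
    using assms by (auto simp: regular_on_def)
  then show ?thesis using regular_mult[OF regular_const assms] by simp
qed

lemma regular_uminus: "f \<in> regular_on forms X \<Longrightarrow> (\<lambda>x. - f x) \<in> regular_on forms X"
  using regular_cmult[of f X "-1"] by simp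

lemma regular_diff:
  assumes "f \<in> regular_on forms X" "g \<in> regular_on forms X"
  shows "(\<lambda>x. f x - g x) \<in> regular_on forms X"
  using regular_add[OF assms(1) regular_uminus[OF assms(2)]] by simp

lemma regular_sum:
  assumes "\<And>i. i \<in> I \<Longrightarrow> f i \<in> regular_on forms X"
  shows "(\<lambda>x. \<Sum>i\<in>I. f i x) \<in> regular_on forms X"
  using assms by (induction I rule: infinite_finite_induct) (auto intro: regular_zero regular_add)

end

interpretation tf: graded_functions ternary_forms "(+)" 0
  by standard (auto intro: ternary_add ternary_mult ternary_const)

interpretation bf: graded_functions biforms "\<lambda>k l. (fst k + fst l, snd k + snd l)" "(0, 0)"
proof
  show "(\<lambda>_. c) \<in> biforms (0, 0)" for c using biforms_of_ternary[OF ternary_const] by simp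
  show "(\<lambda>x. a x + b x) \<in> biforms k" if "a \<in> biforms k" "b \<in> biforms k" for a b k
    using that biforms_add by (cases k) auto
  show "(\<lambda>x. a x * b x) \<in> biforms (fst k + fst l, snd k + snd l)"
    if "a \<in> biforms k" "b \<in> biforms l" for a b k l
    using that biforms_mult by (cases k; cases l) auto
qed

lemma O_inc_of_plane:
  assumes "f \<in> O_plane U"
  shows "(\<lambda>w. if w \<in> incidence U then f (fst w) else 0) \<in> O_inc U"
  unfolding O_inc_def regular_on_def
proof (intro CollectI conjI allI impI ballI)
  fix w assume w: "w \<in> incidence U"
  then have "fst w \<in> U" by (auto simp: incidence_def)
  then obtain k a b where f: "a \<in> ternary_forms k" "b \<in> ternary_forms k" "b (fst w) \<noteq> 0"
    "\<forall>y\<in>U. b y \<noteq> 0 \<longrightarrow> f y = a y / b y"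
    using assms unfolding O_plane_def regular_on_def by blast
  have "y \<in> incidence U \<Longrightarrow> fst y \<in> U" for y by (auto simp: incidence_def)
  then show "\<exists>k. \<exists>a\<in>biforms k. \<exists>b\<in>biforms k. b w \<noteq> 0 \<and> (\<forall>y\<in>incidence U. b y \<noteq> 0 \<longrightarrow>
      (if y \<in> incidence U then f (fst y) else 0) = a y / b y)"
    using f by (intro exI[of _ "(k, 0)"] rev_bexI[OF biforms_of_ternary[OF f(1)]]
        rev_bexI[OF biforms_of_ternary[OF f(2)]]) auto
qed auto

lemma O_inc_binary_fraction:
  assumes "bihom n 0 (\<lambda>x y. f x)" "bihom n 0 (\<lambda>x y. g x)" "\<And>w. w \<in> incidence U \<Longrightarrow> g (snd w) \<noteq> 0"
  shows "(\<lambda>w. if w \<in> incidence U then f (snd w) / g (snd w) else 0) \<in> O_inc U"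
  unfolding O_inc_def 
  by (rule bf.regular_fraction[OF biforms_of_binary[OF assms(1)] biforms_of_binary[OF assms(2)] assms(3)])

section \<open>The double cover over a small affine open set\<close>

lemma O_plane_iff: "f \<in> O_plane U \<longleftrightarrow> (\<forall>u. u \<notin> U \<longrightarrow> f u = 0) \<and>
    (\<forall>u\<in>U. \<exists>k. \<exists>a\<in>ternary_forms k. \<exists>b\<in>ternary_forms k. b u \<noteq> 0 \<and>
      (\<forall>v\<in>U. b v \<noteq> 0 \<longrightarrow> f v = a v / b v))"
  unfolding O_plane_def regular_on_def by blast

text \<open>A regular function is locally a quotient of forms, so it is determined off the discriminant.\<close>

lemma O_plane_zero_dense:
  assumes h: "h \<in> ternary_forms n" and f: "f \<in> O_plane (principal_open h)"
    and van: "\<And>u. h u \<noteq> 0 \<Longrightarrow> disc u \<noteq> 0 \<Longrightarrow> f u = 0"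
  shows "f u = 0"
proof (cases "h u = 0")
  case True
  then show ?thesis using f unfolding O_plane_iff principal_open_def by blast
next
  case False
  then obtain k a b where ab: "a \<in> ternary_forms k" "b \<in> ternary_forms k" "b u \<noteq> 0"
    "\<And>v. h v \<noteq> 0 \<Longrightarrow> b v \<noteq> 0 \<Longrightarrow> f v = a v / b v"
    using f unfolding O_plane_iff principal_open_def by blast
  have "a u = 0"
  proof (rule ternary_zero_dense[OF ab(1) ternary_mult[OF h ab(2)]])
    show "h u * b u \<noteq> 0" using False ab(3) by simp
    show "a v = 0" if "h v * b v \<noteq> 0" "disc v \<noteq> 0" for v
      using that ab(4)[of v] van[of v] by auto
  qed
  then show ?thesis using ab(4)[of u] False ab(3) by simp
qed

text \<open>\<open>l1, l2\<close> and \<open>m1, m2\<close> are the coefficients of two linear forms on the projective line. The first one does not vanish on the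
  fibres over \<open>U\<close>, so the quotient of the second one by it is a coordinate there.\<close>

locale chart =
  fixes l1 l2 m1 m2 :: complex and h :: "pt2 \<Rightarrow> complex" and n :: nat and U :: "pt2 set"
  assumes det1: "m1 * l2 - m2 * l1 = 1"
    and h: "h \<in> ternary_forms n" and n_pos: "n > 0"
    and U_def: "U = principal_open h"
    and U_chart: "\<And>a b c. (a, b, c) \<in> U \<Longrightarrow> l1\<^sup>2 * c - l1 * l2 * b + l2\<^sup>2 * a \<noteq> 0"
    and U_ne: "U \<noteq> {}"
begin

definition lf :: "pt1 \<Rightarrow> complex" where "lf t = l1 * fst t + l2 * snd t"
definition mf :: "pt1 \<Rightarrow> complex" where "mf t = m1 * fst t + m2 * snd t"
definition \<xi> :: "pt1 \<Rightarrow> complex" where "\<xi> t = mf t / lf t"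
definition L :: "pt2 \<Rightarrow> complex" where "L = (\<lambda>(a, b, c). l2\<^sup>2 * a + (- l1 * l2) * b + l1\<^sup>2 * c)"

lemma ternary_L: "L \<in> ternary_forms 1"
  unfolding L_def by (rule ternary_linear)

lemma L_divisor: "L (divisor x y) = lf x * lf y"
  by (simp add: L_def divisor_def lf_def algebra_simps power2_eq_square)

lemma L_nonzero: "u \<in> U \<Longrightarrow> L u \<noteq> 0"
  using U_chart by (cases u) (auto simp: L_def algebra_simps)

lemma mf_lf_bracket: "mf x * lf y - mf y * lf x = bracket x y"
proof -
  have "mf x * lf y - mf y * lf x = (m1 * l2 - m2 * l1) * bracket x y"
    by (simp add: mf_def lf_def bracket_def algebra_simps)
  then show ?thesis by (simp add: det1)
qed

lemma zero_notin_U: "(0, 0, 0) \<notin> U"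
  using U_chart by fastforce

lemma divisor_in_U_nonzero:
  assumes "divisor x y \<in> U"
  shows "x \<noteq> (0, 0)" "y \<noteq> (0, 0)" "lf x \<noteq> 0" "lf y \<noteq> 0"
proof -
  show "x \<noteq> (0, 0)" "y \<noteq> (0, 0)" using assms zero_notin_U divisor_eq_zero by metis+
  show "lf x \<noteq> 0" "lf y \<noteq> 0" using L_nonzero[OF assms] by (auto simp: L_divisor)
qed

lemma incidence_chart:
  assumes "w \<in> incidence U"
  obtains x y where "w = (divisor x y, x)" "divisor x y \<in> U"
proof -
  obtain u t where w: "w = (u, t)" by (cases w)
  then obtain y where "u \<in> U" "u = divisor t y" using assms incidence_iff by blast
  with w show thesis using that by blast
qed

lemma incidence_chart_iff: "(divisor x y, x) \<in> incidence U \<longleftrightarrow> divisor x y \<in> U"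
  using divisor_in_U_nonzero incidence_divisor incidence_iff by metis

lemma \<xi>_diff: "divisor x y \<in> U \<Longrightarrow> \<xi> x - \<xi> y = bracket x y / (lf x * lf y)"
  using divisor_in_U_nonzero[of x y]
  by (simp add: \<xi>_def field_simps flip: mf_lf_bracket)

lemma bihom_lf: "bihom 1 0 (\<lambda>x y. lf x)" "bihom 0 1 (\<lambda>x y. lf y)"
  unfolding lf_def by (intro bihom_add bihom_cmult bihom_coord)+

lemma bihom_mf: "bihom 1 0 (\<lambda>x y. mf x)" "bihom 0 1 (\<lambda>x y. mf y)"
  unfolding mf_def by (intro bihom_add bihom_cmult bihom_coord)+

lemma xi_coeffs_zero:
  assumes "u \<in> U" "disc u \<noteq> 0" "\<And>t. (u, t) \<in> incidence U \<Longrightarrow> \<alpha> + \<beta> * \<xi> t = 0"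
  shows "\<alpha> = 0 \<and> \<beta> = 0"
proof -
  obtain x y where u: "u = divisor x y" using divisor_surj by blast
  note nz = divisor_in_U_nonzero[OF assms(1)[unfolded u]]
  have "bracket x y \<noteq> 0" using assms(2) by (simp add: u disc_divisor)
  then have "\<xi> x - \<xi> y \<noteq> 0" using nz \<xi>_diff[OF assms(1)[unfolded u]] by simp
  moreover have a: "\<alpha> + \<beta> * \<xi> x = 0" "\<alpha> + \<beta> * \<xi> y = 0"
    using assms(3) incidence_divisor[OF assms(1)[unfolded u] nz(1,2)] u by auto
  then have "(\<alpha> + \<beta> * \<xi> x) - (\<alpha> + \<beta> * \<xi> y) = 0" by simp
  then have "\<beta> * (\<xi> x - \<xi> y) = 0" by (simp only: algebra_simps add_diff_cancel_left)
  ultimately have "\<beta> = 0" by simp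
  with a show ?thesis by simp
qed

lemma O_plane_xi_zero:
  assumes "\<alpha> \<in> O_plane U" "\<beta> \<in> O_plane U"
    and "\<And>u t. (u, t) \<in> incidence U \<Longrightarrow> \<alpha> u + \<beta> u * \<xi> t = 0"
  shows "\<alpha> u = 0 \<and> \<beta> u = 0"
proof -
  have *: "\<alpha> v = 0 \<and> \<beta> v = 0" if "h v \<noteq> 0" "disc v \<noteq> 0" for v
    using that by (intro xi_coeffs_zero[of v] assms(3)) (auto simp: U_def principal_open_def)
  show ?thesis
    using O_plane_zero_dense[OF h assms(1)[unfolded U_def]] O_plane_zero_dense[OF h assms(2)[unfolded U_def]] *
    by blast
qed

text \<open>On the double cover, seen as the space of ordered pairs, a regular function is near any
  one point a quotient of bihomogeneous forms of equal bidegree. Multiplying numerator and denominator by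
  the denominator makes the relation valid everywhere.\<close>

lemma O_inc_local_quotient:
  assumes f: "f \<in> O_inc U" and xy: "divisor x y \<in> U"
  shows "\<exists>e A B. bihom e e A \<and> bihom e e B \<and> B x y \<noteq> 0 \<and>
    (\<forall>x' y'. divisor x' y' \<in> U \<longrightarrow> A x' y' = f (divisor x' y', x') * B x' y')"
proof -
  have "(divisor x y, x) \<in> incidence U" using xy incidence_chart_iff by blast
  then obtain k a b where "a \<in> biforms k" "b \<in> biforms k" "b (divisor x y, x) \<noteq> 0"
    and q: "\<And>w. w \<in> incidence U \<Longrightarrow> b w \<noteq> 0 \<Longrightarrow> f w = a w / b w"
    using f unfolding O_inc_def regular_on_def by blast
  then obtain p q where ab: "a \<in> biforms (p, q)" "b \<in> biforms (p, q)" "b (divisor x y, x) \<noteq> 0"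
    by (cases k) auto
  define e where "e = (p + q) + (p + q)"
  define A where "A = (\<lambda>x y. (a (divisor x y, x) * b (divisor x y, x)) * lf y ^ (2 * q))"
  define B where "B = (\<lambda>x y. (b (divisor x y, x) * b (divisor x y, x)) * lf y ^ (2 * q))"
  have "bihom (((p + q) + (p + q)) + 2 * q * 0) ((p + p) + 2 * q * 1) A"
    "bihom (((p + q) + (p + q)) + 2 * q * 0) ((p + p) + 2 * q * 1) B"
    unfolding A_def B_def by (intro bihom_mult biforms_pullback ab bihom_power bihom_lf)+
  then have "bihom e e A" "bihom e e B" by (simp_all add: e_def algebra_simps mult_2)
  moreover have "B x y \<noteq> 0" using ab(3) divisor_in_U_nonzero[OF xy] by (simp add: B_def)
  moreover have "A x' y' = f (divisor x' y', x') * B x' y'" if "divisor x' y' \<in> U" for x' y'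
    using q[of "(divisor x' y', x')"] incidence_chart_iff that by (cases "b (divisor x' y', x') = 0") (auto simp: A_def B_def)
  ultimately show ?thesis by blast
qed

text \<open>Each point of the fibre has a quotient that is defined there. Since both satisfy the relation everywhere, so do their
  combinations, and a suitable one is defined at both points.\<close>

lemma O_inc_semilocal_quotient:
  assumes f: "f \<in> O_inc U" and xy: "divisor x y \<in> U"
  shows "\<exists>e A B. bihom e e A \<and> bihom e e B \<and> B x y \<noteq> 0 \<and> B y x \<noteq> 0 \<and>
    (\<forall>x' y'. divisor x' y' \<in> U \<longrightarrow> A x' y' = f (divisor x' y', x') * B x' y')"
proof -
  have yx: "divisor y x \<in> U" using xy divisor_commute by metis
  obtain e1 A1 B1 where 1: "bihom e1 e1 A1" "bihom e1 e1 B1" "B1 x y \<noteq> 0"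
    "\<And>x' y'. divisor x' y' \<in> U \<Longrightarrow> A1 x' y' = f (divisor x' y', x') * B1 x' y'"
    using O_inc_local_quotient[OF f xy] by blast
  obtain e2 A2 B2 where 2: "bihom e2 e2 A2" "bihom e2 e2 B2" "B2 y x \<noteq> 0"
    "\<And>x' y'. divisor x' y' \<in> U \<Longrightarrow> A2 x' y' = f (divisor x' y', x') * B2 x' y'"
    using O_inc_local_quotient[OF f yx] by blast
  define K where "K = (\<lambda>e x y. (lf x * lf y) ^ e)"
  have K: "bihom e e (K e)" for e
  proof -
    have "bihom (e * (1 + 0)) (e * (0 + 1)) (K e)"
      unfolding K_def by (intro bihom_power bihom_mult bihom_lf)
    then show ?thesis by simp
  qed
  have Knz: "K e x y \<noteq> 0" "K e y x \<noteq> 0" for e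
    using divisor_in_U_nonzero[OF xy] by (simp_all add: K_def)
  define A where "A = (\<lambda>i j x y. i * (A1 x y * K e2 x y) + j * (A2 x y * K e1 x y))"
  define B where "B = (\<lambda>i j x y. i * (B1 x y * K e2 x y) + j * (B2 x y * K e1 x y))"
  have bi: "bihom (e1 + e2) (e1 + e2) (\<lambda>x y. C x y * K e2 x y)" if "bihom e1 e1 C" for C
    by (intro bihom_mult that K)
  have bi': "bihom (e1 + e2) (e1 + e2) (\<lambda>x y. C x y * K e1 x y)" if "bihom e2 e2 C" for C
    using bihom_mult[OF that K[of e1]] by (simp add: add.commute)
  have "bihom (e1 + e2) (e1 + e2) (A i j)" "bihom (e1 + e2) (e1 + e2) (B i j)" for i j
    unfolding A_def B_def by (intro bihom_add bihom_cmult bi bi' 1 2)+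
  moreover have "\<forall>x' y'. divisor x' y' \<in> U \<longrightarrow> A i j x' y' = f (divisor x' y', x') * B i j x' y'" for i j
    using 1(4) 2(4) by (simp add: A_def B_def algebra_simps)
  moreover have "\<exists>i j. B i j x y \<noteq> 0 \<and> B i j y x \<noteq> 0"
  proof (cases "B1 y x = 0")
    case False
    then show ?thesis using 1(3) Knz by (intro exI[of _ 1] exI[of _ 0]) (simp add: B_def)
  next
    case b1: True
    show ?thesis
    proof (cases "B2 x y = 0")
      case False
      then show ?thesis using 2(3) Knz by (intro exI[of _ 0] exI[of _ 1]) (simp add: B_def)
    next
      case True
      then show ?thesis using b1 1(3) 2(3) Knz by (intro exI[of _ 1] exI[of _ 1]) (simp add: B_def)
    qed
  qed
  ultimately show ?thesis by blast
qed

text \<open>Multiplying by the conjugate denominator makes the denominator symmetric, so that only the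
  numerator, a bihomogeneous form, has to be split.\<close>

lemma O_inc_local_split:
  assumes f: "f \<in> O_inc U" and u: "u \<in> U"
  shows "\<exists>k. \<exists>G0\<in>ternary_forms k. \<exists>G1\<in>ternary_forms k. \<exists>N\<in>ternary_forms k. N u \<noteq> 0 \<and>
    (\<forall>v t. (v, t) \<in> incidence U \<longrightarrow> N v * f (v, t) = G0 v + G1 v * \<xi> t)"
proof -
  obtain x y where xy: "u = divisor x y" using divisor_surj by blast
  obtain e A B where AB: "bihom e e A" "bihom e e B" "B x y \<noteq> 0" "B y x \<noteq> 0"
    "\<And>x' y'. divisor x' y' \<in> U \<Longrightarrow> A x' y' = f (divisor x' y', x') * B x' y'"
    using O_inc_semilocal_quotient[OF f] u xy by blast
  have "bihom (e + e) (e + e) (\<lambda>x y. B x y * B y x)" "bihom (e + e) (e + e) (\<lambda>x y. A x y * B y x)"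
    by (intro bihom_mult AB bihom_swap)+
  then obtain N G H where N: "N \<in> ternary_forms (e + e)" "\<And>x y. B x y * B y x = N (divisor x y)"
    and G: "G \<in> ternary_forms (e + e)" and H: "H \<in> ternary_pred (e + e)"
    and A': "\<And>x y. A x y * B y x = G (divisor x y) + fst x * snd y * H (divisor x y)"
    using bihom_symmetric_descends[of "e + e" "\<lambda>x y. B x y * B y x"]
      bihom_splits[of "e + e" "\<lambda>x y. A x y * B y x"] unfolding splits_def
    by (auto simp: mult.commute)
  define S where "S = (\<lambda>(a, b, c). (m2 * l2) * a + (- m2 * l1) * b + (m1 * l1) * c)"
  have S: "fst x * snd y = mf x * lf y - S (divisor x y)" for x y
  proof -
    have "mf x * lf y - S (divisor x y) = (m1 * l2 - m2 * l1) * (fst x * snd y)"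
      by (simp add: mf_def lf_def S_def divisor_def algebra_simps)
    then show ?thesis by (simp add: det1)
  qed
  have G0: "(\<lambda>u. G u - S u * H u) \<in> ternary_forms (e + e)"
    unfolding S_def by (intro ternary_diff G ternary_pred_mult[OF _ H] ternary_linear)
  have G1: "(\<lambda>u. L u * H u) \<in> ternary_forms (e + e)"
    by (intro ternary_pred_mult[OF ternary_L H])
  have "N v * f (v, t) = (G v - S v * H v) + (L v * H v) * \<xi> t" if vt: "(v, t) \<in> incidence U" for v t
  proof -
    obtain y where v: "v = divisor t y" "divisor t y \<in> U" using vt incidence_chart by blast
    have "mf t * lf y = L v * \<xi> t"
      using divisor_in_U_nonzero[OF v(2)] by (simp add: v(1) L_divisor \<xi>_def)
    moreover have "N v * f (v, t) = A t y * B y t"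
      using AB(5)[OF v(2)] N(2)[of t y] v(1) by (simp add: algebra_simps)
    ultimately show ?thesis unfolding A' S v(1)[symmetric] by (simp add: algebra_simps)
  qed
  moreover have "N u \<noteq> 0" using AB N(2)[of x y] xy by auto
  ultimately show ?thesis using N(1)
    by (intro exI[of _ "e + e"] rev_bexI[OF G0] rev_bexI[OF G1] rev_bexI[OF N(1)]) auto
qed

text \<open>Away from the discriminant the coefficients of \<open>1\<close> and \<open>\<xi>\<close> are determined by the function,
  so the local splittings agree as quotients of forms and glue.\<close>

lemma O_inc_split:
  assumes f: "f \<in> O_inc U"
  shows "\<exists>\<alpha>\<in>O_plane U. \<exists>\<beta>\<in>O_plane U. \<forall>u t. (u, t) \<in> incidence U \<longrightarrow> f (u, t) = \<alpha> u + \<beta> u * \<xi> t"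
proof -
  have "\<forall>u. \<exists>k G0 G1 N. u \<in> U \<longrightarrow> G0 \<in> ternary_forms k \<and> G1 \<in> ternary_forms k \<and>
      N \<in> ternary_forms k \<and> N u \<noteq> 0 \<and>
      (\<forall>v t. (v, t) \<in> incidence U \<longrightarrow> N v * f (v, t) = G0 v + G1 v * \<xi> t)"
    using O_inc_local_split[OF f] by blast
  then obtain k G0 G1 N where *: "\<And>u. u \<in> U \<Longrightarrow> G0 u \<in> ternary_forms (k u)"
    "\<And>u. u \<in> U \<Longrightarrow> G1 u \<in> ternary_forms (k u)" "\<And>u. u \<in> U \<Longrightarrow> N u \<in> ternary_forms (k u)"
    "\<And>u. u \<in> U \<Longrightarrow> N u u \<noteq> 0"
    "\<And>u v t. u \<in> U \<Longrightarrow> (v, t) \<in> incidence U \<Longrightarrow> N u v * f (v, t) = G0 u v + G1 u v * \<xi> t"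
    by metis
  define \<alpha> where "\<alpha> = (\<lambda>u. if u \<in> U then G0 u u / N u u else 0)"
  define \<beta> where "\<beta> = (\<lambda>u. if u \<in> U then G1 u u / N u u else 0)"
  have agree: "N u v * G0 w v - N w v * G0 u v = 0" "N u v * G1 w v - N w v * G1 u v = 0"
    if "u \<in> U" "w \<in> U" for u v w
  proof -
    obtain p where p: "h p \<noteq> 0" using U_ne by (auto simp: U_def principal_open_def)
    have T: "(\<lambda>v. N u v * G0 w v - N w v * G0 u v) \<in> ternary_forms (k u + k w)"
      "(\<lambda>v. N u v * G1 w v - N w v * G1 u v) \<in> ternary_forms (k u + k w)"
      using ternary_diff[OF ternary_mult[OF *(3)[OF that(1)] *(1)[OF that(2)]]
          ternary_mult[OF *(3)[OF that(2)] *(1)[OF that(1)], unfolded add.commute[of "k w"]]]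
        ternary_diff[OF ternary_mult[OF *(3)[OF that(1)] *(2)[OF that(2)]]
          ternary_mult[OF *(3)[OF that(2)] *(2)[OF that(1)], unfolded add.commute[of "k w"]]]
      by simp_all
    have "N u v * G0 w v - N w v * G0 u v = 0 \<and> N u v * G1 w v - N w v * G1 u v = 0"
      if v: "h v \<noteq> 0" "disc v \<noteq> 0" for v
    proof (rule xi_coeffs_zero)
      show "v \<in> U" using v by (simp add: U_def principal_open_def)
      fix t assume t: "(v, t) \<in> incidence U"
      have "N u v * (G0 w v + G1 w v * \<xi> t) = N w v * (G0 u v + G1 u v * \<xi> t)"
        unfolding *(5)[OF \<open>u \<in> U\<close> t, symmetric] *(5)[OF \<open>w \<in> U\<close> t, symmetric] by simp
      then show "N u v * G0 w v - N w v * G0 u v + (N u v * G1 w v - N w v * G1 u v) * \<xi> t = 0"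
        by (simp add: algebra_simps)
    qed (use v in auto)
    then show "N u v * G0 w v - N w v * G0 u v = 0" "N u v * G1 w v - N w v * G1 u v = 0"
      using ternary_zero_dense[OF T(1) h p] ternary_zero_dense[OF T(2) h p] by auto
  qed
  have loc: "\<exists>k. \<exists>a\<in>ternary_forms k. \<exists>b\<in>ternary_forms k. b u \<noteq> 0 \<and>
      (\<forall>v\<in>U. b v \<noteq> 0 \<longrightarrow> (if v \<in> U then G v v / N v v else 0) = a v / b v)"
    if u: "u \<in> U" and G: "\<And>u. u \<in> U \<Longrightarrow> G u \<in> ternary_forms (k u)"
      and ag: "\<And>u v w. u \<in> U \<Longrightarrow> w \<in> U \<Longrightarrow> N u v * G w v - N w v * G u v = 0" for G u
  proof (rule exI, rule bexI[OF _ G[OF u]], rule bexI[OF _ *(3)[OF u]], intro conjI ballI impI)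
    fix v assume v: "v \<in> U" "N u v \<noteq> 0"
    then show "(if v \<in> U then G v v / N v v else 0) = G u v / N u v"
      using ag[OF v(1) u, of v] *(4)[OF v(1)] by (simp add: field_simps)
  qed (use u * in auto)
  have "\<alpha> \<in> O_plane U" "\<beta> \<in> O_plane U"
    unfolding O_plane_iff \<alpha>_def \<beta>_def using loc[OF _ *(1) agree(1)] loc[OF _ *(2) agree(2)] by auto
  moreover have "f (u, t) = \<alpha> u + \<beta> u * \<xi> t" if "(u, t) \<in> incidence U" for u t
  proof -
    have "u \<in> U" using that by (auto simp: incidence_def)
    then show ?thesis using *(5)[OF _ that, of u] *(4)[of u]
      by (simp add: \<alpha>_def \<beta>_def field_simps)
  qed
  ultimately show ?thesis by blast
qed

end

section \<open>The Fitting ideal of a square presentation\<close>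

lemma comm_ring_hom_eval: "comm_ring_hom (\<lambda>f :: 'x \<Rightarrow> 'c :: comm_ring_1. f x)"
  by unfold_locales simp_all

text \<open>Rings of functions have zero divisors, so block determinants are computed pointwise.\<close>

lemma det_block_lower_fun:
  fixes P :: "('x \<Rightarrow> 'c :: idom) mat"
  assumes "P \<in> carrier_mat n n" "R \<in> carrier_mat m n" "S \<in> carrier_mat m m"
  shows "det (four_block_mat P (0\<^sub>m n m) R S) = det P * det S"
proof
  fix x
  interpret comm_ring_hom "\<lambda>f :: 'x \<Rightarrow> 'c. f x" by (rule comm_ring_hom_eval)
  have "map_mat (\<lambda>f. f x) (four_block_mat P (0\<^sub>m n m) R S)
      = four_block_mat (map_mat (\<lambda>f. f x) P) (0\<^sub>m n m) (map_mat (\<lambda>f. f x) R) (map_mat (\<lambda>f. f x) S)"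
    using assms by (intro eq_matI) auto
  then show "det (four_block_mat P (0\<^sub>m n m) R S) x = (det P * det S) x"
    using det_four_block_mat_upper_right_zero[of "map_mat (\<lambda>f. f x) P" n "0\<^sub>m n m" m
        "map_mat (\<lambda>f. f x) R" "map_mat (\<lambda>f. f x) S"] assms
    by (simp flip: hom_det)
qed

lemma det_block_upper_fun:
  fixes P :: "('x \<Rightarrow> 'c :: idom) mat"
  assumes "P \<in> carrier_mat n n" "R \<in> carrier_mat n m" "S \<in> carrier_mat m m"
  shows "det (four_block_mat P R (0\<^sub>m m n) S) = det P * det S"
proof
  fix x
  interpret comm_ring_hom "\<lambda>f :: 'x \<Rightarrow> 'c. f x" by (rule comm_ring_hom_eval)
  have "map_mat (\<lambda>f. f x) (four_block_mat P R (0\<^sub>m m n) S)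
      = four_block_mat (map_mat (\<lambda>f. f x) P) (map_mat (\<lambda>f. f x) R) (0\<^sub>m m n) (map_mat (\<lambda>f. f x) S)"
    using assms by (intro eq_matI) auto
  then show "det (four_block_mat P R (0\<^sub>m m n) S) x = (det P * det S) x"
    using det_four_block_mat_lower_left_zero[of "map_mat (\<lambda>f. f x) P" n "map_mat (\<lambda>f. f x) R" m
        "0\<^sub>m m n" "map_mat (\<lambda>f. f x) S"] assms
    by (simp flip: hom_det)
qed

lemma det_closed:
  fixes B :: "'r :: comm_ring_1 mat"
  assumes B: "B \<in> carrier_mat n n" "\<And>i j. i < n \<Longrightarrow> j < n \<Longrightarrow> B $$ (i, j) \<in> S"
    and S: "0 \<in> S" "1 \<in> S" "\<And>a b. a \<in> S \<Longrightarrow> b \<in> S \<Longrightarrow> a + b \<in> S"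
      "\<And>a b. a \<in> S \<Longrightarrow> b \<in> S \<Longrightarrow> a * b \<in> S" "\<And>a. a \<in> S \<Longrightarrow> - a \<in> S"
  shows "det B \<in> S"
proof -
  have sum: "sum f I \<in> S" if "\<And>i. i \<in> I \<Longrightarrow> f i \<in> S" for f :: "'b \<Rightarrow> 'r" and I
    using that by (induction I rule: infinite_finite_induct) (auto intro: S)
  have prod: "prod f I \<in> S" if "\<And>i. i \<in> I \<Longrightarrow> f i \<in> S" for f :: "nat \<Rightarrow> 'r" and I
    using that by (induction I rule: infinite_finite_induct) (auto intro: S)
  have sign: "signof p \<in> S" for p :: "nat \<Rightarrow> nat" by (auto simp: sign_def intro: S)
  show ?thesis unfolding det_def'[OF B(1)]
    by (intro sum S(4) sign prod B(2)) (auto dest: permutes_in_image)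
qed

lemma ideal_gen_mono: "S \<subseteq> T \<Longrightarrow> ideal_gen A S \<subseteq> ideal_gen A T"
  unfolding ideal_gen_def by blast

lemma ideal_gen_subset_principal:
  assumes "\<And>s a. s \<in> S \<Longrightarrow> a \<in> A \<Longrightarrow> \<exists>b\<in>A. a * s = b * D"
  shows "ideal_gen A S \<subseteq> ideal_gen A {D}"
proof
  fix x assume "x \<in> ideal_gen A S"
  then obtain k :: nat and a s where x: "x = (\<Sum>i<k. a i * s i)" "\<forall>i<k. a i \<in> A \<and> s i \<in> S"
    unfolding ideal_gen_def by blast
  then have "\<forall>i. \<exists>b. i < k \<longrightarrow> b \<in> A \<and> a i * s i = b * D" using assms by blast
  then obtain b where "\<And>i. i < k \<Longrightarrow> b i \<in> A \<and> a i * s i = b i * D" by metis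
  then have "x = (\<Sum>i<k. b i * (\<lambda>_. D) i)" "\<forall>i<k. b i \<in> A \<and> (\<lambda>_. D) i \<in> {D}"
    using x by auto
  then show "x \<in> ideal_gen A {D}" unfolding ideal_gen_def
    by (intro CollectI exI[of _ k] exI[of _ b] exI[of _ "\<lambda>_. D"]) simp
qed

text \<open>The unit \<open>e\<close> of \<open>A\<close> need not be the constant function \<open>1\<close>: for functions extended by zero it is
  the indicator function of their domain.\<close>

locale function_module =
  fixes A :: "('x \<Rightarrow> 'c :: idom) set" and e :: "'x \<Rightarrow> 'c"
    and sc :: "('x \<Rightarrow> 'c) \<Rightarrow> 'm :: ab_group_add \<Rightarrow> 'm" and E N :: "'m set"
  assumes A_add: "\<And>a b. a \<in> A \<Longrightarrow> b \<in> A \<Longrightarrow> a + b \<in> A"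
    and A_mult: "\<And>a b. a \<in> A \<Longrightarrow> b \<in> A \<Longrightarrow> a * b \<in> A"
    and A_uminus: "\<And>a. a \<in> A \<Longrightarrow> - a \<in> A"
    and unit_A: "e \<in> A" and unit: "\<And>a. a \<in> A \<Longrightarrow> e * a = a"
    and sc_add_left: "\<And>a b m. sc (a + b) m = sc a m + sc b m"
    and sc_add_right: "\<And>a m m'. sc a (m + m') = sc a m + sc a m'"
    and sc_mult: "\<And>a b m. sc (a * b) m = sc a (sc b m)"
    and sc_unit: "\<And>m. m \<in> E \<Longrightarrow> sc e m = m"
    and N_zero: "0 \<in> N" and N_add: "\<And>m m'. m \<in> N \<Longrightarrow> m' \<in> N \<Longrightarrow> m + m' \<in> N"
    and N_uminus: "\<And>m. m \<in> N \<Longrightarrow> - m \<in> N"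
    and N_scale: "\<And>a m. a \<in> A \<Longrightarrow> m \<in> N \<Longrightarrow> sc a m \<in> N"
begin

lemma A_zero: "0 \<in> A" using A_add[OF unit_A A_uminus[OF unit_A]] by simp

lemma A_diff: "a \<in> A \<Longrightarrow> b \<in> A \<Longrightarrow> a - b \<in> A"
  using A_add[OF _ A_uminus, of a b] by simp

lemma A_sum: "(\<And>i. i \<in> I \<Longrightarrow> f i \<in> A) \<Longrightarrow> sum f I \<in> A"
  by (induction I rule: infinite_finite_induct) (auto intro: A_zero A_add)

lemma N_sum: "(\<And>i. i \<in> I \<Longrightarrow> f i \<in> N) \<Longrightarrow> sum f I \<in> N"
  by (induction I rule: infinite_finite_induct) (auto intro: N_zero N_add)

lemma N_diff: "m \<in> N \<Longrightarrow> m' \<in> N \<Longrightarrow> m - m' \<in> N"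
  using N_add[OF _ N_uminus, of m m'] by simp

lemma sc_zero_left: "sc 0 m = 0"
  using sc_add_left[of 0 0 m] by simp

lemma sc_diff_left: "sc (a - b) m = sc a m - sc b m"
  using sc_add_left[of "a - b" b m] by (simp add: algebra_simps)

lemma sc_sum_left: "sc (\<Sum>i\<in>I. f i) m = (\<Sum>i\<in>I. sc (f i) m)"
  by (induction I rule: infinite_finite_induct) (simp_all only: sum.infinite sum.empty sum.insert sc_zero_left sc_add_left if_False not_False_eq_True)

lemma sc_zero_right: "sc a 0 = 0"
  using sc_add_right[of a 0 0] by simp

lemma sc_diff_right: "sc a (m - m') = sc a m - sc a m'"
  using sc_add_right[of a "m - m'" m'] by (simp add: algebra_simps)

lemma sc_sum_right: "sc a (\<Sum>i\<in>I. f i) = (\<Sum>i\<in>I. sc a (f i))"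
  by (induction I rule: infinite_finite_induct) (simp_all only: sum.infinite sum.empty sum.insert sc_zero_right sc_add_right if_False not_False_eq_True)

text \<open>Substituting expressions in the generators \<open>\<epsilon>\<close> into a combination of the \<open>m j\<close>.\<close>

lemma substitute:
  assumes "\<And>j. j < n \<Longrightarrow> b j \<in> A"
    and "\<And>j. j < n \<Longrightarrow> m j - (\<Sum>k<p. sc (c j k) (\<epsilon> k)) \<in> N"
  shows "(\<Sum>j<n. sc (b j) (m j)) - (\<Sum>k<p. sc (\<Sum>j<n. b j * c j k) (\<epsilon> k)) \<in> N"
proof -
  have "(\<Sum>k<p. sc (\<Sum>j<n. b j * c j k) (\<epsilon> k)) = (\<Sum>j<n. sc (b j) (\<Sum>k<p. sc (c j k) (\<epsilon> k)))"
    unfolding sc_sum_left sc_sum_right sc_mult by (rule sum.swap)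
  then have "(\<Sum>j<n. sc (b j) (m j)) - (\<Sum>k<p. sc (\<Sum>j<n. b j * c j k) (\<epsilon> k))
      = (\<Sum>j<n. sc (b j) (m j - (\<Sum>k<p. sc (c j k) (\<epsilon> k))))"
    by (simp add: sc_diff_right sum_subtractf)
  also have "\<dots> \<in> N" using assms by (intro N_sum N_scale) auto
  finally show ?thesis .
qed

text \<open>Fitting's lemma for a module with as many relations as generators. Let \<open>a\<close> be a matrix of relations of another
  family, which is expressed in the \<open>\<epsilon>\<close> by \<open>c\<close>, and let \<open>g\<close> express the \<open>\<epsilon>\<close> in that family. The relations
  of the union of both families form the block matrix with rows \<open>(a, 0)\<close> and \<open>(-g, e)\<close>. Substituting \<open>c\<close> is a unimodular
  column operation; afterwards the columns of the \<open>\<epsilon>\<close> contain relations between the \<open>\<epsilon>\<close>,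
  hence multiples of \<open>M\<close>, and \<open>det M\<close> can be taken out of the determinant.\<close>

lemma fitting0_square_presentation:
  assumes gen: "generates_mod A sc E N p \<epsilon>"
    and M: "\<And>l k. l < p \<Longrightarrow> k < p \<Longrightarrow> M l k \<in> A"
      "\<And>l. l < p \<Longrightarrow> (\<Sum>k<p. sc (M l k) (\<epsilon> k)) \<in> N"
    and complete: "\<And>r. (\<And>k. k < p \<Longrightarrow> r k \<in> A) \<Longrightarrow> (\<Sum>k<p. sc (r k) (\<epsilon> k)) \<in> N \<Longrightarrow>
      \<exists>s. (\<forall>l<p. s l \<in> A) \<and> (\<forall>k<p. r k = (\<Sum>l<p. s l * M l k))"
  shows "fitting0 A sc E N = ideal_gen A {det (mat p p (\<lambda>(i, j). M i j))}"
proof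
  let ?D = "det (mat p p (\<lambda>(i, j). M i j))"
  show "ideal_gen A {?D} \<subseteq> fitting0 A sc E N"
    unfolding fitting0_def using gen M by (intro ideal_gen_mono) blast
  show "fitting0 A sc E N \<subseteq> ideal_gen A {?D}"
    unfolding fitting0_def
  proof (rule ideal_gen_subset_principal)
    fix d a0 assume a0: "a0 \<in> A" and "d \<in> {det (mat n n (\<lambda>(i, j). a i j)) | n a.
      \<exists>m. generates_mod A sc E N n m \<and> (\<forall>i<n. (\<forall>j<n. a i j \<in> A) \<and> (\<Sum>j<n. sc (a i j) (m j)) \<in> N)}"
    then obtain n a m where d: "d = det (mat n n (\<lambda>(i, j). a i j))"
      and m: "generates_mod A sc E N n m"
      and a: "\<And>i j. i < n \<Longrightarrow> j < n \<Longrightarrow> a i j \<in> A" "\<And>i. i < n \<Longrightarrow> (\<Sum>j<n. sc (a i j) (m j)) \<in> N"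
      by blast
    have "\<forall>j. \<exists>c. j < n \<longrightarrow> (\<forall>k<p. c k \<in> A) \<and> m j - (\<Sum>k<p. sc (c k) (\<epsilon> k)) \<in> N"
      using gen m unfolding generates_mod_def by blast
    then obtain c where c: "\<And>j k. j < n \<Longrightarrow> k < p \<Longrightarrow> c j k \<in> A"
      "\<And>j. j < n \<Longrightarrow> m j - (\<Sum>k<p. sc (c j k) (\<epsilon> k)) \<in> N" by metis
    have "\<forall>k. \<exists>g. k < p \<longrightarrow> (\<forall>j<n. g j \<in> A) \<and> \<epsilon> k - (\<Sum>j<n. sc (g j) (m j)) \<in> N"
      using gen m unfolding generates_mod_def by blast
    then obtain g where g: "\<And>k j. k < p \<Longrightarrow> j < n \<Longrightarrow> g k j \<in> A"
      "\<And>k. k < p \<Longrightarrow> \<epsilon> k - (\<Sum>j<n. sc (g k j) (m j)) \<in> N" by metis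
    have "\<exists>s. i < n \<longrightarrow> (\<forall>l<p. s l \<in> A) \<and> (\<forall>k<p. (\<Sum>j<n. a i j * c j k) = (\<Sum>l<p. s l * M l k))" for i
    proof (cases "i < n")
      case True
      have "(\<Sum>k<p. sc (\<Sum>j<n. a i j * c j k) (\<epsilon> k)) \<in> N"
      proof -
        have "(\<Sum>j<n. sc (a i j) (m j)) - (\<Sum>k<p. sc (\<Sum>j<n. a i j * c j k) (\<epsilon> k)) \<in> N"
          using a(1) c(2) True by (intro substitute) auto
        from N_diff[OF a(2)[OF True] this] show ?thesis by simp
      qed
      moreover have "(\<Sum>j<n. a i j * c j k) \<in> A" if "k < p" for k
        using a(1) c(1) True that by (intro A_sum A_mult) auto
      ultimately show ?thesis using complete[of "\<lambda>k. \<Sum>j<n. a i j * c j k"] by blast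
    qed auto
    then have "\<exists>s. \<forall>i. i < n \<longrightarrow> (\<forall>l<p. s i l \<in> A) \<and>
        (\<forall>k<p. (\<Sum>j<n. a i j * c j k) = (\<Sum>l<p. s i l * M l k))"
      by (intro choice allI)
    then obtain s where s: "\<And>i l. i < n \<Longrightarrow> l < p \<Longrightarrow> s i l \<in> A"
      "\<And>i k. i < n \<Longrightarrow> k < p \<Longrightarrow> (\<Sum>j<n. a i j * c j k) = (\<Sum>l<p. s i l * M l k)" by blast
    define \<delta> where "\<delta> = (\<lambda>k q :: nat. if q = k then e else 0)"
    have "\<exists>t. k < p \<longrightarrow> (\<forall>l<p. t l \<in> A) \<and>
        (\<forall>q<p. \<delta> k q - (\<Sum>j<n. g k j * c j q) = (\<Sum>l<p. t l * M l q))" for k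
    proof (cases "k < p")
      case True
      have "(\<Sum>q<p. sc (\<delta> k q) (\<epsilon> q)) = (\<Sum>q<p. if q = k then sc e (\<epsilon> q) else 0)"
        by (intro sum.cong) (auto simp: \<delta>_def sc_zero_left)
      also have "\<dots> = \<epsilon> k" using True gen by (simp add: sc_unit generates_mod_def)
      finally have "(\<Sum>q<p. sc (\<delta> k q - (\<Sum>j<n. g k j * c j q)) (\<epsilon> q))
          = (\<epsilon> k - (\<Sum>j<n. sc (g k j) (m j)))
            + ((\<Sum>j<n. sc (g k j) (m j)) - (\<Sum>q<p. sc (\<Sum>j<n. g k j * c j q) (\<epsilon> q)))"
        by (simp add: sc_diff_left sum_subtractf)
      also have "\<dots> \<in> N" using True g c by (intro N_add substitute) auto
      finally have "(\<Sum>q<p. sc (\<delta> k q - (\<Sum>j<n. g k j * c j q)) (\<epsilon> q)) \<in> N" .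
      moreover have "\<delta> k q - (\<Sum>j<n. g k j * c j q) \<in> A" if "q < p" for q
        using g(1) c(1) True that unit_A A_zero
        by (intro A_diff A_sum A_mult) (auto simp: \<delta>_def)
      ultimately show ?thesis
        using complete[of "\<lambda>q. \<delta> k q - (\<Sum>j<n. g k j * c j q)"] by blast
    qed auto
    then have "\<exists>t. \<forall>k. k < p \<longrightarrow> (\<forall>l<p. t k l \<in> A) \<and>
        (\<forall>q<p. \<delta> k q - (\<Sum>j<n. g k j * c j q) = (\<Sum>l<p. t k l * M l q))"
      by (intro choice allI)
    then obtain t where t: "\<And>k l. k < p \<Longrightarrow> l < p \<Longrightarrow> t k l \<in> A"
      "\<And>k q. k < p \<Longrightarrow> q < p \<Longrightarrow> \<delta> k q - (\<Sum>j<n. g k j * c j q) = (\<Sum>l<p. t k l * M l q)" by blast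
    define Am where "Am = mat n n (\<lambda>(i, j). a i j)"
    define Cm where "Cm = mat n p (\<lambda>(i, j). c i j)"
    define Gm where "Gm = mat p n (\<lambda>(i, j). - g i j)"
    define Sm where "Sm = mat n p (\<lambda>(i, j). s i j)"
    define Tm where "Tm = mat p p (\<lambda>(i, j). t i j)"
    define Mm where "Mm = mat p p (\<lambda>(i, j). M i j)"
    note defs = Am_def Cm_def Gm_def Sm_def Tm_def Mm_def
    have carrier: "Am \<in> carrier_mat n n" "Cm \<in> carrier_mat n p" "Gm \<in> carrier_mat p n"
      "Sm \<in> carrier_mat n p" "Tm \<in> carrier_mat p p" "Mm \<in> carrier_mat p p"
      unfolding defs by simp_all
    have AC: "Am * Cm = Sm * Mm"
      by (intro eq_matI) (use s(2) in \<open>auto simp: defs scalar_prod_def lessThan_atLeast0\<close>)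
    have GC: "Gm * Cm + e \<cdot>\<^sub>m 1\<^sub>m p = Tm * Mm"
    proof (intro eq_matI)
      fix i j assume "i < dim_row (Tm * Mm)" "j < dim_col (Tm * Mm)"
      then have ij: "i < p" "j < p" by (simp_all add: defs)
      have "(Tm * Mm) $$ (i, j) = (\<Sum>l<p. t i l * M l j)"
        using ij by (simp add: defs scalar_prod_def lessThan_atLeast0)
      also have "\<dots> = \<delta> i j - (\<Sum>l<n. g i l * c l j)" using t(2)[OF ij] by simp
      finally show "(Gm * Cm + e \<cdot>\<^sub>m 1\<^sub>m p) $$ (i, j) = (Tm * Mm) $$ (i, j)"
        using ij by (simp add: defs scalar_prod_def lessThan_atLeast0 \<delta>_def sum_negf)
    qed (simp_all add: defs)
    define Z where "Z = four_block_mat Am Sm Gm Tm"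
    have Z: "Z \<in> carrier_mat (n + p) (n + p)"
      unfolding Z_def using carrier by simp
    have "four_block_mat Am (0\<^sub>m n p) Gm (e \<cdot>\<^sub>m 1\<^sub>m p) * four_block_mat (1\<^sub>m n) Cm (0\<^sub>m p n) (1\<^sub>m p)
        = four_block_mat Am (Am * Cm) Gm (Gm * Cm + e \<cdot>\<^sub>m 1\<^sub>m p)"
      using carrier by (subst mult_four_block_mat[of _ n n _ p _ p _ _ n _ p]) auto
    also have "\<dots> = Z * four_block_mat (1\<^sub>m n) (0\<^sub>m n p) (0\<^sub>m p n) Mm"
      unfolding Z_def AC GC using carrier
      by (subst mult_four_block_mat[of _ n n _ p _ p _ _ n _ p]) auto
    finally have "det (four_block_mat Am (0\<^sub>m n p) Gm (e \<cdot>\<^sub>m 1\<^sub>m p))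
        * det (four_block_mat (1\<^sub>m n) Cm (0\<^sub>m p n) (1\<^sub>m p))
      = det Z * det (four_block_mat (1\<^sub>m n) (0\<^sub>m n p) (0\<^sub>m p n) Mm)"
      using carrier Z by (simp flip: det_mult[of _ "n + p"])
    then have dets: "det Am * e ^ p = det Z * det Mm"
      using carrier by (simp add: det_block_lower_fun[of _ n] det_block_upper_fun[of _ n])
    \<comment> \<open>Only multiples by elements of \<open>A\<close> matter, and these absorb the powers of the idempotent \<open>e\<close>.\<close>
    have pow: "a0 * e ^ q = a0" for q
    proof (induction q)
      case (Suc q)
      have "a0 * e ^ Suc q = (e * a0) * e ^ q" by (simp only: power_Suc mult.assoc mult.left_commute)
      then show ?case by (simp only: unit[OF a0] Suc)
    qed (simp only: power_0 mult_1_right)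
    \<comment> \<open>The determinant of an empty matrix is \<open>1\<close>, which may lie outside \<open>A\<close>; the idealizer contains it.\<close>
    have "det Z \<in> {z. \<forall>b\<in>A. b * z \<in> A}"
    proof (rule det_closed[OF Z])
      fix i j assume "i < n + p" "j < n + p"
      then have "Z $$ (i, j) \<in> A"
        unfolding Z_def using carrier by (auto simp: defs intro!: a s t A_uminus[OF g(1)])
      then show "Z $$ (i, j) \<in> {z. \<forall>b\<in>A. b * z \<in> A}" using A_mult by blast
    qed (auto simp: A_zero distrib_left intro: A_add A_uminus simp flip: mult.assoc)
    then have "a0 * det Z \<in> A" using a0 by blast
    moreover have "a0 * d = (a0 * det Z) * ?D"
    proof -
      have "a0 * d = a0 * (det Am * e ^ p)"
        unfolding d Am_def by (metis pow[of p] mult.assoc mult.commute)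
      then show ?thesis unfolding dets Mm_def by (simp add: mult.assoc)
    qed
    ultimately show "\<exists>b\<in>A. a0 * d = b * ?D" by blast
  qed
qed

end

section \<open>Linear algebra of the Klein quadric\<close>

text \<open>The alternating form of a functional \<open>p\<close> on the exterior square, as a map from \<open>V\<close> to its dual. Vectors are functions of which only
  the first four or six values count; the six coordinates are in the order \<open>01, 02, 03, 12, 13, 23\<close>.\<close>

definition altmap :: "(nat \<Rightarrow> complex) \<Rightarrow> (nat \<Rightarrow> complex) \<Rightarrow> nat \<Rightarrow> complex" where
  "altmap p v = (\<lambda>i.
     if i = 0 then p 0 * v 1 + p 1 * v 2 + p 2 * v 3
     else if i = 1 then - p 0 * v 0 + p 3 * v 2 + p 4 * v 3
     else if i = 2 then - p 1 * v 0 - p 3 * v 1 + p 5 * v 3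
     else if i = 3 then - p 2 * v 0 - p 4 * v 1 - p 5 * v 2 else 0)"

text \<open>The identification of the exterior square with its dual by the wedge product.\<close>

definition dual :: "(nat \<Rightarrow> complex) \<Rightarrow> nat \<Rightarrow> complex" where
  "dual p = (\<lambda>r. if r = 0 then p 5 else if r = 1 then - p 4 else if r = 2 then p 3
     else if r = 3 then p 2 else if r = 4 then - p 1 else if r = 5 then p 0 else 0)"

text \<open>The polar form of the Klein quadric.\<close>

definition pol :: "(nat \<Rightarrow> complex) \<Rightarrow> (nat \<Rightarrow> complex) \<Rightarrow> complex" where
  "pol p p' = p 0 * p' 5 - p 1 * p' 4 + p 2 * p' 3 + p 3 * p' 2 - p 4 * p' 1 + p 5 * p' 0"

definition dot4 :: "(nat \<Rightarrow> complex) \<Rightarrow> (nat \<Rightarrow> complex) \<Rightarrow> complex" where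
  "dot4 v w = v 0 * w 0 + v 1 * w 1 + v 2 * w 2 + v 3 * w 3"

text \<open>Pluecker coordinates of the line through two points.\<close>

definition plu :: "(nat \<Rightarrow> complex) \<Rightarrow> (nat \<Rightarrow> complex) \<Rightarrow> nat \<Rightarrow> complex" where
  "plu a b = (\<lambda>r. if r = 0 then a 0 * b 1 - a 1 * b 0 else if r = 1 then a 0 * b 2 - a 2 * b 0
     else if r = 2 then a 0 * b 3 - a 3 * b 0 else if r = 3 then a 1 * b 2 - a 2 * b 1
     else if r = 4 then a 1 * b 3 - a 3 * b 1 else if r = 5 then a 2 * b 3 - a 3 * b 2 else 0)"

abbreviation unit4 :: "nat \<Rightarrow> nat \<Rightarrow> complex" where
  "unit4 i \<equiv> (\<lambda>j. if j = i then 1 else 0)"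

lemma less_4_cases: "(i :: nat) < 4 \<Longrightarrow> i = 0 \<or> i = 1 \<or> i = 2 \<or> i = 3" by linarith
lemma less_6_cases: "(i :: nat) < 6 \<Longrightarrow> i = 0 \<or> i = 1 \<or> i = 2 \<or> i = 3 \<or> i = 4 \<or> i = 5" by linarith
lemma less_3_cases: "(i :: nat) < 3 \<Longrightarrow> i = 0 \<or> i = 1 \<or> i = 2" by linarith

lemma taut_fibre_iff: "vec 4 v \<in> taut_fibre p \<longleftrightarrow> altmap (\<lambda>r. p $ r) v = (\<lambda>_. 0)"
proof -
  have "(alt_mat p *\<^sub>v vec 4 v) $ i = altmap (\<lambda>r. p $ r) v i" if "i < 4" for i
    using less_4_cases[OF that]
    by (auto simp: alt_mat_def mat_of_rows_list_def scalar_prod_def altmap_def numeral_eq_Suc)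
  moreover have "dim_vec (alt_mat p *\<^sub>v vec 4 v) = 4"
    by (simp add: alt_mat_def mat_of_rows_list_def)
  moreover have "altmap (\<lambda>r. p $ r) v i = 0" if "\<not> i < 4" for i
    using that by (auto simp: altmap_def)
  ultimately show ?thesis
    unfolding taut_fibre_def by (auto simp: vec_eq_iff fun_eq_iff)
qed

lemma pol_qmat:
  assumes "x \<in> carrier_vec 6" "y \<in> carrier_vec 6"
  shows "x \<bullet> (qmat *\<^sub>v y) = pol (\<lambda>r. x $ r) (\<lambda>r. y $ r)"
  using assms by (auto simp: pol_def qmat_def mat_of_rows_list_def scalar_prod_def numeral_eq_Suc)

lemma dual_dual: "r < 6 \<Longrightarrow> dual (dual p) r = p r"
  by (drule less_6_cases) (auto simp: dual_def)

lemma pol_dual: "pol (dual p) (dual p') = pol p p'"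
  by (simp add: pol_def dual_def)

lemma pol_commute: "pol p p' = pol p' p"
  by (simp add: pol_def)

lemma altmap_dual_dual: "altmap (dual (dual p)) = altmap p"
  by (intro ext) (simp add: altmap_def dual_def)

lemma altmap_zero: "altmap p (\<lambda>_. 0) = (\<lambda>_. 0)"
  by (simp add: altmap_def fun_eq_iff)

lemma altmap_uminus: "altmap p (\<lambda>i. - v i) = (\<lambda>i. - altmap p v i)"
  by (simp add: altmap_def fun_eq_iff)

lemma altmap_cmult: "altmap p (\<lambda>i. c * v i) = (\<lambda>i. c * altmap p v i)"
  by (simp add: altmap_def fun_eq_iff algebra_simps)

lemma altmap_add: "altmap p (\<lambda>i. u i + v i) = (\<lambda>i. altmap p u i + altmap p v i)"
  by (simp add: altmap_def fun_eq_iff algebra_simps)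

lemma dot4_add_left: "dot4 (\<lambda>i. u i + v i) w = dot4 u w + dot4 v w"
  by (simp add: dot4_def algebra_simps)

lemma dot4_add_right: "dot4 w (\<lambda>i. u i + v i) = dot4 w u + dot4 w v"
  by (simp add: dot4_def algebra_simps)

lemma dot4_altmap: "dot4 u (altmap p v) = - dot4 v (altmap p u)"
  by (simp add: altmap_def dot4_def algebra_simps)

text \<open>The maps of a functional and of its dual anticommute up to the polar form, as in a Clifford
  algebra. In particular the radical of a nonzero isotropic functional is the image of the dual map.\<close>

lemma altmap_anticommute:
  "altmap p (altmap (dual p') v) i + altmap p' (altmap (dual p) v) i = (if i < 4 then - pol p p' * v i else 0)"
proof (cases "i < 4")
  case True
  then show ?thesis using less_4_cases[OF True]
    by (elim disjE) (simp_all add: altmap_def dual_def pol_def, (simp_all add: algebra_simps)?)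
qed (auto simp: altmap_def)

lemma altmap_swap:
  assumes "pol p p' = 0"
  shows "altmap p (altmap (dual p') v) = (\<lambda>i. - altmap p' (altmap (dual p) v) i)"
    and "altmap (dual p) (altmap p' v) = (\<lambda>i. - altmap (dual p') (altmap p v) i)"
proof -
  have *: "altmap p (altmap (dual p') v) = (\<lambda>i. - altmap p' (altmap (dual p) v) i)"
    if "pol p p' = 0" for p p'
    using altmap_anticommute[of p p' v] that by (auto simp: fun_eq_iff eq_neg_iff_add_eq_0)
  show "altmap p (altmap (dual p') v) = (\<lambda>i. - altmap p' (altmap (dual p) v) i)"
    using *[OF assms] .
  show "altmap (dual p) (altmap p' v) = (\<lambda>i. - altmap (dual p') (altmap p v) i)"
    using *[of "dual p" "dual p'"] assms by (simp add: pol_dual altmap_dual_dual)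
qed

lemma altmap_isotropic:
  assumes "pol p p = 0"
  shows "altmap p (altmap (dual p) v) = (\<lambda>_. 0)" "altmap (dual p) (altmap p v) = (\<lambda>_. 0)"
proof -
  have *: "altmap p (altmap (dual p) v) = (\<lambda>_. 0)" if "pol p p = 0" for p
  proof
    fix i
    have "2 * altmap p (altmap (dual p) v) i = 0"
      using altmap_anticommute[of p p v i] that by simp
    then show "altmap p (altmap (dual p) v) i = 0" by simp
  qed
  show "altmap p (altmap (dual p) v) = (\<lambda>_. 0)" using *[OF assms] .
  show "altmap (dual p) (altmap p v) = (\<lambda>_. 0)"
    using *[of "dual p"] assms by (simp add: pol_dual altmap_dual_dual)
qed

text \<open>If \<open>v\<close> is in the radical, its wedge with the dual of \<open>p\<close> is zero; contracting with two
  covectors expresses \<open>v\<close> in the images of these.\<close>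

lemma radical_expansion:
  assumes "altmap p v = (\<lambda>_. 0)" "i < 4"
  shows "dot4 w (altmap (dual p) w') * v i
    = dot4 w v * altmap (dual p) w' i - dot4 w' v * altmap (dual p) w i"
proof -
  let ?L = "\<lambda>i. dot4 w (altmap (dual p) w') * v i"
  let ?R = "\<lambda>i. dot4 w v * altmap (dual p) w' i - dot4 w' v * altmap (dual p) w i"
  let ?m = "plu w w'" and ?A = "altmap p v"
  note defs = altmap_def dual_def dot4_def plu_def
  have "?L 0 = ?R 0 - ?m 3 * ?A 3 + ?m 4 * ?A 2 - ?m 5 * ?A 1"
    by (simp add: defs, simp add: algebra_simps)
  moreover have "?L 1 = ?R 1 + ?m 1 * ?A 3 - ?m 2 * ?A 2 + ?m 5 * ?A 0"
    by (simp add: defs, simp add: algebra_simps)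
  moreover have "?L 2 = ?R 2 - ?m 0 * ?A 3 + ?m 2 * ?A 1 - ?m 4 * ?A 0"
    by (simp add: defs, simp add: algebra_simps)
  moreover have "?L 3 = ?R 3 + ?m 0 * ?A 2 - ?m 1 * ?A 1 + ?m 3 * ?A 0"
    by (simp add: defs, simp add: algebra_simps)
  ultimately show ?thesis using less_4_cases[OF assms(2)] unfolding assms(1)
    by (elim disjE) simp_all
qed

text \<open>For isotropic \<open>p\<close> the images of two covectors under the dual map span the line of \<open>p\<close>, so their
  Pluecker coordinates are those of \<open>p\<close>, up to the pairing of the two covectors.\<close>

lemma plu_radical:
  assumes "pol p p = 0"
  shows "plu (altmap (dual p) w) (altmap (dual p) w') r = dot4 w (altmap (dual p) w') * dual p r"
proof -
  have "2 * plu (altmap (dual p) w) (altmap (dual p) w') r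
      = 2 * (dot4 w (altmap (dual p) w') * dual p r) - pol p p * dual (plu w w') r"
  proof (cases "r < 6")
    case True
    then show ?thesis using less_6_cases[OF True]
      by (elim disjE) (simp_all add: altmap_def dual_def pol_def plu_def dot4_def, (simp_all add: algebra_simps)?)
  qed (auto simp: plu_def dual_def)
  then show ?thesis using assms by simp
qed

lemma pol_plu_radicals:
  assumes "pol p p = 0" "pol p' p' = 0"
  shows "pol (plu (altmap (dual p) w) (altmap (dual p) w')) (plu (altmap (dual p') w) (altmap (dual p') w'))
    = dot4 w (altmap (dual p) w') * dot4 w (altmap (dual p') w') * pol p p'"
proof -
  have "pol (\<lambda>r. c * p r) (\<lambda>r. c' * p' r) = c * c' * pol p p'" for c c' p p'
    by (simp add: pol_def algebra_simps)
  then show ?thesis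
    using pol_dual[of p p'] unfolding plu_radical[OF assms(1), abs_def] plu_radical[OF assms(2), abs_def]
    by simp
qed

lemma common_nonvanishing:
  fixes f g :: "(nat \<Rightarrow> complex) \<Rightarrow> complex"
  assumes "f a \<noteq> 0" "g b \<noteq> 0"
    and "f (\<lambda>i. a i + b i) = f a + f b" "g (\<lambda>i. a i + b i) = g a + g b"
  shows "\<exists>c. f c \<noteq> 0 \<and> g c \<noteq> 0"
proof (cases "g a = 0")
  case g: True
  show ?thesis
  proof (cases "f b = 0")
    case True
    then have "f (\<lambda>i. a i + b i) \<noteq> 0 \<and> g (\<lambda>i. a i + b i) \<noteq> 0" using g assms by simp
    then show ?thesis by (intro exI[of _ "\<lambda>i. a i + b i"])
  qed (use assms in blast)
qed (use assms in blast)

text \<open>A nonzero alternating form is nonzero on some pair of covectors, and a complex vector space is not the union of two proper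
  subspaces.\<close>

lemma transversal_pair:
  assumes "\<exists>r<6. p r \<noteq> 0" "\<exists>r<6. p' r \<noteq> 0"
  shows "\<exists>w w'. dot4 w (altmap (dual p) w') \<noteq> 0 \<and> dot4 w (altmap (dual p') w') \<noteq> 0"
proof -
  have ex: "\<exists>a b. dot4 a (altmap (dual p) b) \<noteq> 0" if "\<exists>r<6. p r \<noteq> 0" for p
  proof -
    obtain r where r: "r < 6" "p r \<noteq> 0" using \<open>\<exists>r<6. p r \<noteq> 0\<close> by blast
    have "r = 0 \<or> r = 1 \<or> r = 2 \<or> r = 3 \<or> r = 4 \<or> r = 5" using less_6_cases r(1) by blast
    then have "dot4 (unit4 2) (altmap (dual p) (unit4 3)) \<noteq> 0 \<or> dot4 (unit4 1) (altmap (dual p) (unit4 3)) \<noteq> 0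
      \<or> dot4 (unit4 1) (altmap (dual p) (unit4 2)) \<noteq> 0 \<or> dot4 (unit4 0) (altmap (dual p) (unit4 3)) \<noteq> 0
      \<or> dot4 (unit4 0) (altmap (dual p) (unit4 2)) \<noteq> 0 \<or> dot4 (unit4 0) (altmap (dual p) (unit4 1)) \<noteq> 0"
      using r(2) by (auto simp: dot4_def altmap_def dual_def)
    then show ?thesis by blast
  qed
  obtain a a' where a: "dot4 a (altmap (dual p) a') \<noteq> 0" using ex[OF assms(1)] by blast
  obtain b b' where b: "dot4 b (altmap (dual p') b') \<noteq> 0" using ex[OF assms(2)] by blast
  obtain w where w: "dot4 w (altmap (dual p) a') \<noteq> 0" "dot4 w (altmap (dual p') b') \<noteq> 0"
    using common_nonvanishing[of "\<lambda>w. dot4 w (altmap (dual p) a')" a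
        "\<lambda>w. dot4 w (altmap (dual p') b')" b, OF a b dot4_add_left dot4_add_left] by blast
  have add: "dot4 w (altmap p (\<lambda>i. u i + v i)) = dot4 w (altmap p u) + dot4 w (altmap p v)" for p u v
    unfolding altmap_add by (rule dot4_add_right)
  show ?thesis
    using common_nonvanishing[of "\<lambda>v. dot4 w (altmap (dual p) v)" a'
        "\<lambda>v. dot4 w (altmap (dual p') v)" b', OF w add add] by blast
qed

lemma det_expand_first_row:
  fixes f :: "nat \<Rightarrow> nat \<Rightarrow> 'a :: comm_ring_1"
  shows "det (mat (Suc n) (Suc n) (\<lambda>(i, j). f i j)) =
    (\<Sum>j<Suc n. f 0 j * ((-1) ^ j * det (mat n n (\<lambda>(i, k). f (Suc i) (if k < j then k else Suc k)))))"
proof -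
  let ?A = "mat (Suc n) (Suc n) (\<lambda>(i, j). f i j)"
  have "det ?A = (\<Sum>j<Suc n. ?A $$ (0, j) * cofactor ?A 0 j)"
    by (rule laplace_expansion_row[of _ "Suc n"]) auto
  also have "\<dots> = (\<Sum>j<Suc n. f 0 j * ((-1) ^ j * det (mat n n (\<lambda>(i, k). f (Suc i) (if k < j then k else Suc k)))))"
    by (intro sum.cong refl arg_cong2[of _ _ _ _ "(*)"])
      (auto simp: cofactor_def mat_delete_def intro!: arg_cong[of _ _ "\<lambda>B. _ * det B"] eq_matI)
  finally show ?thesis .
qed

text \<open>Laplace expansion along two pairs of rows.\<close>

lemma det4_laplace:
  fixes f :: "nat \<Rightarrow> nat \<Rightarrow> complex"
  shows "det (mat 4 4 (\<lambda>(i, j). f i j)) = pol (plu (f 0) (f 1)) (plu (f 2) (f 3))"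
  by (simp add: numeral_eq_Suc det_expand_first_row pol_def plu_def algebra_simps)

section \<open>Families of pairwise orthogonal points of the Klein quadric\<close>

lemma rank_injective:
  assumes A: "A \<in> carrier_mat n nc" and inj: "\<And>v. v \<in> carrier_vec nc \<Longrightarrow> A *\<^sub>v v = 0\<^sub>v n \<Longrightarrow> v = 0\<^sub>v nc"
  shows "vec_space.rank n (A :: complex mat) = nc"
proof -
  interpret vec_space "TYPE(complex)" n .
  have "distinct (cols A)"
    unfolding distinct_conv_nth
  proof (intro allI impI notI)
    fix i j assume ij: "i < length (cols A)" "j < length (cols A)" "i \<noteq> j" "cols A ! i = cols A ! j"
    then have lt: "i < nc" "j < nc" using A by auto
    have "A *\<^sub>v (unit_vec nc i - unit_vec nc j) = A *\<^sub>v unit_vec nc i - A *\<^sub>v unit_vec nc j"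
      using A by (intro mult_minus_distrib_mat_vec) auto
    also have "\<dots> = col A i - col A j"
      using A lt by (intro arg_cong2[of _ _ _ _ "(-)"] eq_vecI) auto
    also have "\<dots> = 0\<^sub>v n" using ij A lt by (auto simp: cols_nth)
    finally have "unit_vec nc i - unit_vec nc j = (0\<^sub>v nc :: complex vec)"
      using inj by (metis minus_carrier_vec unit_vec_carrier)
    then have "(unit_vec nc i - unit_vec nc j) $ i = (0\<^sub>v nc :: complex vec) $ i" by simp
    then show False using lt ij(3) by simp
  qed
  moreover have "lin_indpt (set (cols A))"
    using lin_depE[OF A _ \<open>distinct (cols A)\<close>] inj by blast
  ultimately show ?thesis by (rule lin_indpt_full_rank[OF A])
qed

lemma qmat_carrier: "qmat \<in> carrier_mat 6 6"
  by (rule carrier_matI) (simp_all add: qmat_def mat_of_rows_list_def)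

lemma isotropic_planeI:
  fixes g :: "nat \<Rightarrow> nat \<Rightarrow> complex"
  assumes iso: "\<And>a b. a < 3 \<Longrightarrow> b < 3 \<Longrightarrow> pol (g a) (g b) = 0"
    and inj: "\<And>(x :: nat \<Rightarrow> complex) (k :: nat).
      (\<And>r. r < 6 \<Longrightarrow> x 0 * g 0 r + x 1 * g 1 r + x 2 * g 2 r = 0) \<Longrightarrow> k < 3 \<Longrightarrow> x k = 0"
  shows "isotropic_plane (mat 6 3 (\<lambda>(r, c). g c r))"
proof -
  define M where "M = mat 6 3 (\<lambda>(r, c). g c r)"
  have M: "M \<in> carrier_mat 6 3" by (simp add: M_def)
  have col: "col M i = vec 6 (g i)" if "i < 3" for i
    using that by (simp add: M_def)
  have "vec_space.rank 6 M = 3"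
  proof (rule rank_injective[OF M])
    fix v :: "complex vec" assume v: "v \<in> carrier_vec 3" "M *\<^sub>v v = 0\<^sub>v 6"
    have "v $ 0 * g 0 r + v $ 1 * g 1 r + v $ 2 * g 2 r = 0" if "r < 6" for r
    proof -
      have "(M *\<^sub>v v) $ r = (\<Sum>c\<in>{0..<3}. g c r * v $ c)"
        using v(1) that by (simp add: M_def scalar_prod_def)
      also have "\<dots> = v $ 0 * g 0 r + v $ 1 * g 1 r + v $ 2 * g 2 r"
        by (simp add: eval_nat_numeral mult.commute)
      finally show ?thesis using that unfolding v(2) by (metis index_zero_vec(1))
    qed
    then have "v $ k = 0" if "k < 3" for k using inj[of "\<lambda>k. v $ k" k] that by blast
    then show "v = 0\<^sub>v 3" using v(1) by (intro eq_vecI) auto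
  qed
  moreover have "transpose_mat M * qmat * M = 0\<^sub>m 3 3"
  proof (rule eq_matI)
    fix i j assume "i < dim_row (0\<^sub>m 3 3 :: complex mat)" "j < dim_col (0\<^sub>m 3 3 :: complex mat)"
    then have ij: "i < 3" "j < 3" by auto
    have T: "transpose_mat M \<in> carrier_mat 3 6" and QM: "qmat * M \<in> carrier_mat 6 3"
      using M qmat_carrier by auto
    have "(transpose_mat M * qmat * M) $$ (i, j) = (transpose_mat M * (qmat * M)) $$ (i, j)"
      unfolding assoc_mult_mat[OF T qmat_carrier M] ..
    also have "\<dots> = row (transpose_mat M) i \<bullet> col (qmat * M) j"
      using ij T QM by (intro index_mult_mat) auto
    also have "\<dots> = col M i \<bullet> (qmat *\<^sub>v col M j)"
    proof -
      have "row (transpose_mat M) i = col M i" using ij M by (intro row_transpose) auto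
      then show ?thesis unfolding col_mult2[OF qmat_carrier M ij(2)] by (rule arg_cong)
    qed
    also have "\<dots> = pol (\<lambda>r. vec 6 (g i) $ r) (\<lambda>r. vec 6 (g j) $ r)"
      unfolding col[OF ij(1)] col[OF ij(2)] by (intro pol_qmat) auto
    also have "\<dots> = pol (g i) (g j)" by (simp add: pol_def)
    finally show "(transpose_mat M * qmat * M) $$ (i, j) = 0\<^sub>m 3 3 $$ (i, j)"
      using iso ij by simp
  qed (use M in auto)
  ultimately have "isotropic_plane M" unfolding isotropic_plane_def using M by blast
  then show ?thesis by (simp only: M_def)
qed

lemma dual_zero: "(\<And>r. r < 6 \<Longrightarrow> p r = 0) \<Longrightarrow> dual p r = 0"
  by (simp add: dual_def)

text \<open>Enumerates the three indices different from \<open>i\<close>.\<close>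

definition skip :: "nat \<Rightarrow> nat \<Rightarrow> nat" where "skip i c = (if c < i then c else Suc c)"

lemma pol_plu_same: "pol (plu a v) (plu b v) = 0"
  by (simp add: pol_def plu_def algebra_simps)

lemma plu_unit_injective:
  fixes x :: "nat \<Rightarrow> complex" and k :: nat
  assumes i: "i < 4" "v i \<noteq> 0"
    and z: "\<And>r. r < 6 \<Longrightarrow> x 0 * plu (unit4 (skip i 0)) v r + x 1 * plu (unit4 (skip i 1)) v r + x 2 * plu (unit4 (skip i 2)) v r = 0"
    and k: "k < 3"
  shows "x k = 0"
proof -
  note defs = plu_def skip_def
  consider "i = 0" | "i = 1" | "i = 2" | "i = 3" using less_4_cases[OF i(1)] by blast
  then have "x 0 = 0 \<and> x 1 = 0 \<and> x 2 = 0"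
  proof cases
    case 1
    then show ?thesis using z[of 0] z[of 1] z[of 2] i(2) by (simp add: defs)
  next
    case 2
    then show ?thesis using z[of 0] z[of 3] z[of 4] i(2) by (simp add: defs)
  next
    case 3
    then show ?thesis using z[of 1] z[of 3] z[of 5] i(2) by (simp add: defs)
  next
    case 4
    then show ?thesis using z[of 2] z[of 4] z[of 5] i(2) by (simp add: defs)
  qed
  then show ?thesis using less_3_cases[OF k] by auto
qed

lemma radical_decomposition:
  assumes "altmap p v = (\<lambda>_. 0)" "i < 4" "r < 6"
  shows "v i * dual p r = plu (altmap (dual p) (unit4 i)) v r"
proof -
  let ?A = "altmap p v"
  let ?S = "if i = 0 then (if r = 3 then - ?A 3 else if r = 4 then ?A 2 else if r = 5 then - ?A 1 else 0)
    else if i = 1 then (if r = 1 then ?A 3 else if r = 2 then - ?A 2 else if r = 5 then ?A 0 else 0)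
    else if i = 2 then (if r = 0 then - ?A 3 else if r = 2 then ?A 1 else if r = 4 then - ?A 0 else 0)
    else (if r = 0 then ?A 2 else if r = 1 then - ?A 1 else if r = 3 then ?A 0 else 0)"
  have "v i * dual p r = plu (altmap (dual p) (unit4 i)) v r + ?S"
    using less_4_cases[OF assms(2)] less_6_cases[OF assms(3)]
    by (elim disjE) (simp_all add: plu_def altmap_def dual_def algebra_simps)
  moreover have "?S = 0" unfolding assms(1) by simp
  ultimately show ?thesis by simp
qed

text \<open>The functionals with a given vector \<open>v\<close> in their radical form an isotropic plane: the lines
  through a point of \<open>\<bbbP>\<^sup>3\<close>. A nonzero coordinate of \<open>v\<close> provides a basis.\<close>

lemma plane_of_point:
  assumes i: "i < 4" "v i \<noteq> 0"
  defines "g \<equiv> \<lambda>c. plu (unit4 (skip i c)) v"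
  shows "isotropic_plane (mat 6 3 (\<lambda>(r, c). g c r))"
    and "isotropic_plane (mat 6 3 (\<lambda>(r, c). dual (g c) r))"
    and "altmap p v = (\<lambda>_. 0) \<Longrightarrow> \<exists>x :: nat \<Rightarrow> complex. \<forall>r<6. dual p r = x 0 * g 0 r + x 1 * g 1 r + x 2 * g 2 r"
proof -
  have inj: "x k = 0" if "\<And>r. r < 6 \<Longrightarrow> x 0 * g 0 r + x 1 * g 1 r + x 2 * g 2 r = 0" "k < 3"
    for x :: "nat \<Rightarrow> complex" and k :: nat
    using that unfolding g_def by (rule plu_unit_injective[where v = v, OF i])
  show "isotropic_plane (mat 6 3 (\<lambda>(r, c). g c r))"
    using inj by (intro isotropic_planeI) (auto simp: g_def pol_plu_same)
  show "isotropic_plane (mat 6 3 (\<lambda>(r, c). dual (g c) r))"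
  proof (rule isotropic_planeI)
    fix x :: "nat \<Rightarrow> complex" and k :: nat assume *: "\<And>r. r < 6 \<Longrightarrow> x 0 * dual (g 0) r + x 1 * dual (g 1) r + x 2 * dual (g 2) r = 0" "k < 3"
    have "x 0 * g 0 r + x 1 * g 1 r + x 2 * g 2 r = 0" if "r < 6" for r
    proof -
      have "dual (\<lambda>r. x 0 * dual (g 0) r + x 1 * dual (g 1) r + x 2 * dual (g 2) r) r = 0"
        by (rule dual_zero[OF *(1)])
      then show ?thesis using less_6_cases[OF that]
        by (elim disjE) (simp_all add: dual_def)
    qed
    then show "x k = 0" using *(2) by (rule inj)
  qed (simp add: pol_dual g_def pol_plu_same)
  show "\<exists>x :: nat \<Rightarrow> complex. \<forall>r<6. dual p r = x 0 * g 0 r + x 1 * g 1 r + x 2 * g 2 r" if "altmap p v = (\<lambda>_. 0)"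
  proof -
    define u where "u = altmap (dual p) (unit4 i)"
    have "dual p r = u (skip i 0) / v i * g 0 r + u (skip i 1) / v i * g 1 r + u (skip i 2) / v i * g 2 r"
      if r: "r < 6" for r
    proof -
      have "u i = 0" using less_4_cases[OF i(1)] by (auto simp: u_def altmap_def)
      then have "plu u v r = u (skip i 0) * g 0 r + u (skip i 1) * g 1 r + u (skip i 2) * g 2 r"
        using less_4_cases[OF i(1)] less_6_cases[OF r] unfolding g_def
        by (elim disjE) (simp_all add: plu_def skip_def flip: numeral_2_eq_2)
      moreover have "v i * dual p r = plu u v r"
        unfolding u_def using radical_decomposition \<open>altmap p v = _\<close> i(1) r by blast
      ultimately show ?thesis using i(2) by (simp add: field_simps)
    qed
    then show ?thesis
      by (intro exI[of _ "\<lambda>c. u (skip i c) / v i"]) simp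
  qed
qed

text \<open>Three lines that pairwise meet have a common point or a common plane. By anticommutation the first composition is alternating
  in \<open>p1, p2, p3\<close>, so its values \<open>s\<close> are planes that contain all three lines. If some \<open>s\<close> is not zero, contracting
  it with \<open>p1\<close> shows that \<open>w\<close>, a plane through \<open>p1\<close>, is proportional to it unless \<open>w = 0\<close>; so \<open>p3\<close> annihilates \<open>w\<close> as well.\<close>

lemma concurrent_or_coplanar:
  assumes iso: "pol p1 p1 = 0" "pol p2 p2 = 0" "pol p3 p3 = 0"
    and orth: "pol p1 p2 = 0" "pol p1 p3 = 0" "pol p2 p3 = 0"
  shows "altmap p3 (altmap (dual p2) (altmap p1 e)) = (\<lambda>_. 0) \<or>
    altmap (dual p3) (altmap p1 (altmap (dual p2) f)) = (\<lambda>_. 0)"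
proof -
  define s where "s = altmap p3 (altmap (dual p2) (altmap p1 e))"
  define y where "y = altmap (dual p2) f"
  define w where "w = altmap p1 y"
  define t where "t = altmap (dual p3) w"
  note sw = altmap_swap[OF orth(1)] altmap_swap[OF orth(2)] altmap_swap[OF orth(3)]
  note z = altmap_isotropic[OF iso(1)] altmap_isotropic[OF iso(2)] altmap_isotropic[OF iso(3)]
  have s3: "altmap (dual p3) s = (\<lambda>_. 0)" unfolding s_def by (rule z)
  have s2: "altmap (dual p2) s = (\<lambda>_. 0)"
    unfolding s_def by (simp add: sw z altmap_uminus altmap_zero)
  have s1: "altmap (dual p1) s = (\<lambda>_. 0)"
  proof -
    have "s = (\<lambda>i. - altmap p2 (altmap (dual p3) (altmap p1 e)) i)"
      unfolding s_def using altmap_swap(1)[of p3 p2] orth(3) by (simp add: pol_commute)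
    also have "altmap (dual p3) (altmap p1 e) = (\<lambda>i. - altmap (dual p1) (altmap p3 e) i)"
      using altmap_swap(2)[of p3 p1] orth(2) by (simp add: pol_commute)
    finally have "s = altmap p2 (altmap (dual p1) (altmap p3 e))" by (simp add: altmap_uminus)
    also have "\<dots> = (\<lambda>i. - altmap p1 (altmap (dual p2) (altmap p3 e)) i)"
      using altmap_swap(1)[of p2 p1] orth(1) by (simp add: pol_commute)
    finally show ?thesis by (simp add: altmap_uminus z)
  qed
  have "dot4 s y = 0"
    unfolding y_def dot4_altmap[of s] s2 by (simp add: dot4_def)
  have key: "s i = 0 \<or> t = (\<lambda>_. 0)" if i: "i < 4" for i
  proof -
    have "dot4 (unit4 i) w * s j = s i * w j" if "j < 4" for j
    proof -
      have "dot4 (unit4 i) (altmap p1 y) * s j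
          = dot4 (unit4 i) s * altmap p1 y j - dot4 y s * altmap p1 (unit4 i) j"
        using radical_expansion[of "dual p1" s j "unit4 i" y] s1 that by (simp add: altmap_dual_dual)
      moreover have "dot4 y s = 0" using \<open>dot4 s y = 0\<close> by (simp add: dot4_def mult.commute)
      moreover have "dot4 (unit4 i) s = s i" using less_4_cases[OF i] by (auto simp: dot4_def)
      ultimately show ?thesis by (simp add: w_def)
    qed
    moreover have "s j = 0 \<and> w j = 0" if "\<not> j < 4" for j
      using that by (auto simp: s_def w_def altmap_def)
    ultimately have "(\<lambda>j. dot4 (unit4 i) w * s j) = (\<lambda>j. s i * w j)" by (metis mult_zero_right)
    then have "altmap (dual p3) (\<lambda>j. dot4 (unit4 i) w * s j) = altmap (dual p3) (\<lambda>j. s i * w j)" by simp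
    then have "(\<lambda>j. s i * t j) = (\<lambda>_. 0)"
      unfolding altmap_cmult s3 t_def by simp
    then show ?thesis by (metis mult_eq_0_iff)
  qed
  show ?thesis
  proof (rule ccontr)
    assume "\<not> ?thesis"
    then have "t \<noteq> (\<lambda>_. 0)" "s \<noteq> (\<lambda>_. 0)" unfolding s_def t_def w_def y_def by auto
    then obtain j where "s j \<noteq> 0" by auto
    moreover have "j < 4" using \<open>s j \<noteq> 0\<close> by (auto simp: s_def altmap_def split: if_splits)
    ultimately show False using key \<open>t \<noteq> _\<close> by blast
  qed
qed

lemma ternary_of_binary:
  "bihom d 0 f \<Longrightarrow> (\<lambda>(a, b, c). f (a, b) y) \<in> ternary_forms d"
proof (induction f rule: bihom_monomial_induct)
  case (mono k i i' j j')
  have "(\<lambda>(a, b, c). monomial22 k i i' j j' (a, b) y) = monomial3 k i i' 0"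
    using mono by (auto simp: monomial22_def monomial3_def)
  then show ?case using ternary_monomial[of k i i' 0] mono by simp
next
  case zero
  then show ?case using ternary_zero by (simp add: case_prod_unfold)
next
  case (add f g)
  then show ?case using ternary_add by (fastforce simp: case_prod_unfold)
qed

lemma binary_domain:
  assumes f: "bihom m 0 (\<lambda>x y. f x)" and g: "bihom n 0 (\<lambda>x y. g x)" and fg: "\<And>x. f x * g x = 0"
  shows "(\<forall>x. f x = 0) \<or> (\<forall>x. g x = 0)"
proof -
  let ?F = "\<lambda>(a, b, c :: complex). f (a, b)" and ?G = "\<lambda>(a, b, c :: complex). g (a, b)"
  have "(\<forall>u. ?F u = 0) \<or> (\<forall>u. ?G u = 0)"
  proof (rule ternary_domain)
    show "?F \<in> ternary_forms m" "?G \<in> ternary_forms n"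
      using ternary_of_binary[OF f] ternary_of_binary[OF g] by auto
    show "?F u * ?G u = 0" for u using fg by (cases u) auto
  qed
  then show ?thesis
  proof
    assume "\<forall>u. ?F u = 0"
    then have "f x = 0" for x by (cases x) (metis case_prod_conv)
    then show ?thesis by blast
  next
    assume "\<forall>u. ?G u = 0"
    then have "g x = 0" for x by (cases x) (metis case_prod_conv)
    then show ?thesis by blast
  qed
qed

lemma bihom_altmap:
  assumes "\<And>r. r < 6 \<Longrightarrow> bihom d 0 (\<lambda>x y. p x r)"
  shows "bihom d 0 (\<lambda>x y. altmap (p x) v i)"
proof -
  have *: "bihom d 0 (\<lambda>x y. p x r * c)" if "r < 6" for r c
    using bihom_cmult[OF assms[OF that], of c] by (simp add: mult.commute)
  have **: "bihom d 0 (\<lambda>x y. - (p x r * c))" if "r < 6" for r c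
    using bihom_cmult[OF *[OF that], of "- 1" c] by simp
  consider "i = 0" | "i = 1" | "i = 2" | "i = 3" | "i \<ge> 4" by linarith
  then show ?thesis
    by cases (simp_all add: altmap_def bihom_zero, auto intro!: bihom_add bihom_diff * **)
qed

lemma bihom_dual:
  assumes "\<And>r. r < 6 \<Longrightarrow> bihom d 0 (\<lambda>x y. p x r)"
  shows "bihom d 0 (\<lambda>x y. dual (p x) r)"
proof (cases "r < 6")
  case True
  have "bihom d 0 (\<lambda>x y. - p x r)" if "r < 6" for r
    using bihom_cmult[OF assms[OF that], of "-1"] by simp
  then show ?thesis using less_6_cases[OF True] assms by (elim disjE) (simp_all add: dual_def)
qed (simp add: dual_def bihom_zero)

lemma plane_contains:
  fixes p x :: "nat \<Rightarrow> complex"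
  assumes "\<forall>r<6. p r = x 0 * g 0 r + x 1 * g 1 r + x 2 * g 2 r"
  shows "vec 6 p \<in> {mat 6 3 (\<lambda>(r, c). g c r) *\<^sub>v c | c. c \<in> carrier_vec 3}"
proof -
  have "vec 6 p = mat 6 3 (\<lambda>(r, c). g c r) *\<^sub>v vec 3 x"
  proof (rule eq_vecI)
    fix r assume "r < dim_vec (mat 6 3 (\<lambda>(r, c). g c r) *\<^sub>v vec 3 x)"
    then have r: "r < 6" by simp
    have "(mat 6 3 (\<lambda>(r, c). g c r) *\<^sub>v vec 3 x) $ r = (\<Sum>c\<in>{0..<3}. g c r * x c)"
      using r by (simp add: scalar_prod_def)
    also have "\<dots> = p r" using assms r by (simp add: eval_nat_numeral mult.commute)
    finally show "vec 6 p $ r = (mat 6 3 (\<lambda>(r, c). g c r) *\<^sub>v vec 3 x) $ r" using r by simp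
  qed simp
  then show ?thesis by (intro CollectI exI[of _ "vec 3 x"] conjI) simp_all
qed

text \<open>A family of lines that pairwise meet has a common point or lies in a plane. For two lines
  that are distinct, every third line passes through the common point or lies in the common
  plane, and since the family is irreducible the same alternative holds for all its members.\<close>

lemma isotropic_family:
  assumes bin: "\<And>r. r < 6 \<Longrightarrow> bihom d 0 (\<lambda>x y. p x r)"
    and nz: "p t0 r0 \<noteq> 0" "r0 < 6"
    and orth: "\<And>x y. pol (p x) (p y) = 0"
  shows "\<exists>M. isotropic_plane M \<and> (\<forall>t. vec 6 (p t) \<in> {M *\<^sub>v c | c. c \<in> carrier_vec 3})"
proof -
  have nonzero_coord: "\<exists>i<4. u i \<noteq> 0" if "dot4 a u \<noteq> 0" for a u
  proof (rule ccontr)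
    assume "\<not> ?thesis"
    then have "u 0 = 0 \<and> u 1 = 0 \<and> u 2 = 0 \<and> u 3 = 0" by auto
    then show False using that by (simp add: dot4_def)
  qed
  have point: ?thesis if v: "i < 4" "v i \<noteq> 0" "\<And>t. altmap (p t) v = (\<lambda>_. 0)" for v i
  proof -
    define g where "g = (\<lambda>c. plu (unit4 (skip i c)) v)"
    have "vec 6 (p t) \<in> {mat 6 3 (\<lambda>(r, c). dual (g c) r) *\<^sub>v c | c. c \<in> carrier_vec 3}" for t
    proof -
      obtain x :: "nat \<Rightarrow> complex" where x: "\<forall>r<6. dual (p t) r = x 0 * g 0 r + x 1 * g 1 r + x 2 * g 2 r"
        using plane_of_point(3)[where v = v, OF v(1,2) v(3)] unfolding g_def by blast
      have "p t r = x 0 * dual (g 0) r + x 1 * dual (g 1) r + x 2 * dual (g 2) r" if r: "r < 6" for r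
      proof -
        have "p t r = dual (dual (p t)) r" using dual_dual[OF r] by simp
        also have "\<dots> = x 0 * dual (g 0) r + x 1 * dual (g 1) r + x 2 * dual (g 2) r"
          using x by (simp add: dual_def[of "dual (p t)"] dual_def[of "g _"])
        finally show ?thesis .
      qed
      then show ?thesis by (intro plane_contains[of _ x]) simp
    qed
    then show ?thesis using plane_of_point(2)[where v = v, OF v(1,2)] unfolding g_def by blast
  qed
  have plane: ?thesis if v: "i < 4" "v i \<noteq> 0" "\<And>t. altmap (dual (p t)) v = (\<lambda>_. 0)" for v i
  proof -
    define g where "g = (\<lambda>c. plu (unit4 (skip i c)) v)"
    have "vec 6 (p t) \<in> {mat 6 3 (\<lambda>(r, c). g c r) *\<^sub>v c | c. c \<in> carrier_vec 3}" for t
    proof -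
      obtain x :: "nat \<Rightarrow> complex" where x: "\<forall>r<6. dual (dual (p t)) r = x 0 * g 0 r + x 1 * g 1 r + x 2 * g 2 r"
        using plane_of_point(3)[where v = v, OF v(1,2) v(3)] unfolding g_def by blast
      then show ?thesis by (intro plane_contains[of _ x]) (simp add: dual_dual)
    qed
    then show ?thesis using plane_of_point(1)[where v = v, OF v(1,2)] unfolding g_def by blast
  qed
  show ?thesis
  proof (cases "\<forall>x y f. altmap (p x) (altmap (dual (p y)) f) = (\<lambda>_. 0)")
    case True
    have "\<exists>r<6. p t0 r \<noteq> 0" using nz by blast
    from transversal_pair[OF this this] obtain a b where "dot4 a (altmap (dual (p t0)) b) \<noteq> 0" by blast
    then obtain i where "i < 4" "altmap (dual (p t0)) b i \<noteq> 0" using nonzero_coord by blast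
    then show ?thesis using point[of i "altmap (dual (p t0)) b"] True by blast
  next
    case False
    then obtain x y f where "altmap (p x) (altmap (dual (p y)) f) \<noteq> (\<lambda>_. 0)" by blast
    then obtain i where wi: "altmap (p x) (altmap (dual (p y)) f) i \<noteq> 0" by auto
    define w where "w = altmap (p x) (altmap (dual (p y)) f)"
    have i: "i < 4" using wi by (auto simp: altmap_def split: if_splits)
    define v where "v = altmap (dual (p y)) (altmap (p x) (unit4 i))"
    have "w i = dot4 (unit4 i) w" using less_4_cases[OF i] by (auto simp: dot4_def)
    also have "\<dots> = dot4 f v"
      unfolding w_def v_def dot4_altmap[of "unit4 i"] dot4_altmap[of f]
      by (simp add: dot4_def mult.commute)
    finally obtain j where j: "j < 4" "v j \<noteq> 0" using wi nonzero_coord by (metis w_def)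
    have alt: "altmap (p t) v = (\<lambda>_. 0) \<or> altmap (dual (p t)) w = (\<lambda>_. 0)" for t
      unfolding v_def w_def by (rule concurrent_or_coplanar) (rule orth)+
    have "(\<forall>t. altmap (p t) v = (\<lambda>_. 0)) \<or> (\<forall>t. altmap (dual (p t)) w = (\<lambda>_. 0))"
    proof (rule ccontr)
      assume "\<not> ?thesis"
      then obtain t1 a t2 b where "altmap (p t1) v a \<noteq> 0" "altmap (dual (p t2)) w b \<noteq> 0"
        by (metis ext)
      moreover have "(\<forall>t. altmap (p t) v a = 0) \<or> (\<forall>t. altmap (dual (p t)) w b = 0)"
      proof (rule binary_domain)
        show "bihom d 0 (\<lambda>x y. altmap (p x) v a)" by (rule bihom_altmap[OF bin])
        show "bihom d 0 (\<lambda>x y. altmap (dual (p x)) w b)"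
          by (rule bihom_altmap[of d "\<lambda>x. dual (p x)"], rule bihom_dual[OF bin])
        show "altmap (p t) v a * altmap (dual (p t)) w b = 0" for t using alt[of t] by auto
      qed
      ultimately show False by blast
    qed
    then show ?thesis
    proof
      assume "\<forall>t. altmap (p t) v = (\<lambda>_. 0)"
      then show ?thesis using point[of j v] j by blast
    next
      assume "\<forall>t. altmap (dual (p t)) w = (\<lambda>_. 0)"
      then show ?thesis using plane[of i w] i wi unfolding w_def by blast
    qed
  qed
qed

section \<open>The curve of isotropic chords\<close>

text \<open>The functional \<open>f(t)\<close>, as a function of the index.\<close>

definition ev :: "nat \<Rightarrow> complex mat \<Rightarrow> pt1 \<Rightarrow> nat \<Rightarrow> complex" where
  "ev d \<psi> t = (\<lambda>r. mor_eval d \<psi> t $ r)"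

lemma veronese_index: "i \<le> d \<Longrightarrow> veronese d t $ i = fst t ^ (d - i) * snd t ^ i"
  by (simp add: veronese_def case_prod_unfold)

lemma veronese_carrier: "veronese d t \<in> carrier_vec (d + 1)"
  by (simp add: veronese_def case_prod_unfold)

lemma mor_eval_carrier: "\<psi> \<in> carrier_mat (d + 1) 6 \<Longrightarrow> mor_eval d \<psi> t \<in> carrier_vec 6"
  unfolding mor_eval_def by (rule mult_mat_vec_carrier[OF _ veronese_carrier]) simp

lemma ev_sum:
  assumes "\<psi> \<in> carrier_mat (d + 1) 6" "r < 6"
  shows "ev d \<psi> x r = (\<Sum>i\<in>{0..<d + 1}. \<psi> $$ (i, r) * veronese d x $ i)"
  using assms veronese_carrier[of d x] by (simp add: ev_def mor_eval_def scalar_prod_def)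

lemma bihom_ev:
  assumes "\<psi> \<in> carrier_mat (d + 1) 6" "r < 6"
  shows "bihom d 0 (\<lambda>x y. ev d \<psi> x r)"
proof -
  have "ev d \<psi> x r = (\<Sum>i\<in>{..d}. monomial22 (\<psi> $$ (i, r)) (d - i) i 0 0 x y)" for x y :: pt1
  proof -
    note ev_sum[OF assms, of x]
    also have "{0..<d + 1} = {..d}" by auto
    finally show ?thesis by (simp add: veronese_index monomial22_def mult.assoc)
  qed
  moreover have "bihom d 0 (\<lambda>x y. \<Sum>i\<in>{..d}. monomial22 (\<psi> $$ (i, r)) (d - i) i 0 0 x y)"
  proof (rule bihom_sum)
    fix i assume "i \<in> {..d}"
    then show "bihom d 0 (monomial22 (\<psi> $$ (i, r)) (d - i) i 0 0)"
      using bihom_monomial[of "d - i" i 0 0] by simp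
  qed
  ultimately show ?thesis by simp
qed

lemma polar_quadric:
  assumes \<psi>: "\<psi> \<in> carrier_mat (d + 1) 6"
  shows "veronese d x \<bullet> ((\<psi> * qmat * transpose_mat \<psi>) *\<^sub>v veronese d y) = pol (ev d \<psi> x) (ev d \<psi> y)"
proof -
  have T: "transpose_mat \<psi> \<in> carrier_mat 6 (d + 1)" using \<psi> by simp
  have y: "transpose_mat \<psi> *\<^sub>v veronese d y \<in> carrier_vec 6" using T veronese_carrier by auto
  have "(\<psi> * qmat * transpose_mat \<psi>) *\<^sub>v veronese d y = (\<psi> * qmat) *\<^sub>v (transpose_mat \<psi> *\<^sub>v veronese d y)"
    by (rule assoc_mult_mat_vec[OF mult_carrier_mat[OF \<psi> qmat_carrier] T veronese_carrier])
  also have "\<dots> = \<psi> *\<^sub>v (qmat *\<^sub>v mor_eval d \<psi> y)"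
    unfolding mor_eval_def by (rule assoc_mult_mat_vec[OF \<psi> qmat_carrier y])
  finally have "veronese d x \<bullet> ((\<psi> * qmat * transpose_mat \<psi>) *\<^sub>v veronese d y)
      = veronese d x \<bullet> (\<psi> *\<^sub>v (qmat *\<^sub>v mor_eval d \<psi> y))" by simp
  also have "\<dots> = (transpose_mat \<psi> *\<^sub>v veronese d x) \<bullet> (qmat *\<^sub>v mor_eval d \<psi> y)"
    using transpose_vec_mult_scalar[OF \<psi> _ veronese_carrier[of d x], of "qmat *\<^sub>v mor_eval d \<psi> y"]
      mult_mat_vec_carrier[OF qmat_carrier mor_eval_carrier[OF \<psi>]] by simp
  also have "\<dots> = pol (ev d \<psi> x) (ev d \<psi> y)"
    unfolding ev_def mor_eval_def[symmetric]
    by (rule pol_qmat) (rule mor_eval_carrier[OF \<psi>])+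
  finally show ?thesis .
qed

lemma bihom_pol_ev:
  assumes \<psi>: "\<psi> \<in> carrier_mat (d + 1) 6"
  shows "bihom d d (\<lambda>x y. pol (ev d \<psi> x) (ev d \<psi> y))"
proof -
  have "bihom (d + 0) (0 + d) (\<lambda>x y. ev d \<psi> x r * ev d \<psi> y s)" if "r < 6" "s < 6" for r s
    by (rule bihom_mult[OF bihom_ev[OF \<psi> that(1)] bihom_swap[OF bihom_ev[OF \<psi> that(2)]]])
  then show ?thesis unfolding pol_def by (intro bihom_add bihom_diff) simp_all
qed

text \<open>The polar form descends to the plane and vanishes on the conic of double points, because the curve lies on the quadric.\<close>

lemma isotropic_chords_form:
  assumes mor: "is_mor d \<psi>" and d: "d = Suc (Suc n)"
  shows "\<exists>F\<in>ternary_forms n. \<forall>x y. pol (ev d \<psi> x) (ev d \<psi> y) = (bracket x y)\<^sup>2 * F (divisor x y)"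
proof -
  have \<psi>: "\<psi> \<in> carrier_mat (d + 1) 6" using mor unfolding is_mor_def by blast
  obtain G where G: "G \<in> ternary_forms d" "\<And>x y. pol (ev d \<psi> x) (ev d \<psi> y) = G (divisor x y)"
    using bihom_symmetric_descends[OF bihom_pol_ev[OF \<psi>]] pol_commute by blast
  have "G (divisor x x) = 0" for x
  proof (cases "x = (0, 0)")
    case True
    then have "G (divisor x x) = G (0 * 0, 0 * 0, 0 * 0)" by (simp add: divisor_def)
    also have "\<dots> = 0" unfolding ternary_homogeneous[OF G(1)] by (simp add: d)
    finally show ?thesis .
  next
    case False
    then have "mor_eval d \<psi> x \<bullet> (qmat *\<^sub>v mor_eval d \<psi> x) = 0" using mor unfolding is_mor_def by blast
    then have "pol (ev d \<psi> x) (ev d \<psi> x) = 0"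
      unfolding ev_def pol_qmat[OF mor_eval_carrier[OF \<psi>] mor_eval_carrier[OF \<psi>]] .
    then show ?thesis using G(2) by simp
  qed
  then obtain F where F: "F \<in> ternary_forms n" "\<And>u. G u = disc u * F u"
    using disc_divides[OF G(1)[unfolded d]] by blast
  have "pol (ev d \<psi> x) (ev d \<psi> y) = (bracket x y)\<^sup>2 * F (divisor x y)" for x y
    unfolding G(2) F(2) disc_divisor ..
  then show ?thesis using F(1) by blast
qed

text \<open>If all chords were isotropic, the lines \<open>K\<^sub>t\<close> would pairwise meet.\<close>

lemma isotropic_chords_nonzero:
  assumes mor: "is_mor d \<psi>"
    and non: "\<not> (\<exists>M. isotropic_plane M \<and>
      (\<forall>t. t \<noteq> (0, 0) \<longrightarrow> mor_eval d \<psi> t \<in> {M *\<^sub>v c | c. c \<in> carrier_vec 3}))"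
  shows "\<exists>x y. pol (ev d \<psi> x) (ev d \<psi> y) \<noteq> 0"
proof (rule ccontr)
  assume "\<not> ?thesis"
  then have orth: "pol (ev d \<psi> x) (ev d \<psi> y) = 0" for x y by blast
  have \<psi>: "\<psi> \<in> carrier_mat (d + 1) 6" using mor unfolding is_mor_def by blast
  have ev: "vec 6 (ev d \<psi> t) = mor_eval d \<psi> t" for t
    using mor_eval_carrier[OF \<psi>, of t] by (auto simp: ev_def)
  have "mor_eval d \<psi> (1, 0) \<noteq> 0\<^sub>v 6" using mor unfolding is_mor_def by simp
  then obtain r where r: "r < 6" "ev d \<psi> (1, 0) r \<noteq> 0"
    using mor_eval_carrier[OF \<psi>, of "(1, 0)"] unfolding ev_def by (metis carrier_vecD eq_vecI index_zero_vec)
  from isotropic_family[of d "ev d \<psi>", OF bihom_ev[OF \<psi>] r(2,1) orth]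
  show False using non unfolding ev by blast
qed

lemma bihom_symmetric_matrix:
  assumes f: "bihom m m f" and sym: "\<And>x y. f x y = f y x"
  shows "\<exists>B\<in>sym_mats (m + 1). \<forall>x y. veronese m x \<bullet> (B *\<^sub>v veronese m y) = f x y"
proof -
  obtain k where k: "\<And>x y. f x y = (\<Sum>i\<le>m. \<Sum>j\<le>m. monomial22 (k i j) (m - i) i (m - j) j x y)"
    using f unfolding bihom_def by blast
  define B where "B = mat (m + 1) (m + 1) (\<lambda>(i, j). (k i j + k j i) / 2)"
  have "B \<in> sym_mats (m + 1)"
    unfolding sym_mats_def B_def by (auto intro!: eq_matI simp: add.commute)
  moreover have "veronese m x \<bullet> (B *\<^sub>v veronese m y) = f x y" for x y
  proof -
    have "veronese m x \<bullet> (B *\<^sub>v veronese m y)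
        = (\<Sum>i\<in>{0..<m + 1}. veronese m x $ i * (\<Sum>j\<in>{0..<m + 1}. (k i j + k j i) / 2 * veronese m y $ j))"
      using veronese_carrier[of m x] veronese_carrier[of m y] by (simp add: B_def scalar_prod_def)
    also have "{0..<m + 1} = {..m}" by auto
    also have "(\<Sum>i\<le>m. veronese m x $ i * (\<Sum>j\<le>m. (k i j + k j i) / 2 * veronese m y $ j))
      = (\<Sum>i\<le>m. \<Sum>j\<le>m. monomial22 (k i j) (m - i) i (m - j) j x y / 2 + monomial22 (k j i) (m - j) j (m - i) i y x / 2)"
      unfolding sum_distrib_left
      by (intro sum.cong refl) (simp add: veronese_index monomial22_def field_simps)
    also have "\<dots> = (\<Sum>i\<le>m. \<Sum>j\<le>m. monomial22 (k i j) (m - i) i (m - j) j x y / 2)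
        + (\<Sum>i\<le>m. \<Sum>j\<le>m. monomial22 (k j i) (m - j) j (m - i) i y x / 2)"
      by (simp add: sum.distrib)
    also have "(\<Sum>i\<le>m. \<Sum>j\<le>m. monomial22 (k j i) (m - j) j (m - i) i y x / 2)
        = (\<Sum>j\<le>m. \<Sum>i\<le>m. monomial22 (k j i) (m - j) j (m - i) i y x / 2)"
      by (rule sum.swap)
    also have "(\<Sum>i\<le>m. \<Sum>j\<le>m. monomial22 (k i j) (m - i) i (m - j) j x y / 2) + \<dots> = f x y / 2 + f y x / 2"
      unfolding k by (simp add: sum_divide_distrib)
    also have "\<dots> = f x y" using sym[of x y] by simp
    finally show ?thesis .
  qed
  ultimately show ?thesis by blast
qed

section \<open>The Fitting ideal on a small open set\<close>

lemma sum_fun_eval: "(\<Sum>i\<in>I. f i) x = (\<Sum>i\<in>I. f i x)"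
  by (induction I rule: infinite_finite_induct) simp_all

lemma O_plane_closed:
  assumes "a \<in> O_plane U" "b \<in> O_plane U"
  shows "(\<lambda>u. a u + b u) \<in> O_plane U" "(\<lambda>u. a u * b u) \<in> O_plane U" "(\<lambda>u. a u - b u) \<in> O_plane U"
  using assms unfolding O_plane_def
  by (auto intro: tf.regular_add tf.regular_mult tf.regular_diff)

lemma O_plane_uminus: "a \<in> O_plane U \<Longrightarrow> (\<lambda>u. - a u) \<in> O_plane U"
  unfolding O_plane_def by (rule tf.regular_uminus)

lemma O_plane_zero: "(\<lambda>_. 0) \<in> O_plane U"
  unfolding O_plane_def by (rule tf.regular_zero)

lemma O_plane_sum: "(\<And>i. i \<in> I \<Longrightarrow> f i \<in> O_plane U) \<Longrightarrow> (\<lambda>u. \<Sum>i\<in>I. f i u) \<in> O_plane U"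
  unfolding O_plane_def by (rule tf.regular_sum)

lemma O_plane_outside: "a \<in> O_plane U \<Longrightarrow> u \<notin> U \<Longrightarrow> a u = 0"
  unfolding O_plane_iff by blast

lemma O_inc_outside: "a \<in> O_inc U \<Longrightarrow> w \<notin> incidence U \<Longrightarrow> a w = 0"
  unfolding O_inc_def regular_on_def by blast

lemma O_inc_closed:
  assumes "a \<in> O_inc U" "b \<in> O_inc U"
  shows "(\<lambda>u. a u + b u) \<in> O_inc U" "(\<lambda>u. a u * b u) \<in> O_inc U"
  using assms unfolding O_inc_def by (auto intro: bf.regular_add bf.regular_mult)

lemma O_inc_uminus: "a \<in> O_inc U \<Longrightarrow> (\<lambda>u. - a u) \<in> O_inc U"
  unfolding O_inc_def by (rule bf.regular_uminus)

lemma O_inc_cmult: "a \<in> O_inc U \<Longrightarrow> (\<lambda>u. c * a u) \<in> O_inc U"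
  unfolding O_inc_def by (rule bf.regular_cmult)

lemma O_inc_zero: "(\<lambda>_. 0) \<in> O_inc U"
  unfolding O_inc_def by (rule bf.regular_zero)

lemma O_inc_scale:
  assumes "a \<in> O_plane U" "f \<in> O_inc U"
  shows "(\<lambda>w. a (fst w) * f w) \<in> O_inc U"
proof -
  have "(\<lambda>w. a (fst w) * f w) = (\<lambda>w. (if w \<in> incidence U then a (fst w) else 0) * f w)"
    using O_inc_outside[OF assms(2)] by auto
  then show ?thesis using O_inc_closed(2)[OF O_inc_of_plane[OF assms(1)] assms(2)] by simp
qed

lemma V_tensor_combine:
  assumes "\<sigma> \<in> V_tensor A" "\<tau> \<in> V_tensor A"
    and "\<And>a b. a \<in> A \<Longrightarrow> b \<in> A \<Longrightarrow> (\<lambda>x. a x + b x) \<in> A"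
  shows "(\<lambda>i x. \<sigma> i x + \<tau> i x) \<in> V_tensor A"
  using assms unfolding V_tensor_def by auto

lemma V_tensor_map:
  assumes "\<sigma> \<in> V_tensor A" "\<And>a. a \<in> A \<Longrightarrow> (\<lambda>x. g (a x) x) \<in> B" "\<And>x. g 0 x = 0"
  shows "(\<lambda>i x. g (\<sigma> i x) x) \<in> V_tensor B"
  using assms unfolding V_tensor_def by auto

lemma V_tensor_outside:
  assumes "\<sigma> \<in> V_tensor (O_inc U)" "v \<notin> incidence U"
  shows "\<sigma> i v = 0"
proof (cases "i < 4")
  case True
  then have "\<sigma> i \<in> O_inc U" using assms(1) unfolding V_tensor_def by blast
  then show ?thesis using assms(2) by (rule O_inc_outside)
next
  case False
  then have "\<sigma> i = (\<lambda>_. 0)" using assms(1) unfolding V_tensor_def by simp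
  then show ?thesis by simp
qed

lemma K_sections_iff:
  "\<sigma> \<in> K_sections d \<psi> U \<longleftrightarrow> \<sigma> \<in> V_tensor (O_inc U) \<and>
    (\<forall>w\<in>incidence U. altmap (ev d \<psi> (snd w)) (\<lambda>i. \<sigma> i w) = (\<lambda>_. 0))"
  unfolding K_sections_def taut_fibre_iff ev_def by blast

lemma K_sections_D:
  assumes "\<kappa> \<in> K_sections d \<psi> U"
  shows "\<kappa> \<in> V_tensor (O_inc U)"
    and "v \<in> incidence U \<Longrightarrow> altmap (ev d \<psi> (snd v)) (\<lambda>i. \<kappa> i v) = (\<lambda>_. 0)"
  using assms unfolding K_sections_iff by blast+

lemma K_sections_add:
  assumes "\<kappa> \<in> K_sections d \<psi> U" "\<kappa>' \<in> K_sections d \<psi> U"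
  shows "(\<lambda>i v. \<kappa> i v + \<kappa>' i v) \<in> K_sections d \<psi> U"
  unfolding K_sections_iff altmap_add
proof (intro conjI ballI)
  show "(\<lambda>i v. \<kappa> i v + \<kappa>' i v) \<in> V_tensor (O_inc U)"
    by (rule V_tensor_combine[OF K_sections_D(1)[OF assms(1)] K_sections_D(1)[OF assms(2)] O_inc_closed(1)])
qed (simp only: K_sections_D(2)[OF assms(1)] K_sections_D(2)[OF assms(2)] add_0)

lemma K_sections_scale:
  assumes "\<kappa> \<in> K_sections d \<psi> U" "a \<in> O_plane U"
  shows "(\<lambda>i v. a (fst v) * \<kappa> i v) \<in> K_sections d \<psi> U"
  unfolding K_sections_iff altmap_cmult
proof (intro conjI ballI)
  show "(\<lambda>i v. a (fst v) * \<kappa> i v) \<in> V_tensor (O_inc U)"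
    by (rule V_tensor_map[OF K_sections_D(1)[OF assms(1)] O_inc_scale[OF assms(2)]]) (assumption, rule mult_zero_right)
qed (simp only: K_sections_D(2)[OF assms(1)] mult_zero_right)

lemma K_sections_uminus:
  assumes "\<kappa> \<in> K_sections d \<psi> U"
  shows "(\<lambda>i v. - \<kappa> i v) \<in> K_sections d \<psi> U"
  unfolding K_sections_iff altmap_uminus
proof (intro conjI ballI)
  show "(\<lambda>i v. - \<kappa> i v) \<in> V_tensor (O_inc U)"
    by (rule V_tensor_map[OF K_sections_D(1)[OF assms(1)] O_inc_uminus]) (assumption, rule minus_zero)
qed (simp only: K_sections_D(2)[OF assms(1)] minus_zero)

lemma K_sections_zero: "(\<lambda>_ _. 0) \<in> K_sections d \<psi> U"
  unfolding K_sections_iff V_tensor_def using O_inc_zero by (simp add: altmap_zero)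

lemma coker_relations_iff:
  "\<sigma> \<in> coker_relations d \<psi> U \<longleftrightarrow> (\<exists>\<alpha>\<in>V_tensor (O_plane U). \<exists>\<kappa>\<in>K_sections d \<psi> U.
    \<forall>i w. \<sigma> i w = (if w \<in> incidence U then \<alpha> i (fst w) else 0) + \<kappa> i w)"
proof -
  let ?p = "\<lambda>\<alpha> i w. if w \<in> incidence U then \<alpha> i (fst w) else 0"
  have "\<sigma> \<in> coker_relations d \<psi> U \<longleftrightarrow> (\<exists>\<alpha>\<in>V_tensor (O_plane U). \<exists>\<kappa>\<in>K_sections d \<psi> U. \<sigma> = ?p \<alpha> + \<kappa>)"
    unfolding coker_relations_def pulled_back_def by blast
  then show ?thesis unfolding plus_fun_def fun_eq_iff[of \<sigma>] fun_eq_iff[of "\<sigma> _"] .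
qed

lemma function_module_coker:
  "function_module (O_plane U) (\<lambda>u. if u \<in> U then 1 else 0) scale_sections
    (V_tensor (O_inc U)) (coker_relations d \<psi> U)"
proof
  fix a b assume ab: "a \<in> O_plane U" "b \<in> O_plane U"
  show "a + b \<in> O_plane U" using O_plane_closed(1)[OF ab] by (simp add: plus_fun_def)
  show "a * b \<in> O_plane U" using O_plane_closed(2)[OF ab] by (simp add: times_fun_def)
next
  fix a assume a: "a \<in> O_plane U"
  show "- a \<in> O_plane U" using O_plane_uminus[OF a] by (simp add: fun_Compl_def)
  show "(\<lambda>u. if u \<in> U then 1 else 0) * a = a"
    using O_plane_outside[OF a] by (auto simp: fun_eq_iff)
next
  show "(\<lambda>u. if u \<in> U then 1 else 0) \<in> O_plane U"
    unfolding O_plane_def by (rule tf.regular_const)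
next
  fix a b :: "pt2 \<Rightarrow> complex" and m m' :: "nat \<Rightarrow> pt2 \<times> pt1 \<Rightarrow> complex"
  show "scale_sections (a + b) m = scale_sections a m + scale_sections b m"
    "scale_sections a (m + m') = scale_sections a m + scale_sections a m'"
    "scale_sections (a * b) m = scale_sections a (scale_sections b m)"
    unfolding scale_sections_def by (auto simp: fun_eq_iff algebra_simps)
next
  fix \<sigma> :: "nat \<Rightarrow> pt2 \<times> pt1 \<Rightarrow> complex" assume \<sigma>: "\<sigma> \<in> V_tensor (O_inc U)"
  show "scale_sections (\<lambda>u. if u \<in> U then 1 else 0) \<sigma> = \<sigma>"
  proof (intro ext)
    fix i v
    show "scale_sections (\<lambda>u. if u \<in> U then 1 else 0) \<sigma> i v = \<sigma> i v"
    proof (cases "v \<in> incidence U")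
      case True
      then have "fst v \<in> U" by (auto simp: incidence_def)
      then show ?thesis by (simp add: scale_sections_def)
    qed (simp add: scale_sections_def V_tensor_outside[OF \<sigma>])
  qed
next
  have "(\<lambda>_ _. 0) \<in> V_tensor (O_plane U)"
    unfolding V_tensor_def using O_plane_zero by simp
  then show "0 \<in> coker_relations d \<psi> U"
    using K_sections_zero unfolding coker_relations_iff
    by (intro bexI[of _ "\<lambda>_ _. 0"]) (simp_all only: zero_fun_apply if_cancel add_0 simp_thms)
next
  fix \<sigma> \<tau> assume "\<sigma> \<in> coker_relations d \<psi> U" "\<tau> \<in> coker_relations d \<psi> U"
  then obtain \<alpha> \<kappa> \<alpha>' \<kappa>' where 1: "\<alpha> \<in> V_tensor (O_plane U)" "\<kappa> \<in> K_sections d \<psi> U"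
    "\<And>i w. \<sigma> i w = (if w \<in> incidence U then \<alpha> i (fst w) else 0) + \<kappa> i w"
    and 2: "\<alpha>' \<in> V_tensor (O_plane U)" "\<kappa>' \<in> K_sections d \<psi> U"
    "\<And>i w. \<tau> i w = (if w \<in> incidence U then \<alpha>' i (fst w) else 0) + \<kappa>' i w"
    unfolding coker_relations_iff by metis
  show "\<sigma> + \<tau> \<in> coker_relations d \<psi> U"
    unfolding coker_relations_iff plus_fun_apply 1(3) 2(3)
    by (rule bexI[OF _ V_tensor_combine[OF 1(1) 2(1) O_plane_closed(1)]],
        rule bexI[OF _ K_sections_add[OF 1(2) 2(2)]]) auto
next
  fix \<sigma> assume "\<sigma> \<in> coker_relations d \<psi> U"
  then obtain \<alpha> \<kappa> where 1: "\<alpha> \<in> V_tensor (O_plane U)" "\<kappa> \<in> K_sections d \<psi> U"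
    "\<And>i w. \<sigma> i w = (if w \<in> incidence U then \<alpha> i (fst w) else 0) + \<kappa> i w"
    unfolding coker_relations_iff by metis
  have neg: "(\<lambda>i u. - \<alpha> i u) \<in> V_tensor (O_plane U)"
    by (rule V_tensor_map[OF 1(1) O_plane_uminus]) (assumption, rule minus_zero)
  show "- \<sigma> \<in> coker_relations d \<psi> U"
    unfolding coker_relations_iff uminus_apply 1(3)
    by (rule bexI[OF _ neg], rule bexI[OF _ K_sections_uminus[OF 1(2)]]) auto
  fix a assume a: "a \<in> O_plane U"
  have scaled: "(\<lambda>i u. a u * \<alpha> i u) \<in> V_tensor (O_plane U)"
    by (rule V_tensor_map[OF 1(1) O_plane_closed(2)[OF a]]) (assumption, rule mult_zero_right)
  show "scale_sections a \<sigma> \<in> coker_relations d \<psi> U"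
    unfolding coker_relations_iff scale_sections_def 1(3)
    by (rule bexI[OF _ scaled], rule bexI[OF _ K_sections_scale[OF 1(2) a]]) (auto simp: algebra_simps)
qed

text \<open>The last assumption makes the images of the covectors \<open>w\<close> and \<open>w'\<close> a basis of \<open>K\<^sub>x\<close> for every point of the double cover;
  by symmetry of the divisor it covers both points of a fibre.\<close>

locale psi_chart = chart l1 l2 m1 m2 h n U
  for l1 l2 m1 m2 :: complex and h :: "pt2 \<Rightarrow> complex" and n :: nat and U :: "pt2 set" +
  fixes d :: nat and \<psi> :: "complex mat" and w w' :: "nat \<Rightarrow> complex"
  assumes psi: "\<psi> \<in> carrier_mat (d + 1) 6"
    and isotropic: "\<And>t. pol (ev d \<psi> t) (ev d \<psi> t) = 0"
    and transversal: "\<And>x y. divisor x y \<in> U \<Longrightarrow> dot4 w (altmap (dual (ev d \<psi> x)) w') \<noteq> 0"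
begin

definition \<delta> :: "pt1 \<Rightarrow> complex" where "\<delta> t = dot4 w (altmap (dual (ev d \<psi> t)) w')"

text \<open>Two sections that span the tautological subbundle at the points of the chart, in degree zero,
  and their multiples by \<open>\<xi>\<close>.\<close>

definition S :: "nat \<Rightarrow> pt1 \<Rightarrow> nat \<Rightarrow> complex" where
  "S l t i = altmap (dual (ev d \<psi> t)) (if l = 0 then w else w') i / lf t ^ d"

definition R :: "nat \<Rightarrow> pt1 \<Rightarrow> nat \<Rightarrow> complex" where
  "R l t i = (if l < 2 then S l t i else \<xi> t * S (l - 2) t i)"

lemma bihom_K: "bihom d 0 (\<lambda>x y. altmap (dual (ev d \<psi> x)) v i)"
  by (rule bihom_altmap[of d "\<lambda>x. dual (ev d \<psi> x)"], rule bihom_dual[OF bihom_ev[OF psi]])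

lemma bihom_\<delta>: "bihom d 0 (\<lambda>x y. \<delta> x)"
  unfolding \<delta>_def dot4_def by (intro bihom_add bihom_cmult bihom_K)

lemma bihom_lf_power: "bihom d 0 (\<lambda>x y. lf x ^ d)"
  using bihom_power[OF bihom_lf(1), of d] by simp

lemma inc_nonzero: "v \<in> incidence U \<Longrightarrow> lf (snd v) \<noteq> 0 \<and> \<delta> (snd v) \<noteq> 0"
proof -
  assume "v \<in> incidence U"
  then obtain x y where "v = (divisor x y, x)" "divisor x y \<in> U" using incidence_chart by blast
  then show ?thesis using divisor_in_U_nonzero transversal unfolding \<delta>_def by auto
qed

lemma S_O_inc: "(\<lambda>v. if v \<in> incidence U then S l (snd v) i else 0) \<in> O_inc U"
  unfolding S_def using inc_nonzero by (intro O_inc_binary_fraction[OF bihom_K bihom_lf_power]) simp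

lemma xi_O_inc: "(\<lambda>v. if v \<in> incidence U then \<xi> (snd v) else 0) \<in> O_inc U"
  unfolding \<xi>_def using inc_nonzero by (intro O_inc_binary_fraction[of 1] bihom_mf bihom_lf) simp

lemma R_O_inc: "(\<lambda>v. if v \<in> incidence U then R l (snd v) i else 0) \<in> O_inc U"
proof (cases "l < 2")
  case True
  then show ?thesis using S_O_inc[of l i] by (simp add: R_def cong: if_cong)
next
  case False
  then have "(\<lambda>v. if v \<in> incidence U then R l (snd v) i else 0)
    = (\<lambda>v. (if v \<in> incidence U then \<xi> (snd v) else 0) * (if v \<in> incidence U then S (l - 2) (snd v) i else 0))"
    by (auto simp: R_def)
  then show ?thesis using O_inc_closed(2)[OF xi_O_inc S_O_inc] by simp
qed

lemma R_outside: "\<not> i < 4 \<Longrightarrow> R l t i = 0"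
  by (simp add: R_def S_def altmap_def)

lemma R_K_sections: "(\<lambda>i v. if v \<in> incidence U then R l (snd v) i else 0) \<in> K_sections d \<psi> U"
proof -
  have "\<exists>c v. R l t = (\<lambda>i. c * altmap (dual (ev d \<psi> t)) v i)" for t
  proof (cases "l < 2")
    case True
    then show ?thesis
      by (intro exI[of _ "1 / lf t ^ d"] exI[of _ "if l = 0 then w else w'"]) (auto simp: R_def S_def)
  next
    case False
    then show ?thesis
      by (intro exI[of _ "\<xi> t / lf t ^ d"] exI[of _ "if l - 2 = 0 then w else w'"]) (auto simp: R_def S_def)
  qed
  then have "altmap (ev d \<psi> t) (R l t) = (\<lambda>_. 0)" for t
    using altmap_isotropic(1)[OF isotropic] altmap_cmult by (metis mult_zero_right)
  then show ?thesis
    unfolding K_sections_iff V_tensor_def using R_O_inc R_outside by auto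
qed

text \<open>The two sections generate: a section with values in the subbundle is expanded by contracting
  with the two covectors.\<close>

lemma K_section_expansion:
  assumes \<kappa>: "\<kappa> \<in> K_sections d \<psi> U"
  shows "\<exists>s. (\<forall>l<4. s l \<in> O_plane U) \<and>
    (\<forall>u t i. (u, t) \<in> incidence U \<longrightarrow> i < 4 \<longrightarrow> \<kappa> i (u, t) = (\<Sum>l<4. s l u * R l t i))"
proof -
  define q where "q = (\<lambda>v. if v \<in> incidence U then lf (snd v) ^ d / \<delta> (snd v) else 0)"
  have q: "q \<in> O_inc U"
    unfolding q_def using inc_nonzero by (intro O_inc_binary_fraction[OF bihom_lf_power bihom_\<delta>]) simp
  have dot: "(\<lambda>v. dot4 a (\<lambda>i. \<kappa> i v) * q v) \<in> O_inc U" for a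
  proof -
    have "\<kappa> i \<in> O_inc U" if "i < 4" for i using \<kappa> that unfolding K_sections_iff V_tensor_def by blast
    then have "(\<lambda>v. dot4 a (\<lambda>i. \<kappa> i v)) \<in> O_inc U"
      unfolding dot4_def by (intro O_inc_closed(1) O_inc_cmult) simp_all
    then show ?thesis by (rule O_inc_closed(2)[OF _ q])
  qed
  obtain s0 s2 where s02: "s0 \<in> O_plane U" "s2 \<in> O_plane U"
    "\<And>u t. (u, t) \<in> incidence U \<Longrightarrow> - (dot4 w' (\<lambda>i. \<kappa> i (u, t)) * q (u, t)) = s0 u + s2 u * \<xi> t"
    using O_inc_split[OF O_inc_uminus[OF dot[of w']]] by blast
  obtain s1 s3 where s13: "s1 \<in> O_plane U" "s3 \<in> O_plane U"
    "\<And>u t. (u, t) \<in> incidence U \<Longrightarrow> dot4 w (\<lambda>i. \<kappa> i (u, t)) * q (u, t) = s1 u + s3 u * \<xi> t"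
    using O_inc_split[OF dot[of w]] by blast
  define s where "s = (\<lambda>l :: nat. if l = 0 then s0 else if l = 1 then s1 else if l = 2 then s2 else s3)"
  have "\<forall>l<4. s l \<in> O_plane U" using s02 s13 by (simp add: s_def)
  moreover have "\<kappa> i (u, t) = (\<Sum>l<4. s l u * R l t i)" if ut: "(u, t) \<in> incidence U" and i: "i < 4" for u t i
  proof -
    let ?p = "ev d \<psi> t"
    have nz: "lf t \<noteq> 0" "\<delta> t \<noteq> 0" using inc_nonzero[OF ut] by simp_all
    have rad: "altmap ?p (\<lambda>i. \<kappa> i (u, t)) = (\<lambda>_. 0)"
      using \<kappa> ut unfolding K_sections_iff by fastforce
    have "\<delta> t * \<kappa> i (u, t) = dot4 w (\<lambda>i. \<kappa> i (u, t)) * altmap (dual ?p) w' i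
        - dot4 w' (\<lambda>i. \<kappa> i (u, t)) * altmap (dual ?p) w i"
      unfolding \<delta>_def by (rule radical_expansion[OF rad i])
    then have "\<kappa> i (u, t) = (dot4 w (\<lambda>i. \<kappa> i (u, t)) * altmap (dual ?p) w' i
        - dot4 w' (\<lambda>i. \<kappa> i (u, t)) * altmap (dual ?p) w i) / \<delta> t"
      using nz by (simp add: field_simps)
    also have "\<dots> = (dot4 w (\<lambda>i. \<kappa> i (u, t)) * q (u, t)) * S 1 t i
        + (- (dot4 w' (\<lambda>i. \<kappa> i (u, t)) * q (u, t))) * S 0 t i"
      using nz ut by (simp add: q_def S_def field_simps)
    also have "\<dots> = (s1 u + s3 u * \<xi> t) * S 1 t i + (s0 u + s2 u * \<xi> t) * S 0 t i"
      unfolding s02(3)[OF ut] s13(3)[OF ut] ..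
    also have "\<dots> = (\<Sum>l<4. s l u * R l t i)"
      by (simp add: eval_nat_numeral R_def s_def algebra_simps)
    finally show ?thesis .
  qed
  ultimately show ?thesis by blast
qed

text \<open>The sections \<open>\<xi> e\<^sub>k\<close>.\<close>

definition \<epsilon> :: "nat \<Rightarrow> nat \<Rightarrow> pt2 \<times> pt1 \<Rightarrow> complex" where
  "\<epsilon> k i v = (if i = k \<and> v \<in> incidence U then \<xi> (snd v) else 0)"

lemma sum_\<epsilon>: "(\<Sum>k<4. scale_sections (r k) (\<epsilon> k)) i v
    = (if i < 4 \<and> v \<in> incidence U then r i (fst v) * \<xi> (snd v) else 0)"
proof -
  have "(\<Sum>k<4. scale_sections (r k) (\<epsilon> k)) i v
      = (\<Sum>k<4. if i = k then (if v \<in> incidence U then r i (fst v) * \<xi> (snd v) else 0) else 0)"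
    unfolding sum_fun_eval by (intro sum.cong refl) (simp add: scale_sections_def \<epsilon>_def)
  then show ?thesis by (simp add: sum.delta)
qed

lemma \<epsilon>_generates: "generates_mod (O_plane U) scale_sections (V_tensor (O_inc U)) (coker_relations d \<psi> U) 4 \<epsilon>"
  unfolding generates_mod_def
proof (intro conjI allI impI ballI)
  fix k :: nat assume "k < 4"
  then show "\<epsilon> k \<in> V_tensor (O_inc U)"
    unfolding V_tensor_def
  proof (intro CollectI conjI allI impI)
    fix i :: nat assume "i < 4"
    show "\<epsilon> k i \<in> O_inc U"
      using xi_O_inc O_inc_zero by (cases "i = k") (simp_all add: \<epsilon>_def[abs_def] cong: if_cong)
  qed (auto simp: \<epsilon>_def fun_eq_iff)
next
  fix \<sigma> assume \<sigma>: "\<sigma> \<in> V_tensor (O_inc U)"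
  have "\<forall>i. \<exists>\<alpha> \<beta>. i < 4 \<longrightarrow> \<alpha> \<in> O_plane U \<and> \<beta> \<in> O_plane U \<and>
      (\<forall>u t. (u, t) \<in> incidence U \<longrightarrow> \<sigma> i (u, t) = \<alpha> u + \<beta> u * \<xi> t)"
    using O_inc_split \<sigma> unfolding V_tensor_def by blast
  then obtain \<alpha> \<beta> where ab: "\<And>i. i < 4 \<Longrightarrow> \<alpha> i \<in> O_plane U" "\<And>i. i < 4 \<Longrightarrow> \<beta> i \<in> O_plane U"
    "\<And>i u t. i < 4 \<Longrightarrow> (u, t) \<in> incidence U \<Longrightarrow> \<sigma> i (u, t) = \<alpha> i u + \<beta> i u * \<xi> t" by metis
  define \<alpha>' where "\<alpha>' = (\<lambda>i :: nat. if i < 4 then \<alpha> i else (\<lambda>_. 0))"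
  have "(\<sigma> - (\<Sum>k<4. scale_sections (\<beta> k) (\<epsilon> k))) i v = (if v \<in> incidence U then \<alpha>' i (fst v) else 0) + 0" for i v
  proof (cases "i < 4 \<and> v \<in> incidence U")
    case True
    then show ?thesis using ab(3)[of i "fst v" "snd v"] unfolding fun_diff_def sum_\<epsilon> by (simp add: \<alpha>'_def)
  next
    case False
    then have "\<sigma> i v = 0"
      using \<sigma> V_tensor_outside[OF \<sigma>, of v i] by (cases "i < 4") (auto simp: V_tensor_def)
    then show ?thesis using False unfolding fun_diff_def sum_\<epsilon> by (auto simp: \<alpha>'_def)
  qed
  moreover have "\<alpha>' \<in> V_tensor (O_plane U)" unfolding V_tensor_def \<alpha>'_def using ab(1) by auto
  moreover note K_sections_zero[of d \<psi> U]
  ultimately have "\<sigma> - (\<Sum>k<4. scale_sections (\<beta> k) (\<epsilon> k)) \<in> coker_relations d \<psi> U"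
    unfolding coker_relations_iff
    by (intro bexI[of _ \<alpha>'] bexI[of _ "\<lambda>_ _. 0"]) auto
  then show "\<exists>a. (\<forall>i<4. a i \<in> O_plane U) \<and> \<sigma> - (\<Sum>i<4. scale_sections (a i) (\<epsilon> i)) \<in> coker_relations d \<psi> U"
    using ab(2) by blast
qed

end

lemma pol_plu_row_operations:
  "pol (plu a b) (plu (\<lambda>i. c * a i + a' i) (\<lambda>i. c * b i + b' i)) = pol (plu a b) (plu a' b')"
  by (simp add: pol_def plu_def algebra_simps)

lemma pol_plu_difference:
  "pol (plu (\<lambda>i. a i - a' i) (\<lambda>i. b i - b' i)) (plu a' b') = pol (plu a b) (plu a' b')"
  by (simp add: pol_def plu_def algebra_simps)

lemma pol_plu_scale:
  "pol (plu (\<lambda>i. s * a i) (\<lambda>i. s * b i)) (plu (\<lambda>i. t * c i) (\<lambda>i. t * e i)) = (s * t)\<^sup>2 * pol (plu a b) (plu c e)"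
  by (simp add: pol_def plu_def power2_eq_square algebra_simps)

lemma det_fun_laplace:
  "det (mat 4 4 (\<lambda>(l, i). \<beta> l i :: pt2 \<Rightarrow> complex)) u
    = pol (plu (\<lambda>i. \<beta> 0 i u) (\<lambda>i. \<beta> 1 i u)) (plu (\<lambda>i. \<beta> 2 i u) (\<lambda>i. \<beta> 3 i u))"
proof -
  interpret comm_ring_hom "\<lambda>f :: pt2 \<Rightarrow> complex. f u" by (rule comm_ring_hom_eval)
  have "det (mat 4 4 (\<lambda>(l, i). \<beta> l i)) u = det (map_mat (\<lambda>f. f u) (mat 4 4 (\<lambda>(l, i). \<beta> l i)))"
    by (rule hom_det[symmetric])
  also have "map_mat (\<lambda>f. f u) (mat 4 4 (\<lambda>(l, i). \<beta> l i)) = mat 4 4 (\<lambda>(l, i). \<beta> l i u)"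
    by (rule eq_matI) auto
  finally show ?thesis unfolding det4_laplace .
qed

lemma ideal_gen_associated:
  fixes A :: "'r :: comm_ring_1 set"
  assumes "\<And>a b. a \<in> A \<Longrightarrow> b \<in> A \<Longrightarrow> a * b \<in> A" "\<omega> \<in> A" "\<omega>' \<in> A"
    and "D = \<omega> * E" "E = \<omega>' * D"
  shows "ideal_gen A {D} = ideal_gen A {E}"
proof
  show "ideal_gen A {D} \<subseteq> ideal_gen A {E}"
  proof (rule ideal_gen_subset_principal)
    fix s a assume "s \<in> {D}" "a \<in> A"
    then have "a * s = (a * \<omega>) * E" "a * \<omega> \<in> A" using assms(1-4) by (simp_all only: singleton_iff mult.assoc)
    then show "\<exists>b\<in>A. a * s = b * E" by blast
  qed
  show "ideal_gen A {E} \<subseteq> ideal_gen A {D}"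
  proof (rule ideal_gen_subset_principal)
    fix s a assume "s \<in> {E}" "a \<in> A"
    then have "a * s = (a * \<omega>') * D" "a * \<omega>' \<in> A"
      using assms(1,3) assms(5) by (simp_all only: singleton_iff mult.assoc)
    then show "\<exists>b\<in>A. a * s = b * D" by blast
  qed
qed

context psi_chart
begin

lemma relation_coefficients:
  "\<exists>\<alpha> \<beta>. \<forall>l i. \<alpha> l i \<in> O_plane U \<and> \<beta> l i \<in> O_plane U \<and>
    (\<forall>u t. (u, t) \<in> incidence U \<longrightarrow> R l t i = \<alpha> l i u + \<beta> l i u * \<xi> t)"
proof -
  have "\<forall>l i. \<exists>a b. a \<in> O_plane U \<and> b \<in> O_plane U \<and>
    (\<forall>u t. (u, t) \<in> incidence U \<longrightarrow> R l t i = a u + b u * \<xi> t)"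
  proof (intro allI)
    fix l i
    obtain a b where ab: "a \<in> O_plane U" "b \<in> O_plane U"
      "\<And>u t. (u, t) \<in> incidence U \<Longrightarrow> (if (u, t) \<in> incidence U then R l (snd (u, t)) i else 0) = a u + b u * \<xi> t"
      using O_inc_split[OF R_O_inc[of l i]] by blast
    have "R l t i = a u + b u * \<xi> t" if "(u, t) \<in> incidence U" for u t
      using ab(3)[OF that] that by simp
    then show "\<exists>a b. a \<in> O_plane U \<and> b \<in> O_plane U \<and>
      (\<forall>u t. (u, t) \<in> incidence U \<longrightarrow> R l t i = a u + b u * \<xi> t)"
      using ab(1,2) by blast
  qed
  then show ?thesis by metis
qed

text \<open>Modulo the functions that come from the plane the cokernel is generated by the multiples of \<open>\<xi>\<close>, and its relations are
  the coefficients of \<open>\<xi>\<close> in the generators of the tautological subbundle: a square matrix.\<close>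

lemma fitting_coker_det:
  assumes \<alpha>: "\<And>l i. \<alpha> l i \<in> O_plane U" and \<beta>: "\<And>l i. \<beta> l i \<in> O_plane U"
    and split: "\<And>l i u t. (u, t) \<in> incidence U \<Longrightarrow> R l t i = \<alpha> l i u + \<beta> l i u * \<xi> t"
  shows "fitting_coker d \<psi> U = ideal_gen (O_plane U) {det (mat 4 4 (\<lambda>(l, i). \<beta> l i))}"
  unfolding fitting_coker_def
proof (rule function_module.fitting0_square_presentation[OF function_module_coker \<epsilon>_generates])
  show "\<beta> l k \<in> O_plane U" for l k by (rule \<beta>)
next
  fix l :: nat assume "l < 4"
  define a where "a = (\<lambda>i :: nat. if i < 4 then (\<lambda>u. - \<alpha> l i u) else (\<lambda>_. 0))"
  have a: "a \<in> V_tensor (O_plane U)"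
    unfolding V_tensor_def a_def using O_plane_uminus[OF \<alpha>] by simp
  have "(\<Sum>k<4. scale_sections (\<beta> l k) (\<epsilon> k)) i v
      = (if v \<in> incidence U then a i (fst v) else 0) + (if v \<in> incidence U then R l (snd v) i else 0)" for i v
  proof (cases "v \<in> incidence U")
    case True
    show ?thesis
    proof (cases "i < 4")
      case i: True
      have "R l (snd v) i = \<alpha> l i (fst v) + \<beta> l i (fst v) * \<xi> (snd v)"
        using split[of "fst v" "snd v" l i] True by (simp only: prod.collapse)
      then show ?thesis unfolding sum_\<epsilon> using True i by (simp add: a_def)
    next
      case False
      then show ?thesis unfolding sum_\<epsilon> by (simp add: a_def R_outside)
    qed
  next
    case False
    then show ?thesis unfolding sum_\<epsilon> by simp
  qed
  then show "(\<Sum>k<4. scale_sections (\<beta> l k) (\<epsilon> k)) \<in> coker_relations d \<psi> U"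
    unfolding coker_relations_iff by (intro bexI[OF _ a] bexI[OF _ R_K_sections[of l]] allI)
next
  fix r assume r: "\<And>k. k < 4 \<Longrightarrow> r k \<in> O_plane U"
    and "(\<Sum>k<4. scale_sections (r k) (\<epsilon> k)) \<in> coker_relations d \<psi> U"
  then obtain a \<kappa> where a: "a \<in> V_tensor (O_plane U)" and \<kappa>: "\<kappa> \<in> K_sections d \<psi> U"
    and eq: "\<And>i v. (if i < 4 \<and> v \<in> incidence U then r i (fst v) * \<xi> (snd v) else 0)
      = (if v \<in> incidence U then a i (fst v) else 0) + \<kappa> i v"
    unfolding coker_relations_iff sum_\<epsilon> by blast
  obtain s where s: "\<And>l. l < 4 \<Longrightarrow> s l \<in> O_plane U"
    "\<And>u t i. (u, t) \<in> incidence U \<Longrightarrow> i < 4 \<Longrightarrow> \<kappa> i (u, t) = (\<Sum>l<4. s l u * R l t i)"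
    using K_section_expansion[OF \<kappa>] by blast
  have "r k = (\<Sum>l<4. s l * \<beta> l k)" if k: "k < 4" for k
  proof
    fix u
    have ak: "a k \<in> O_plane U" using a k unfolding V_tensor_def by blast
    have X: "(\<lambda>u. a k u + (\<Sum>l<4. s l u * \<alpha> l k u)) \<in> O_plane U"
      by (intro O_plane_closed(1) O_plane_sum ak O_plane_closed(2) s \<alpha>) simp
    have Y: "(\<lambda>u. (\<Sum>l<4. s l u * \<beta> l k u) - r k u) \<in> O_plane U"
      by (intro O_plane_closed(3) O_plane_sum O_plane_closed(2) s \<beta> r k) simp
    have "(a k v + (\<Sum>l<4. s l v * \<alpha> l k v)) + ((\<Sum>l<4. s l v * \<beta> l k v) - r k v) * \<xi> t = 0"
      if vt: "(v, t) \<in> incidence U" for v t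
    proof -
      have "r k v * \<xi> t = a k v + (\<Sum>l<4. s l v * R l t k)"
        using eq[of k "(v, t)"] s(2)[OF vt k] k vt by simp
      also have "(\<Sum>l<4. s l v * R l t k) = (\<Sum>l<4. s l v * \<alpha> l k v + s l v * \<beta> l k v * \<xi> t)"
        unfolding split[OF vt] by (simp add: algebra_simps)
      also have "\<dots> = (\<Sum>l<4. s l v * \<alpha> l k v) + (\<Sum>l<4. s l v * \<beta> l k v) * \<xi> t"
        by (simp add: sum.distrib sum_distrib_right)
      finally show ?thesis by (simp add: algebra_simps)
    qed
    then have "(\<Sum>l<4. s l u * \<beta> l k u) - r k u = 0"
      using O_plane_xi_zero[OF X Y] by blast
    then show "r k u = (\<Sum>l<4. s l * \<beta> l k) u" unfolding sum_fun_eval times_fun_apply by simp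
  qed
  then show "\<exists>s. (\<forall>l<4. s l \<in> O_plane U) \<and> (\<forall>k<4. r k = (\<Sum>l<4. s l * \<beta> l k))"
    using s(1) by blast
qed

text \<open>Row operations turn the determinant at a pair \<open>{x, y}\<close> into the determinant of the two lines
  over \<open>x\<close> and \<open>y\<close>, divided by the square of the difference of the coordinates.\<close>

lemma relation_det:
  assumes split: "\<And>l i u t. (u, t) \<in> incidence U \<Longrightarrow> R l t i = \<alpha> l i u + \<beta> l i u * \<xi> t"
    and xy: "divisor x y \<in> U" "bracket x y \<noteq> 0"
  shows "det (mat 4 4 (\<lambda>(l, i). \<beta> l i)) (divisor x y)
    = (lf x * lf y)\<^sup>2 * (\<delta> x * \<delta> y) * pol (ev d \<psi> x) (ev d \<psi> y) / ((bracket x y)\<^sup>2 * ((lf x * lf y) ^ d)\<^sup>2)"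
proof -
  let ?u = "divisor x y"
  note nz = divisor_in_U_nonzero[OF xy(1)]
  define D where "D = \<xi> x - \<xi> y"
  have D: "D = bracket x y / (lf x * lf y)" unfolding D_def by (rule \<xi>_diff[OF xy(1)])
  then have Dnz: "D \<noteq> 0" using nz xy(2) by simp
  note inc = incidence_divisor[OF xy(1) nz(1,2)]
  define b where "b = (\<lambda>l i. (R l x i - R l y i) / D)"
  have \<beta>: "\<beta> l i ?u = b l i" for l i
  proof -
    have "R l x i - R l y i = \<beta> l i ?u * D"
      using split[OF inc(1), of l i] split[OF inc(2), of l i] unfolding D_def by (simp add: algebra_simps)
    then show ?thesis using Dnz by (simp add: b_def)
  qed
  have b01: "b 0 = (\<lambda>i. (1 / D) * (S 0 x i - S 0 y i))" "b 1 = (\<lambda>i. (1 / D) * (S 1 x i - S 1 y i))"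
    by (simp_all add: b_def R_def fun_eq_iff)
  have row: "(\<xi> x * p - \<xi> y * q) / D = \<xi> x * ((1 / D) * (p - q)) + q" for p q
  proof -
    have "\<xi> x * p - \<xi> y * q = \<xi> x * (p - q) + D * q" by (simp add: D_def algebra_simps)
    then show ?thesis using Dnz by (simp add: add_divide_distrib)
  qed
  have b23: "b 2 = (\<lambda>i. \<xi> x * b 0 i + S 0 y i)" "b 3 = (\<lambda>i. \<xi> x * b 1 i + S 1 y i)"
    unfolding b01 by (simp_all add: b_def R_def fun_eq_iff row)
  have "det (mat 4 4 (\<lambda>(l, i). \<beta> l i)) ?u = pol (plu (b 0) (b 1)) (plu (b 2) (b 3))"
    unfolding det_fun_laplace \<beta> ..
  also have "\<dots> = pol (plu (b 0) (b 1)) (plu (S 0 y) (S 1 y))"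
    unfolding b23 by (rule pol_plu_row_operations)
  also have "\<dots> = (1 / D * 1)\<^sup>2 * pol (plu (\<lambda>i. S 0 x i - S 0 y i) (\<lambda>i. S 1 x i - S 1 y i)) (plu (S 0 y) (S 1 y))"
    unfolding b01 using pol_plu_scale[of "1 / D" _ _ 1 "S 0 y" "S 1 y"] by simp
  also have "pol (plu (\<lambda>i. S 0 x i - S 0 y i) (\<lambda>i. S 1 x i - S 1 y i)) (plu (S 0 y) (S 1 y))
      = pol (plu (S 0 x) (S 1 x)) (plu (S 0 y) (S 1 y))"
    by (rule pol_plu_difference)
  also have "\<dots> = (1 / lf x ^ d * (1 / lf y ^ d))\<^sup>2 * (\<delta> x * \<delta> y * pol (ev d \<psi> x) (ev d \<psi> y))"
  proof -
    have S: "S 0 t = (\<lambda>i. 1 / lf t ^ d * altmap (dual (ev d \<psi> t)) w i)"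
      "S 1 t = (\<lambda>i. 1 / lf t ^ d * altmap (dual (ev d \<psi> t)) w' i)" for t
      by (simp_all add: S_def fun_eq_iff)
    show ?thesis unfolding S pol_plu_scale pol_plu_radicals[OF isotropic isotropic] \<delta>_def ..
  qed
  finally show ?thesis unfolding D using nz xy(2)
    by (simp add: power_divide power_mult_distrib)
qed

text \<open>Off the discriminant the determinant of the relations is \<open>F / L\<^sup>m\<close> times \<open>N / L\<^sup>d\<close>, where \<open>N\<close> is the norm of the contraction
  \<open>\<delta>\<close> and has no zero on the chart. So both functions generate the same ideal.\<close>

lemma fitting_coker_curve:
  assumes d: "d = Suc (Suc m)" and F: "F \<in> ternary_forms m"
    and polar: "\<And>x y. pol (ev d \<psi> x) (ev d \<psi> y) = (bracket x y)\<^sup>2 * F (divisor x y)"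
    and N: "N \<in> ternary_forms d" "\<And>x y. \<delta> x * \<delta> y = N (divisor x y)"
  shows "fitting_coker d \<psi> U = ideal_gen (O_plane U) {\<lambda>u. if u \<in> U then F u / L u ^ m else 0}"
proof -
  obtain \<alpha> \<beta> where \<alpha>: "\<And>l i. \<alpha> l i \<in> O_plane U" and \<beta>: "\<And>l i. \<beta> l i \<in> O_plane U"
    and split: "\<And>l i u t. (u, t) \<in> incidence U \<Longrightarrow> R l t i = \<alpha> l i u + \<beta> l i u * \<xi> t"
    using relation_coefficients by blast
  define D where "D = det (mat 4 4 (\<lambda>(l, i). \<beta> l i))"
  define E where "E = (\<lambda>u. if u \<in> U then F u / L u ^ m else 0)"
  define \<omega> where "\<omega> = (\<lambda>u. if u \<in> U then N u / L u ^ d else 0)"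
  define \<omega>' where "\<omega>' = (\<lambda>u. if u \<in> U then L u ^ d / N u else 0)"
  have Lp: "(\<lambda>u. L u ^ k) \<in> ternary_forms k" for k using ternary_power[OF ternary_L, of k] by simp
  have Nnz: "N u \<noteq> 0" if "u \<in> U" for u
  proof -
    obtain x y where u: "u = divisor x y" using divisor_surj by blast
    then show ?thesis
      using transversal[of x y] transversal[of y x] that divisor_commute[of x y]
      unfolding u N(2)[symmetric] \<delta>_def by simp
  qed
  have D: "D \<in> O_plane U"
  proof -
    have "(\<lambda>u. pol (plu (\<lambda>i. \<beta> 0 i u) (\<lambda>i. \<beta> 1 i u)) (plu (\<lambda>i. \<beta> 2 i u) (\<lambda>i. \<beta> 3 i u))) \<in> O_plane U"
      unfolding pol_def plu_def by (simp, intro O_plane_closed \<beta>)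
    then show ?thesis unfolding D_def det_fun_laplace[symmetric] .
  qed
  have E: "E \<in> O_plane U"
    unfolding E_def O_plane_def using L_nonzero by (intro tf.regular_fraction[OF F Lp]) simp
  have \<omega>: "\<omega> \<in> O_plane U"
    unfolding \<omega>_def O_plane_def using L_nonzero by (intro tf.regular_fraction[OF N(1) Lp]) simp
  have \<omega>': "\<omega>' \<in> O_plane U"
    unfolding \<omega>'_def O_plane_def using Nnz by (intro tf.regular_fraction[OF Lp N(1)]) simp
  have diff: "(\<lambda>u. D u - \<omega> u * E u) \<in> O_plane (principal_open h)"
    using O_plane_closed(3)[OF D O_plane_closed(2)[OF \<omega> E]] unfolding U_def .
  have "D u - \<omega> u * E u = 0" for u
  proof (rule O_plane_zero_dense[OF h diff])
    fix u assume u: "h u \<noteq> 0" "disc u \<noteq> 0"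
    then have uU: "u \<in> U" unfolding U_def principal_open_def by simp
    obtain x y where xy: "u = divisor x y" using divisor_surj by blast
    have br: "bracket x y \<noteq> 0" using u(2) unfolding xy disc_divisor by simp
    have "D u = (L u)\<^sup>2 * N u * ((bracket x y)\<^sup>2 * F u) / ((bracket x y)\<^sup>2 * (L u ^ d)\<^sup>2)"
      using relation_det[of \<alpha> \<beta> x y, OF split uU[unfolded xy] br]
      unfolding D_def xy polar N(2) L_divisor .
    also have "\<dots> = N u / L u ^ d * (F u / L u ^ m)"
      using br L_nonzero[OF uU] by (simp add: d power2_eq_square field_simps)
    finally show "D u - \<omega> u * E u = 0" using uU by (simp add: \<omega>_def E_def)
  qed
  then have DE: "D = \<omega> * E" unfolding times_fun_def by (intro ext) simp
  have "E = \<omega>' * D"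
  proof
    fix u
    show "E u = (\<omega>' * D) u"
    proof (cases "u \<in> U")
      case True
      then show ?thesis using L_nonzero[OF True] Nnz[OF True]
        unfolding DE times_fun_apply by (simp add: \<omega>_def \<omega>'_def)
    qed (simp add: E_def \<omega>'_def)
  qed
  have "ideal_gen (O_plane U) {D} = ideal_gen (O_plane U) {E}"
  proof (rule ideal_gen_associated[OF _ \<omega> \<omega>' DE \<open>E = \<omega>' * D\<close>])
    show "a * b \<in> O_plane U" if "a \<in> O_plane U" "b \<in> O_plane U" for a b
      using O_plane_closed(2)[OF that] unfolding times_fun_def .
  qed
  moreover have "fitting_coker d \<psi> U = ideal_gen (O_plane U) {D}"
    unfolding D_def by (rule fitting_coker_det[of \<alpha> \<beta>, OF \<alpha> \<beta> split])
  ultimately show ?thesis unfolding E_def by simp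
qed

end

section \<open>The curve defined by the Fitting ideals\<close>

text \<open>The linear form and the two covectors can be chosen nondegenerate at both points of a given divisor.
  They remain so off the zeros of their norms \<open>Lf\<close> and \<open>N\<close>, which are forms on the plane.\<close>

lemma isotropic_chords_defines_curve:
  assumes mor: "is_mor d \<psi>" and d: "d = Suc (Suc m)" and F: "F \<in> ternary_forms m"
    and polar: "\<And>x y. pol (ev d \<psi> x) (ev d \<psi> y) = (bracket x y)\<^sup>2 * F (divisor x y)"
  shows "defines_curve m (fitting_coker d \<psi>) F"
  unfolding defines_curve_def
proof (intro allI impI)
  fix p :: pt2 assume p: "p \<noteq> (0, 0, 0)"
  have \<psi>: "\<psi> \<in> carrier_mat (d + 1) 6" using mor unfolding is_mor_def by blast
  have isotropic: "pol (ev d \<psi> t) (ev d \<psi> t) = 0" for t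
    unfolding polar by (simp add: bracket_def)
  obtain x y where xy: "p = divisor x y" using divisor_surj by blast
  then have nz: "x \<noteq> (0, 0)" "y \<noteq> (0, 0)" using p divisor_eq_zero by auto
  have ev_nz: "\<exists>r<6. ev d \<psi> t r \<noteq> 0" if "t \<noteq> (0, 0)" for t
  proof -
    have "mor_eval d \<psi> t \<noteq> 0\<^sub>v 6" using mor that unfolding is_mor_def by blast
    then show ?thesis
      using mor_eval_carrier[OF \<psi>, of t] unfolding ev_def by (metis carrier_vecD eq_vecI index_zero_vec)
  qed
  obtain w w' where w: "dot4 w (altmap (dual (ev d \<psi> x)) w') \<noteq> 0" "dot4 w (altmap (dual (ev d \<psi> y)) w') \<noteq> 0"
    using transversal_pair[OF ev_nz[OF nz(1)] ev_nz[OF nz(2)]] by blast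
  define dt where "dt = (\<lambda>t. dot4 w (altmap (dual (ev d \<psi> t)) w'))"
  obtain l :: "nat \<Rightarrow> complex" where l: "l 0 * fst x + l 1 * snd x \<noteq> 0" "l 0 * fst y + l 1 * snd y \<noteq> 0"
  proof -
    have ex: "\<exists>l :: nat \<Rightarrow> complex. l 0 * fst t + l 1 * snd t \<noteq> 0" if "t \<noteq> (0, 0)" for t
    proof (cases "fst t = 0")
      case True
      then have "snd t \<noteq> 0" using that by (cases t) simp
      then show ?thesis by (intro exI[of _ "unit4 1"]) simp
    next
      case False
      then show ?thesis by (intro exI[of _ "unit4 0"]) simp
    qed
    obtain a b :: "nat \<Rightarrow> complex" where ab: "a 0 * fst x + a 1 * snd x \<noteq> 0" "b 0 * fst y + b 1 * snd y \<noteq> 0"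
      using ex nz by blast
    have add: "(u 0 + v 0) * fst t + (u 1 + v 1) * snd t = (u 0 * fst t + u 1 * snd t) + (v 0 * fst t + v 1 * snd t)"
      for u v :: "nat \<Rightarrow> complex" and t :: pt1 by (simp add: algebra_simps)
    show thesis
      using common_nonvanishing[of "\<lambda>l. l 0 * fst x + l 1 * snd x" a "\<lambda>l. l 0 * fst y + l 1 * snd y" b,
          OF ab add add] that by blast
  qed
  define l1 l2 where "l1 = l 0" and "l2 = l 1"
  have l12: "l1 * fst x + l2 * snd x \<noteq> 0" "l1 * fst y + l2 * snd y \<noteq> 0"
    using l by (simp_all add: l1_def l2_def)
  obtain m1 m2 where det1: "m1 * l2 - m2 * l1 = 1"
  proof (cases "l1 = 0")
    case True
    then have "1 / l2 * l2 - 0 * l1 = 1" using l12 by auto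
    then show thesis using that by blast
  next
    case False
    then have "0 * l2 - (- 1 / l1) * l1 = 1" by simp
    then show thesis using that by blast
  qed
  define Lf where "Lf = (\<lambda>(a, b, c). l2\<^sup>2 * a + (- l1 * l2) * b + l1\<^sup>2 * c)"
  have Lf: "Lf \<in> ternary_forms 1" unfolding Lf_def by (rule ternary_linear)
  have Lf_div: "Lf (divisor s t) = (l1 * fst s + l2 * snd s) * (l1 * fst t + l2 * snd t)" for s t
    by (simp add: Lf_def divisor_def algebra_simps power2_eq_square)
  have bi: "bihom d 0 (\<lambda>s t. dt s)"
    unfolding dt_def dot4_def
    by (intro bihom_add bihom_cmult bihom_altmap[of d "\<lambda>x. dual (ev d \<psi> x)"] bihom_dual bihom_ev[OF \<psi>])
  obtain N where N: "N \<in> ternary_forms d" "\<And>s t. dt s * dt t = N (divisor s t)"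
  proof -
    have "bihom (d + 0) (0 + d) (\<lambda>s t. dt s * dt t)" by (rule bihom_mult[OF bi bihom_swap[OF bi]])
    then have "bihom d d (\<lambda>s t. dt s * dt t)" by simp
    from bihom_symmetric_descends[OF this] show thesis using that by (metis mult.commute)
  qed
  define h0 where "h0 = (\<lambda>u. Lf u * N u)"
  show "\<exists>n0>0. \<exists>h0\<in>ternary_forms n0. h0 p \<noteq> 0 \<and>
      (\<forall>n>0. \<forall>h\<in>ternary_forms n. h p \<noteq> 0 \<and> principal_open h \<subseteq> principal_open h0 \<longrightarrow>
        (\<exists>b\<in>ternary_forms m. (\<forall>u\<in>principal_open h. b u \<noteq> 0) \<and>
          fitting_coker d \<psi> (principal_open h) = ideal_gen (O_plane (principal_open h))
            {\<lambda>u. if u \<in> principal_open h then F u / b u else 0}))"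
  proof (rule exI[of _ "1 + d"], rule conjI, simp, rule bexI[of _ h0], intro conjI allI impI ballI)
    show "h0 \<in> ternary_forms (1 + d)" unfolding h0_def by (rule ternary_mult[OF Lf N(1)])
    show "h0 p \<noteq> 0" using l12 w unfolding h0_def xy Lf_div N(2)[symmetric] dt_def by simp
    fix n h assume n: "n > (0 :: nat)" and h: "h \<in> ternary_forms n"
      and hp: "h p \<noteq> 0 \<and> principal_open h \<subseteq> principal_open h0"
    have sub: "Lf u \<noteq> 0 \<and> N u \<noteq> 0" if "u \<in> principal_open h" for u
      using that hp unfolding principal_open_def h0_def by auto
    interpret psi_chart l1 l2 m1 m2 h n "principal_open h" d \<psi> w w'
    proof
      show "l1\<^sup>2 * c - l1 * l2 * b + l2\<^sup>2 * a \<noteq> 0" if "(a, b, c) \<in> principal_open h" for a b c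
        using sub[OF that] by (simp add: Lf_def algebra_simps)
      show "principal_open h \<noteq> {}" using hp unfolding principal_open_def by blast
      show "dot4 w (altmap (dual (ev d \<psi> s)) w') \<noteq> 0" if "divisor s t \<in> principal_open h" for s t
        using sub[OF that] unfolding N(2)[symmetric] dt_def by simp
    qed (use det1 h n \<psi> isotropic in auto)
    have L_eq: "L = Lf" unfolding L_def Lf_def ..
    show "\<exists>b\<in>ternary_forms m. (\<forall>u\<in>principal_open h. b u \<noteq> 0) \<and>
        fitting_coker d \<psi> (principal_open h) = ideal_gen (O_plane (principal_open h))
          {\<lambda>u. if u \<in> principal_open h then F u / b u else 0}"
    proof (rule bexI, intro conjI ballI)
      show "(\<lambda>u. Lf u ^ m) \<in> ternary_forms m" using ternary_power[OF Lf, of m] by simp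
      show "Lf u ^ m \<noteq> 0" if "u \<in> principal_open h" for u using sub[OF that] by simp
      show "fitting_coker d \<psi> (principal_open h) = ideal_gen (O_plane (principal_open h))
          {\<lambda>u. if u \<in> principal_open h then F u / Lf u ^ m else 0}"
        using fitting_coker_curve[OF d F polar N(1)] N(2) unfolding L_eq \<delta>_def dt_def by blast
    qed
  qed
qed

section \<open>Uniqueness of the curve\<close>

text \<open>The linear factors of \<open>g\<close> are taken out one by one: at a root of \<open>g\<close> the local quotient forces a root of \<open>f\<close>.\<close>

lemma poly_dvd_of_local_quotients:
  fixes f g :: "complex poly"
  assumes "g \<noteq> 0" "\<And>s. \<exists>c a. poly c s \<noteq> 0 \<and> c * f = a * g"
  shows "g dvd f"
  using assms
proof (induction "degree g" arbitrary: f g)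
  case 0
  then obtain k where "g = [:k:]" using degree_eq_zeroE by metis
  moreover have "k \<noteq> 0" using 0 \<open>g = [:k:]\<close> by auto
  ultimately have "f = g * smult (1 / k) f" by simp
  then show ?case by (rule dvdI)
next
  case (Suc e)
  then have "\<not> constant (poly g)" by (simp add: constant_degree)
  then obtain s where s: "poly g s = 0" using fundamental_theorem_of_algebra by blast
  then obtain g' where g: "g = [:- s, 1:] * g'" by (meson poly_eq_0_iff_dvd dvdE)
  obtain c a where ca: "poly c s \<noteq> 0" "c * f = a * g" using Suc.prems(2) by blast
  have "poly c s * poly f s = poly a s * poly g s" using ca(2) by (metis poly_mult)
  then have "poly f s = 0" using ca(1) s by simp
  then obtain f' where f: "f = [:- s, 1:] * f'" by (meson poly_eq_0_iff_dvd dvdE)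
  have g'0: "g' \<noteq> 0" using Suc.prems(1) g by auto
  have "degree g = Suc (degree g')" unfolding g using g'0 by (subst degree_mult_eq) auto
  then have deg: "e = degree g'" using Suc.hyps(2) by simp
  have "g' dvd f'"
  proof (rule Suc.hyps(1)[OF deg g'0])
    fix t
    obtain c a where c: "poly c t \<noteq> 0" "c * f = a * g" using Suc.prems(2) by blast
    have "[:- s, 1:] * (c * f') = [:- s, 1:] * (a * g')"
      using c(2) unfolding f g by (simp only: mult.left_commute)
    then have "c * f' = a * g'" by (subst (asm) mult_cancel_left) auto
    then show "\<exists>c a. poly c t \<noteq> 0 \<and> c * f' = a * g'" using c(1) by blast
  qed
  then show ?case unfolding f g by (rule mult_dvd_mono[OF dvd_refl])
qed

text \<open>A form that is locally a multiple of another one of the same degree is proportional to it: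
  on a line through a point where the second one is not zero, divisibility of polynomials of
  the same degree leaves only a constant factor.\<close>

lemma locally_multiple_proportional:
  assumes F: "F \<in> ternary_forms m" and G: "G \<in> ternary_forms m"
    and loc: "\<And>p. p \<noteq> (0, 0, 0) \<Longrightarrow> \<exists>e. \<exists>c\<in>ternary_forms e. \<exists>a\<in>ternary_forms e. c p \<noteq> 0 \<and> (\<forall>u. c u * F u = a u * G u)"
    and nz: "G (a0, b0, c0) \<noteq> 0"
  shows "F (a, b, c) * G (a0, b0, c0) = F (a0, b0, c0) * G (a, b, c)"
proof (cases "\<exists>s. (a + s * a0, b + s * b0, c + s * c0) = (0, 0, 0)")
  case True
  then obtain s where s: "a = (- s) * a0" "b = (- s) * b0" "c = (- s) * c0"
    by (auto simp: eq_neg_iff_add_eq_0)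
  show ?thesis unfolding s ternary_homogeneous[OF F] ternary_homogeneous[OF G] by simp
next
  case False
  obtain f where f: "degree f \<le> m" "coeff f m = F (a0, b0, c0)"
    "\<And>s. poly f s = F (a + s * a0, b + s * b0, c + s * c0)"
    using ternary_restrict_line[OF F, of a0 b0 c0 a b c] by blast
  obtain g where g: "degree g \<le> m" "coeff g m = G (a0, b0, c0)"
    "\<And>s. poly g s = G (a + s * a0, b + s * b0, c + s * c0)"
    using ternary_restrict_line[OF G, of a0 b0 c0 a b c] by blast
  have "g \<noteq> 0" using g(2) nz by auto
  have deg: "degree g = m" using g(1,2) nz le_degree[of g m] by simp
  have "g dvd f"
  proof (rule poly_dvd_of_local_quotients[OF \<open>g \<noteq> 0\<close>])
    fix s
    let ?p = "(a + s * a0, b + s * b0, c + s * c0)"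
    obtain e C A where C: "C \<in> ternary_forms e" "A \<in> ternary_forms e" "C ?p \<noteq> 0"
      "\<And>u. C u * F u = A u * G u" using loc[of ?p] False by blast
    obtain pc where pc: "\<And>s. poly pc s = C (a + s * a0, b + s * b0, c + s * c0)"
      using ternary_restrict_line[OF C(1), of a0 b0 c0 a b c] by blast
    obtain pa where pa: "\<And>s. poly pa s = A (a + s * a0, b + s * b0, c + s * c0)"
      using ternary_restrict_line[OF C(2), of a0 b0 c0 a b c] by blast
    have "poly (pc * f) = poly (pa * g)"
      by (intro ext) (simp add: pc pa f(3) g(3) C(4))
    then have "pc * f = pa * g" using poly_eq_poly_eq_iff by blast
    moreover have "poly pc s \<noteq> 0" using C(3) by (simp add: pc)
    ultimately show "\<exists>c a. poly c s \<noteq> 0 \<and> c * f = a * g" by blast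
  qed
  then obtain q where q: "f = g * q" by (rule dvdE)
  obtain k where k: "f = smult k g"
  proof (cases "q = 0")
    case True
    then have "f = smult 0 g" using q by simp
    then show thesis using that by blast
  next
    case False
    then have "degree f = m + degree q" unfolding q using \<open>g \<noteq> 0\<close> deg by (simp add: degree_mult_eq)
    then have "degree q = 0" using f(1) by simp
    then obtain k where "q = [:k:]" using degree_eq_zeroE by metis
    then have "f = smult k g" using q by simp
    then show thesis using that by blast
  qed
  have "F (a, b, c) = k * G (a, b, c)" using f(3)[of 0] g(3)[of 0] unfolding k by simp
  moreover have "F (a0, b0, c0) = k * G (a0, b0, c0)" using f(2) g(2) unfolding k by simp
  ultimately show ?thesis by simp
qed

lemma principal_member:
  assumes E: "E \<in> ideal_gen (O_plane U) {E'}"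
  shows "\<exists>\<phi>\<in>O_plane U. E = \<phi> * E'"
proof -
  obtain k :: nat and a s where E': "E = (\<Sum>i<k. a i * s i)" "\<forall>i<k. a i \<in> O_plane U \<and> s i \<in> {E'}"
    using E unfolding ideal_gen_def by blast
  have "E = (\<Sum>i<k. a i * E')" unfolding E'(1) using E'(2) by (intro sum.cong) auto
  then have "E = (\<Sum>i<k. a i) * E'" by (simp only: sum_distrib_right)
  moreover have "(\<lambda>u. \<Sum>i<k. a i u) \<in> O_plane U" using E'(2) by (intro O_plane_sum) auto
  moreover have "(\<Sum>i<k. a i) = (\<lambda>u. \<Sum>i<k. a i u)" by (intro ext) (simp add: sum_fun_eval)
  ultimately show ?thesis by metis
qed

lemma generator_member:
  assumes "\<And>u. u \<notin> U \<Longrightarrow> E u = 0"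
  shows "E \<in> ideal_gen (O_plane U) {E}"
proof -
  define e where "e = (\<lambda>u. if u \<in> U then 1 else 0 :: complex)"
  have one: "e \<in> O_plane U" unfolding e_def O_plane_def by (rule tf.regular_const)
  have "E = e * E" unfolding times_fun_def e_def using assms by (intro ext) simp
  then have E: "E = (\<Sum>i<Suc 0. e * E)"
    by (simp only: lessThan_Suc lessThan_0 sum.insert sum.empty finite.emptyI empty_iff not_False_eq_True add_0_right)
  show ?thesis unfolding ideal_gen_def
  proof (rule CollectI, rule exI[of _ "Suc 0"], rule exI[of _ "\<lambda>_. e"], rule exI[of _ "\<lambda>_. E"], rule conjI)
    show "E = (\<Sum>i<Suc 0. e * E)" by (rule E)
    show "\<forall>i<Suc 0. e \<in> O_plane U \<and> E \<in> {E}" using one by (simp only: singleton_iff simp_thms)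
  qed
qed

text \<open>Near \<open>p\<close> both local equations generate the same ideal, so \<open>F / b\<close> is a regular multiple of \<open>G / b'\<close>. The identity
  of quotients holds off the zeros of \<open>h\<close> and \<open>\<gamma>\<close>; multiplying by these makes it hold everywhere.\<close>

lemma defines_curve_locally_multiple:
  assumes F: "F \<in> ternary_forms m" and G: "G \<in> ternary_forms m"
    and dF: "defines_curve m J F" and dG: "defines_curve m J G" and p: "p \<noteq> (0, 0, 0)"
  shows "\<exists>e. \<exists>c\<in>ternary_forms e. \<exists>a\<in>ternary_forms e. c p \<noteq> 0 \<and> (\<forall>u. c u * F u = a u * G u)"
proof -
  obtain n0 h0 where h0: "n0 > 0" "h0 \<in> ternary_forms n0" "h0 p \<noteq> 0"
    and local_F: "\<forall>n>0. \<forall>h\<in>ternary_forms n. h p \<noteq> 0 \<and> principal_open h \<subseteq> principal_open h0 \<longrightarrow>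
      (\<exists>b\<in>ternary_forms m. (\<forall>u\<in>principal_open h. b u \<noteq> 0) \<and> J (principal_open h) =
        ideal_gen (O_plane (principal_open h)) {\<lambda>u. if u \<in> principal_open h then F u / b u else 0})"
    using dF[unfolded defines_curve_def, THEN spec, THEN mp, OF p] by (elim exE conjE bexE) (rule that)
  obtain n1 h1 where h1: "n1 > 0" "h1 \<in> ternary_forms n1" "h1 p \<noteq> 0"
    and local_G: "\<forall>n>0. \<forall>h\<in>ternary_forms n. h p \<noteq> 0 \<and> principal_open h \<subseteq> principal_open h1 \<longrightarrow>
      (\<exists>b\<in>ternary_forms m. (\<forall>u\<in>principal_open h. b u \<noteq> 0) \<and> J (principal_open h) =
        ideal_gen (O_plane (principal_open h)) {\<lambda>u. if u \<in> principal_open h then G u / b u else 0})"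
    using dG[unfolded defines_curve_def, THEN spec, THEN mp, OF p] by (elim exE conjE bexE) (rule that)
  define h where "h = (\<lambda>u. h0 u * h1 u)"
  have h: "h \<in> ternary_forms (n0 + n1)" unfolding h_def by (rule ternary_mult[OF h0(2) h1(2)])
  have hp: "h p \<noteq> 0" using h0(3) h1(3) by (simp add: h_def)
  have sub: "principal_open h \<subseteq> principal_open h0" "principal_open h \<subseteq> principal_open h1"
    unfolding principal_open_def h_def by auto
  have npos: "n0 + n1 > 0" using h0(1) by simp
  define U where "U = principal_open h"
  obtain b where b: "b \<in> ternary_forms m" "\<And>u. u \<in> U \<Longrightarrow> b u \<noteq> 0"
    "J U = ideal_gen (O_plane U) {\<lambda>u. if u \<in> U then F u / b u else 0}"
    using local_F[THEN spec, THEN mp, OF npos, THEN bspec, OF h, THEN mp, OF conjI[OF hp sub(1)]]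
    unfolding U_def[symmetric] by (elim bexE conjE) (rule that, auto)
  obtain b' where b': "b' \<in> ternary_forms m" "\<And>u. u \<in> U \<Longrightarrow> b' u \<noteq> 0"
    "J U = ideal_gen (O_plane U) {\<lambda>u. if u \<in> U then G u / b' u else 0}"
    using local_G[THEN spec, THEN mp, OF npos, THEN bspec, OF h, THEN mp, OF conjI[OF hp sub(2)]]
    unfolding U_def[symmetric] by (elim bexE conjE) (rule that, auto)
  have "(\<lambda>u. if u \<in> U then F u / b u else 0) \<in> ideal_gen (O_plane U) {\<lambda>u. if u \<in> U then G u / b' u else 0}"
    using generator_member[of U "\<lambda>u. if u \<in> U then F u / b u else 0"] unfolding b(3)[symmetric] b'(3) by simp
  then obtain \<phi> where \<phi>: "\<phi> \<in> O_plane U"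
    "(\<lambda>u. if u \<in> U then F u / b u else 0) = \<phi> * (\<lambda>u. if u \<in> U then G u / b' u else 0)"
    using principal_member by blast
  have eq: "F u / b u = \<phi> u * (G u / b' u)" if "u \<in> U" for u
    using \<phi>(2)[THEN fun_cong, of u] that by simp
  have "p \<in> U" using hp by (simp add: U_def principal_open_def)
  then obtain e \<alpha> \<gamma> where ag: "\<alpha> \<in> ternary_forms e" "\<gamma> \<in> ternary_forms e" "\<gamma> p \<noteq> 0"
    "\<And>u. u \<in> U \<Longrightarrow> \<gamma> u \<noteq> 0 \<Longrightarrow> \<phi> u = \<alpha> u / \<gamma> u"
    using \<phi>(1) unfolding O_plane_iff by blast
  have C: "(\<lambda>u. (h u * \<gamma> u) * (\<gamma> u * b' u)) \<in> ternary_forms (((n0 + n1) + e) + (e + m))"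
    by (intro ternary_mult h ag b')
  have A: "(\<lambda>u. (h u * \<gamma> u) * (\<alpha> u * b u)) \<in> ternary_forms (((n0 + n1) + e) + (e + m))"
    by (intro ternary_mult h ag b)
  have "(h u * \<gamma> u) * (\<gamma> u * b' u) * F u = (h u * \<gamma> u) * (\<alpha> u * b u) * G u" for u
  proof (cases "h u * \<gamma> u = 0")
    case False
    then have u: "u \<in> U" "\<gamma> u \<noteq> 0" by (auto simp: U_def principal_open_def)
    have "F u / b u = \<alpha> u / \<gamma> u * (G u / b' u)" using eq[OF u(1)] ag(4)[OF u] by simp
    then have "\<gamma> u * b' u * F u = \<alpha> u * b u * G u"
      using b(2)[OF u(1)] b'(2)[OF u(1)] u(2) by (simp add: field_simps)
    then show ?thesis by (simp add: mult.assoc)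
  next
    case True
    then show ?thesis by (simp only: mult_zero_left)
  qed
  moreover have "(h p * \<gamma> p) * (\<gamma> p * b' p) \<noteq> 0" using hp ag(3) b'(2)[OF \<open>p \<in> U\<close>] by simp
  ultimately show ?thesis
    by (intro exI[of _ "((n0 + n1) + e) + (e + m)"] bexI[OF _ C] bexI[OF _ A]) simp
qed

lemma defines_curve_unique:
  assumes F: "F \<in> ternary_forms m" "F u0 \<noteq> 0" and G: "G \<in> ternary_forms m" "G u1 \<noteq> 0"
    and dF: "defines_curve m J F" and dG: "defines_curve m J G"
  shows "\<exists>k. k \<noteq> 0 \<and> F = (\<lambda>u. k * G u)"
proof -
  obtain a0 b0 c0 where u1: "u1 = (a0, b0, c0)" by (cases u1) auto
  have "F u * G u1 = F u1 * G u" for u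
    using locally_multiple_proportional[OF F(1) G(1) defines_curve_locally_multiple[OF F(1) G(1) dF dG]]
      G(2) unfolding u1 by (cases u) blast
  then have eq: "F u = F u1 / G u1 * G u" for u using G(2) by (simp add: field_simps)
  moreover have "F u1 / G u1 \<noteq> 0" using eq[of u0] F(2) by auto
  ultimately show ?thesis by blast
qed

lemma curve_line:
  assumes C: "C \<in> curves m" and G: "G \<in> C"
  shows "C = line (\<lambda>c F u. c * F u) G" "G \<in> ternary_forms m" "\<exists>u. G u \<noteq> 0"
proof -
  obtain H where H: "H \<in> ternary_forms m" "H \<noteq> (\<lambda>_. 0)" "C = line (\<lambda>c F u. c * F u) H"
    using C unfolding curves_def by blast
  obtain c where c: "c \<noteq> 0" "G = (\<lambda>u. c * H u)" using G unfolding H(3) line_def by blast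
  show "G \<in> ternary_forms m" unfolding c(2) by (rule ternary_cmult[OF H(1)])
  show "\<exists>u. G u \<noteq> 0" using H(2) c by auto
  show "C = line (\<lambda>c F u. c * F u) G"
  proof
    show "C \<subseteq> line (\<lambda>c F u. c * F u) G"
    proof
      fix K assume "K \<in> C"
      then obtain e where "e \<noteq> 0" "K = (\<lambda>u. e * H u)" unfolding H(3) line_def by blast
      then have "e / c \<noteq> 0" "K = (\<lambda>u. e / c * G u)" using c by auto
      then show "K \<in> line (\<lambda>c F u. c * F u) G" unfolding line_def by blast
    qed
    show "line (\<lambda>c F u. c * F u) G \<subseteq> C"
    proof
      fix K assume "K \<in> line (\<lambda>c F u. c * F u) G"
      then obtain e where "e \<noteq> 0" "K = (\<lambda>u. e * G u)" unfolding line_def by blast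
      then have "e * c \<noteq> 0" "K = (\<lambda>u. e * c * H u)" using c by auto
      then show "K \<in> C" unfolding H(3) line_def by blast
    qed
  qed
qed

lemma line_scale:
  assumes "k \<noteq> 0" "F = (\<lambda>u. k * G u)"
  shows "line (\<lambda>c F u. c * F u) F = line (\<lambda>c (F :: pt2 \<Rightarrow> complex) u. c * F u) G"
proof
  show "line (\<lambda>c F u. c * F u) F \<subseteq> line (\<lambda>c F u. c * F u) G"
  proof
    fix K assume "K \<in> line (\<lambda>c F u. c * F u) F"
    then obtain e where "e \<noteq> 0" "K = (\<lambda>u. e * F u)" unfolding line_def by blast
    then have "e * k \<noteq> 0" "K = (\<lambda>u. e * k * G u)" using assms by auto
    then show "K \<in> line (\<lambda>c F u. c * F u) G" unfolding line_def by blast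
  qed
  show "line (\<lambda>c F u. c * F u) G \<subseteq> line (\<lambda>c F u. c * F u) F"
  proof
    fix K assume "K \<in> line (\<lambda>c F u. c * F u) G"
    then obtain e where "e \<noteq> 0" "K = (\<lambda>u. e * G u)" unfolding line_def by blast
    then have "e / k \<noteq> 0" "K = (\<lambda>u. e / k * F u)" using assms by auto
    then show "K \<in> line (\<lambda>c F u. c * F u) F" unfolding line_def by blast
  qed
qed

section \<open>The two morphisms\<close>

lemma ev_smult:
  assumes "\<psi> \<in> carrier_mat (d + 1) 6" "r < 6"
  shows "ev d (c \<cdot>\<^sub>m \<psi>) t r = c * ev d \<psi> t r"
proof -
  have "c \<cdot>\<^sub>m \<psi> \<in> carrier_mat (d + 1) 6" using assms(1) by simp
  then have "ev d (c \<cdot>\<^sub>m \<psi>) t r = (\<Sum>i\<in>{0..<d + 1}. (c \<cdot>\<^sub>m \<psi>) $$ (i, r) * veronese d t $ i)"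
    by (rule ev_sum[OF _ assms(2)])
  also have "\<dots> = (\<Sum>i\<in>{0..<d + 1}. c * (\<psi> $$ (i, r) * veronese d t $ i))"
    using assms by (intro sum.cong refl) auto
  also have "\<dots> = c * ev d \<psi> t r" unfolding ev_sum[OF assms] by (rule sum_distrib_left[symmetric])
  finally show ?thesis .
qed

lemma pol_ev_smult:
  assumes "\<psi> \<in> carrier_mat (d + 1) 6"
  shows "pol (ev d (c \<cdot>\<^sub>m \<psi>) x) (ev d (c \<cdot>\<^sub>m \<psi>) y) = c\<^sup>2 * pol (ev d \<psi> x) (ev d \<psi> y)"
  by (simp add: pol_def ev_smult[OF assms] power2_eq_square algebra_simps)

lemma is_mor_smult:
  assumes "is_mor d \<psi>" "c \<noteq> 0"
  shows "is_mor d (c \<cdot>\<^sub>m \<psi>)"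
proof -
  have \<psi>: "\<psi> \<in> carrier_mat (d + 1) 6" using assms(1) unfolding is_mor_def by blast
  then have c\<psi>: "c \<cdot>\<^sub>m \<psi> \<in> carrier_mat (d + 1) 6" by simp
  have "mor_eval d (c \<cdot>\<^sub>m \<psi>) t \<noteq> 0\<^sub>v 6 \<and> mor_eval d (c \<cdot>\<^sub>m \<psi>) t \<bullet> (qmat *\<^sub>v mor_eval d (c \<cdot>\<^sub>m \<psi>) t) = 0"
    if t: "t \<noteq> (0, 0)" for t
  proof
    have "mor_eval d \<psi> t \<noteq> 0\<^sub>v 6" using assms(1) t unfolding is_mor_def by blast
    then obtain r where r: "r < 6" "ev d \<psi> t r \<noteq> 0"
      using mor_eval_carrier[OF \<psi>, of t] unfolding ev_def by (metis carrier_vecD eq_vecI index_zero_vec)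
    then have "mor_eval d (c \<cdot>\<^sub>m \<psi>) t $ r \<noteq> 0"
      using ev_smult[OF \<psi> r(1), of c t] assms(2) unfolding ev_def by simp
    then show "mor_eval d (c \<cdot>\<^sub>m \<psi>) t \<noteq> 0\<^sub>v 6" using r(1) by auto
    have "mor_eval d \<psi> t \<bullet> (qmat *\<^sub>v mor_eval d \<psi> t) = 0"
      using assms(1) t unfolding is_mor_def by blast
    then have "pol (ev d \<psi> t) (ev d \<psi> t) = 0"
      unfolding ev_def pol_qmat[OF mor_eval_carrier[OF \<psi>] mor_eval_carrier[OF \<psi>]] .
    then have "pol (ev d (c \<cdot>\<^sub>m \<psi>) t) (ev d (c \<cdot>\<^sub>m \<psi>) t) = 0" by (simp add: pol_ev_smult[OF \<psi>])
    then show "mor_eval d (c \<cdot>\<^sub>m \<psi>) t \<bullet> (qmat *\<^sub>v mor_eval d (c \<cdot>\<^sub>m \<psi>) t) = 0"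
      unfolding ev_def pol_qmat[OF mor_eval_carrier[OF c\<psi>] mor_eval_carrier[OF c\<psi>]] .
  qed
  then show ?thesis using c\<psi> unfolding is_mor_def by blast
qed

text \<open>Replacing \<open>\<psi>\<close> by a multiple multiplies \<open>F\<close> by a square, so all representatives define the same line of forms.\<close>

lemma Psi_eq:
  assumes mor: "is_mor d \<psi>" and d: "d = Suc (Suc m)" and F: "F \<in> ternary_forms m" "F u0 \<noteq> 0"
    and polar: "\<And>x y. pol (ev d \<psi> x) (ev d \<psi> y) = (bracket x y)\<^sup>2 * F (divisor x y)"
  shows "Psi d (line (\<cdot>\<^sub>m) \<psi>) = line (\<lambda>c F u. c * F u) F"
proof -
  have \<psi>: "\<psi> \<in> carrier_mat (d + 1) 6" using mor unfolding is_mor_def by blast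
  have m: "d - 2 = m" using d by simp
  have self: "K \<in> line (\<lambda>c F u. c * F u) K" for K :: "pt2 \<Rightarrow> complex"
    unfolding line_def by (intro CollectI exI[of _ 1]) simp
  show ?thesis
    unfolding Psi_def m
  proof (rule the_equality)
    have "1 \<cdot>\<^sub>m \<psi> = \<psi>" by (rule eq_matI) auto
    then have "\<psi> \<in> line (\<cdot>\<^sub>m) \<psi>" unfolding line_def by (metis (mono_tags, lifting) mem_Collect_eq one_neq_zero)
    moreover have "defines_curve m (fitting_coker d \<psi>) F"
      by (rule isotropic_chords_defines_curve[OF mor d F(1) polar])
    moreover have "line (\<lambda>c F u. c * F u) F \<in> curves m"
      unfolding curves_def using F by (intro imageI) auto
    ultimately show "line (\<lambda>c F u. c * F u) F \<in> curves m \<and>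
      (\<exists>\<psi>\<in>line (\<cdot>\<^sub>m) \<psi>. \<exists>F\<in>line (\<lambda>c F u. c * F u) F. defines_curve m (fitting_coker d \<psi>) F)"
      using self by blast
  next
    fix C assume "C \<in> curves m \<and> (\<exists>\<psi>\<in>line (\<cdot>\<^sub>m) \<psi>. \<exists>F\<in>C. defines_curve m (fitting_coker d \<psi>) F)"
    then obtain c G where C: "C \<in> curves m" "c \<noteq> 0" "G \<in> C" "defines_curve m (fitting_coker d (c \<cdot>\<^sub>m \<psi>)) G"
      unfolding line_def by blast
    note G = curve_line[OF C(1,3)]
    obtain u1 where u1: "G u1 \<noteq> 0" using G(3) by blast
    define F' where "F' = (\<lambda>u. c\<^sup>2 * F u)"
    have F': "F' \<in> ternary_forms m" unfolding F'_def by (rule ternary_cmult[OF F(1)])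
    have "pol (ev d (c \<cdot>\<^sub>m \<psi>) x) (ev d (c \<cdot>\<^sub>m \<psi>) y) = (bracket x y)\<^sup>2 * F' (divisor x y)" for x y
      unfolding pol_ev_smult[OF \<psi>] polar F'_def by (rule mult.left_commute)
    then have dF': "defines_curve m (fitting_coker d (c \<cdot>\<^sub>m \<psi>)) F'"
      by (rule isotropic_chords_defines_curve[OF is_mor_smult[OF mor C(2)] d F'])
    have "F' u0 \<noteq> 0" using F(2) C(2) by (simp add: F'_def)
    from defines_curve_unique[OF G(2) u1 F' this C(4) dF']
    obtain k where k: "k \<noteq> 0" "G = (\<lambda>u. k * F' u)" by blast
    have "C = line (\<lambda>c F u. c * F u) F'" unfolding G(1) by (rule line_scale[OF k])
    also have "\<dots> = line (\<lambda>c F u. c * F u) F"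
      by (rule line_scale[of "c\<^sup>2"]) (use C(2) in \<open>simp_all add: F'_def\<close>)
    finally show "C = line (\<lambda>c F u. c * F u) F" .
  qed
qed

text \<open>The matrix \<open>B\<close> is the coefficient matrix of the pull-back of \<open>F\<close>. Conversely the quadric determines the form at
  pairs with nonzero bracket, hence everywhere.\<close>

lemma Phi_eq:
  assumes mor: "is_mor d \<psi>" and d: "d = Suc (Suc m)" and F: "F \<in> ternary_forms m" "F u0 \<noteq> 0"
    and polar: "\<And>x y. pol (ev d \<psi> x) (ev d \<psi> y) = (bracket x y)\<^sup>2 * F (divisor x y)"
  shows "Phi d (line (\<cdot>\<^sub>m) \<psi>) = line (\<lambda>c F u. c * F u) F"
proof -
  have \<psi>: "\<psi> \<in> carrier_mat (d + 1) 6" using mor unfolding is_mor_def by blast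
  have m: "d - 2 = m" "d - 1 = m + 1" using d by simp_all
  have self: "K \<in> line (\<lambda>c F u. c * F u) K" for K :: "pt2 \<Rightarrow> complex"
    unfolding line_def by (intro CollectI exI[of _ 1]) simp
  show ?thesis
    unfolding Phi_def m
  proof (rule the_equality)
    obtain B where B: "B \<in> sym_mats (m + 1)" "\<And>x y. veronese m x \<bullet> (B *\<^sub>v veronese m y) = F (divisor x y)"
      using bihom_symmetric_matrix[OF ternary_pullback[OF F(1)]] divisor_commute by metis
    let ?A = "\<psi> * qmat * transpose_mat \<psi>"
    have "?A \<in> quadrics_through_rnc d"
    proof -
      have q: "transpose_mat qmat = qmat"
      proof (rule eq_matI)
        fix i j assume "i < dim_row qmat" "j < dim_col qmat"
        then have ij: "i < 6" "j < 6" using qmat_carrier by auto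
        show "transpose_mat qmat $$ (i, j) = qmat $$ (i, j)"
          using less_6_cases[OF ij(1)] less_6_cases[OF ij(2)] qmat_carrier
          by (elim disjE) (simp_all add: qmat_def mat_of_rows_list_def)
      qed (use qmat_carrier in auto)
      have T: "transpose_mat \<psi> \<in> carrier_mat 6 (d + 1)" using \<psi> by simp
      have "transpose_mat ?A = \<psi> * (qmat * transpose_mat \<psi>)"
        using transpose_mult[OF mult_carrier_mat[OF \<psi> qmat_carrier] T] transpose_mult[OF \<psi> qmat_carrier]
        by (simp add: q)
      also have "\<dots> = ?A" using assoc_mult_mat[OF \<psi> qmat_carrier T] by simp
      finally have "?A \<in> sym_mats (d + 1)" unfolding sym_mats_def
        using mult_carrier_mat[OF mult_carrier_mat[OF \<psi> qmat_carrier] T] by blast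
      moreover have "veronese d t \<bullet> (?A *\<^sub>v veronese d t) = 0" for t
        unfolding polar_quadric[OF \<psi>] polar by (simp add: bracket_def)
      ultimately show ?thesis unfolding quadrics_through_rnc_def by blast
    qed
    moreover have "veronese d x \<bullet> (?A *\<^sub>v veronese d y) =
        (fst x * snd y - snd x * fst y) ^ 2 * (veronese m x \<bullet> (B *\<^sub>v veronese m y))" for x y
      unfolding polar_quadric[OF \<psi>] polar B(2) bracket_def ..
    ultimately have "rnc_iso d ?A B" unfolding rnc_iso_def m using B(1) by blast
    moreover have "hermite_iso m B F" unfolding hermite_iso_def using B F(1) by blast
    moreover have "\<psi> \<in> line (\<cdot>\<^sub>m) \<psi>"
    proof -
      have "1 \<cdot>\<^sub>m \<psi> = \<psi>" by (rule eq_matI) auto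
      then show ?thesis unfolding line_def by (metis (mono_tags, lifting) mem_Collect_eq one_neq_zero)
    qed
    moreover have "line (\<lambda>c F u. c * F u) F \<in> curves m"
      unfolding curves_def using F by (intro imageI) auto
    ultimately show "line (\<lambda>c F u. c * F u) F \<in> curves m \<and>
      (\<exists>\<psi>\<in>line (\<cdot>\<^sub>m) \<psi>. \<exists>B. \<exists>F\<in>line (\<lambda>c F u. c * F u) F.
        rnc_iso d (\<psi> * qmat * transpose_mat \<psi>) B \<and> hermite_iso m B F)"
      using self by blast
  next
    fix C assume "C \<in> curves m \<and> (\<exists>\<psi>\<in>line (\<cdot>\<^sub>m) \<psi>. \<exists>B. \<exists>F\<in>C.
      rnc_iso d (\<psi> * qmat * transpose_mat \<psi>) B \<and> hermite_iso m B F)"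
    then obtain c B G where C: "C \<in> curves m" "c \<noteq> 0" "G \<in> C"
      and iso: "rnc_iso d ((c \<cdot>\<^sub>m \<psi>) * qmat * transpose_mat (c \<cdot>\<^sub>m \<psi>)) B" and her: "hermite_iso m B G"
      unfolding line_def by blast
    note G = curve_line[OF C(1,3)]
    have c\<psi>: "c \<cdot>\<^sub>m \<psi> \<in> carrier_mat (d + 1) 6" using \<psi> by simp
    have eq: "c\<^sup>2 * ((bracket x y)\<^sup>2 * F (divisor x y)) = (bracket x y)\<^sup>2 * G (divisor x y)" for x y
    proof -
      have "veronese d x \<bullet> (((c \<cdot>\<^sub>m \<psi>) * qmat * transpose_mat (c \<cdot>\<^sub>m \<psi>)) *\<^sub>v veronese d y)
          = (bracket x y)\<^sup>2 * (veronese m x \<bullet> (B *\<^sub>v veronese m y))"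
        using iso unfolding rnc_iso_def m bracket_def by blast
      moreover have "veronese m x \<bullet> (B *\<^sub>v veronese m y) = G (divisor x y)"
        using her unfolding hermite_iso_def by blast
      ultimately show ?thesis unfolding polar_quadric[OF c\<psi>] pol_ev_smult[OF \<psi>] polar by simp
    qed
    have "G u - c\<^sup>2 * F u = 0" for u
    proof (rule ternary_zero_dense[OF ternary_diff[OF G(2) ternary_cmult[OF F(1)]] ternary_const[of 1]])
      show "(1 :: complex) \<noteq> 0" by simp
      fix v assume v: "disc v \<noteq> 0"
      obtain x y where xy: "v = divisor x y" using divisor_surj by blast
      then have "(bracket x y)\<^sup>2 \<noteq> 0" using v disc_divisor by metis
      moreover have "(bracket x y)\<^sup>2 * (G v - c\<^sup>2 * F v) = 0"
        using eq[of x y] unfolding xy right_diff_distrib by (simp only: mult.left_commute diff_self)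
      ultimately show "G v - c\<^sup>2 * F v = 0" by (metis mult_eq_0_iff)
    qed
    then have "G = (\<lambda>u. c\<^sup>2 * F u)" by (intro ext) simp
    then show "C = line (\<lambda>c F u. c * F u) F"
      unfolding G(1) by (intro line_scale[of "c\<^sup>2"]) (use C(2) in simp_all)
  qed
qed

theorem mainTheorem2:
  fixes d :: nat
  assumes "d \<ge> 3"
  shows "Psi d \<in> R_maps d \<rightarrow> curves (d - 2) \<and> Phi d \<in> R_maps d \<rightarrow> curves (d - 2) \<and>
    (\<forall>f\<in>R_maps d. Psi d f = Phi d f)"
proof -
  define m where "m = d - 2"
  have d: "d = Suc (Suc m)" using assms by (simp add: m_def)
  have main: "Psi d f = Phi d f \<and> Psi d f \<in> curves m" if f: "f \<in> R_maps d" for f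
  proof -
    obtain \<psi> where f': "f = line (\<cdot>\<^sub>m) \<psi>" and mor: "is_mor d \<psi>"
      and non: "\<not> (\<exists>M. isotropic_plane M \<and>
        (\<forall>t. t \<noteq> (0, 0) \<longrightarrow> mor_eval d \<psi> t \<in> {M *\<^sub>v c | c. c \<in> carrier_vec 3}))"
      using f unfolding R_maps_def by blast
    obtain F where F: "F \<in> ternary_forms m"
      "\<And>x y. pol (ev d \<psi> x) (ev d \<psi> y) = (bracket x y)\<^sup>2 * F (divisor x y)"
      using isotropic_chords_form[OF mor d] by blast
    obtain x y where "pol (ev d \<psi> x) (ev d \<psi> y) \<noteq> 0"
      using isotropic_chords_nonzero[OF mor non] by blast
    then have nz: "F (divisor x y) \<noteq> 0" using F(2) by auto
    have "line (\<lambda>c F u. c * F u) F \<in> curves m"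
      unfolding curves_def using F nz by (intro imageI) auto
    then show ?thesis
      unfolding f' Psi_eq[OF mor d F(1) nz F(2)] Phi_eq[OF mor d F(1) nz F(2)] by simp
  qed
  then show ?thesis unfolding m_def[symmetric] by fastforce
qed

end
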